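(* Let $\mathfrak{g}$ be a reductive Lie algebra, $\mathfrak{a}\hookrightarrow\mathfrak{g}$ a reductive subalgebra, and $\mathfrak{a}_\perp$ the orthogonal partner of $\mathfrak{a}$, with $\mathfrak{h}=\mathfrak{h}_{\mathfrak{a}}\oplus\mathfrak{h}_{\mathfrak{a}_\perp}\oplus\mathfrak{h}_\perp$, $\widetilde{\mathfrak{a}_\perp}=\mathfrak{a}_\perp\oplus\mathfrak{h}_\perp$ and $\widetilde{\mathfrak{a}}=\mathfrak{a}\oplus\mathfrak{h}_\perp$. Let $L^\mu$ be the integrable highest weight $\mathfrak{g}$-module with highest weight $\mu\in P^+$, and let $\Psi^{(\mu)}=\sum_{w\in W}\epsilon(w)e^{w(\mu+\rho)-\rho}$ be its singular element. Then $\Psi^{(\mu)}$ decomposes into the sum over $u\in U$ of the singular elements $\Psi_{\mathfrak{a}_\perp}^{(\mu_{\mathfrak{a}_\perp}(u))}$ with coefficients $\epsilon(u)e^{\mu_{\widetilde{\mathfrak{a}}}(u)}$: $$\Psi^{(\mu)}=\sum_{u\in U}\epsilon(u)\,e^{\mu_{\widetilde{\mathfrak{a}}}(u)}\,\Psi_{\mathfrak{a}_\perp}^{(\mu_{\mathfrak{a}_\perp}(u))}.$$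
   Context: $\mathfrak{g}$ is a (finite-dimensional, complex) reductive Lie algebra with Cartan subalgebra $\mathfrak{h}$, root system $\Delta$, positive roots $\Delta^+$, Weyl group $W$, $\epsilon(w)=(-1)^{\mathrm{length}(w)}$, Weyl vector $\rho=\frac12\sum_{\alpha\in\Delta^+}\alpha$, and dominant integral weights $P^+$. $\mathfrak{a}\subset\mathfrak{g}$ is a reductive subalgebra with Cartan subalgebra $\mathfrak{h}_{\mathfrak{a}}\subset\mathfrak{h}$. Orthogonal partner: $\Delta_{\mathfrak{a}_\perp}=\{\beta\in\Delta:\beta(h)=0\ \forall h\in\mathfrak{h}_{\mathfrak{a}}\}$ and $\Delta^+_{\mathfrak{a}_\perp}=\Delta_{\mathfrak{a}_\perp}\cap\Delta^+$. $\mathfrak{a}_\perp$ is the regular subalgebra of $\mathfrak{g}$ determined by $\Delta_{\mathfrak{a}_\perp}$, i.e. generated by the root spaces $\mathfrak{g}_\beta$, $\beta\in\Delta_{\mathfrak{a}_\perp}$; its Cartan subalgebra $\mathfrak{h}_{\mathfrak{a}_\perp}$ is spanned by the coroots of $\Delta_{\mathfrak{a}_\perp}$. $W_{\mathfrak{a}_\perp}\subset W$ is the subgroup generated by the reflections in the roots of $\Delta^+_{\mathfrak{a}_\perp}$, and $\rho_{\mathfrak{a}_\perp}=\frac12\sum_{\beta\in\Delta^+_{\mathfrak{a}_\perp}}\beta$. $\mathfrak{h}_\perp$ is the orthogonal complement of $\mathfrak{h}_{\mathfrak{a}}\oplus\mathfrak{h}_{\mathfrak{a}_\perp}$ in $\mathfrak{h}$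 with respect to the invariant (Killing) form, so $\mathfrak{h}=\mathfrak{h}_{\mathfrak{a}}\oplus\mathfrak{h}_{\mathfrak{a}_\perp}\oplus\mathfrak{h}_\perp$ is an orthogonal decomposition. Correspondingly $\mathfrak{h}^*=\mathfrak{h}_{\mathfrak{a}}^*\oplus\mathfrak{h}_{\mathfrak{a}_\perp}^*\oplus\mathfrak{h}_\perp^*$; $\mathfrak{h}_{\widetilde{\mathfrak{a}}}^*=\mathfrak{h}_{\mathfrak{a}}^*\oplus\mathfrak{h}_\perp^*$; and $\pi_{\mathfrak{a}_\perp}$, $\pi_{\widetilde{\mathfrak{a}}}$ are the projections of $\mathfrak{h}^*$ onto $\mathfrak{h}_{\mathfrak{a}_\perp}^*$ and $\mathfrak{h}_{\widetilde{\mathfrak{a}}}^*$ along this decomposition (all these are regarded as subspaces of $\mathfrak{h}^*$). Defect: $\mathcal{D}_{\mathfrak{a}_\perp}=\rho_{\mathfrak{a}_\perp}-\pi_{\mathfrak{a}_\perp}\rho$. For $w\in W$ put $$\mu_{\mathfrak{a}_\perp}(w)=\pi_{\mathfrak{a}_\perp}[w(\mu+\rho)-\rho]-\mathcal{D}_{\mathfrak{a}_\perp},\qquad \mu_{\widetilde{\mathfrak{a}}}(w)=\pi_{\widetilde{\mathfrak{a}}}[w(\mu+\rho)-\rho]+\mathcal{D}_{\mathfrak{a}_\perp}.$$ $U=\{u\in W:\mu_{\mathfrak{a}_\perp}(u)\in\overline{C_{\mathfrak{a}_\perp}}\}$, where $\overline{C_{\mathfrak{a}_\perp}}$ is the closed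 fundamental Weyl chamber of $\mathfrak{a}_\perp$ (weights pairing non-negatively with all coroots of $\Delta^+_{\mathfrak{a}_\perp}$); $U$ is a set of representatives for the classes of $W$ modulo left multiplication by $W_{\mathfrak{a}_\perp}$. For a weight $\nu$ of $\mathfrak{a}_\perp$, $\Psi_{\mathfrak{a}_\perp}^{(\nu)}=\sum_{v\in W_{\mathfrak{a}_\perp}}\epsilon(v)e^{v(\nu+\rho_{\mathfrak{a}_\perp})-\rho_{\mathfrak{a}_\perp}}$, where $\epsilon$ is the sign character. Here $e^\lambda$, $\lambda\in\mathfrak{h}^*$, are formal exponentials with $e^\lambda e^{\lambda'}=e^{\lambda+\lambda'}$. *)

theory Defs
  imports
    Complex_Main
    "HOL-Library.Function_Algebras"
    "HOL-Library.Nonpos_Ints"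
    "HOL-Library.Poly_Mapping"
    "HOL-Algebra.Bij"
    "HOL-Algebra.Generated_Groups"
begin

section \<open>Finite-dimensional complex Lie algebras\<close>

class fin_dim_complex_lie_algebra = ab_group_add +
  fixes scaleC :: "complex \<Rightarrow> 'a \<Rightarrow> 'a"  (infixr \<open>*\<^sub>C\<close> 75)
    and bracket :: "'a \<Rightarrow> 'a \<Rightarrow> 'a"
  assumes scaleC_add_right: "c *\<^sub>C (x + y) = c *\<^sub>C x + c *\<^sub>C y"
    and scaleC_add_left: "(c + d) *\<^sub>C x = c *\<^sub>C x + d *\<^sub>C x"
    and scaleC_scaleC: "c *\<^sub>C d *\<^sub>C x = (c * d) *\<^sub>C x"
    and scaleC_one: "1 *\<^sub>C x = x"
    and bracket_add_left: "bracket (x + y) z = bracket x z + bracket y z"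
    and bracket_add_right: "bracket x (y + z) = bracket x y + bracket x z"
    and bracket_scaleC_left: "bracket (c *\<^sub>C x) y = c *\<^sub>C bracket x y"
    and bracket_scaleC_right: "bracket x (c *\<^sub>C y) = c *\<^sub>C bracket x y"
    and bracket_self: "bracket x x = 0"
    and jacobi: "bracket x (bracket y z) + bracket y (bracket z x) + bracket z (bracket x y) = 0"
    and finite_dim: "\<exists>b. finite b \<and> (\<forall>x. \<exists>c. x = (\<Sum>v\<in>b. c v *\<^sub>C v))"

global_interpretation lie: vector_space
  "scaleC :: complex \<Rightarrow> 'g \<Rightarrow> 'g::fin_dim_complex_lie_algebra"
  by unfold_locales
    (fact scaleC_add_right scaleC_add_left scaleC_scaleC scaleC_one)+

definition lie_subalgebra :: "'g::fin_dim_complex_lie_algebra set \<Rightarrow> bool" where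
  "lie_subalgebra S \<longleftrightarrow> lie.subspace S \<and> (\<forall>x\<in>S. \<forall>y\<in>S. bracket x y \<in> S)"

definition lie_ideal :: "'g::fin_dim_complex_lie_algebra set \<Rightarrow> 'g set \<Rightarrow> bool" where
  "lie_ideal I S \<longleftrightarrow> lie.subspace I \<and> I \<subseteq> S \<and> (\<forall>x\<in>S. \<forall>y\<in>I. bracket x y \<in> I)"

text \<open>A Lie algebra is reductive if each of its ideals has a complementary ideal, that is, if
  the adjoint representation is completely reducible.\<close>

definition reductive :: "'g::fin_dim_complex_lie_algebra set \<Rightarrow> bool" where
  "reductive S \<longleftrightarrow> lie_subalgebra S \<and>
    (\<forall>I. lie_ideal I S \<longrightarrow>
      (\<exists>J. lie_ideal J S \<and> (\<forall>x\<in>S. \<exists>y\<in>I. \<exists>z\<in>J. x = y + z) \<and> I \<inter> J = {0}))"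

text \<open>The usual definition of a Cartan subalgebra of a complex reductive Lie algebra: a
  commutative subalgebra which is its own centralizer and all of whose elements are
  ad-diagonalizable (the eigenvectors of \<open>ad h\<close> span). In a reductive Lie algebra these are
  exactly the nilpotent self-normalizing subalgebras.\<close>

definition cartan_subalgebra :: "'g::fin_dim_complex_lie_algebra set \<Rightarrow> 'g set \<Rightarrow> bool" where
  "cartan_subalgebra S H \<longleftrightarrow> lie.subspace H \<and> H \<subseteq> S \<and>
    (\<forall>h\<in>H. \<forall>k\<in>H. bracket h k = 0) \<and>
    (\<forall>x\<in>S. (\<forall>h\<in>H. bracket h x = 0) \<longrightarrow> x \<in> H) \<and>
    (\<forall>h\<in>H. lie.span {x\<in>S. \<exists>c. bracket h x = c *\<^sub>C x} = S)"

text \<open>On a reductive Lie algebra the Killing form is degenerate on the centre, so the orthogonal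
  complement is taken with respect to a nondegenerate invariant symmetric form.\<close>

definition invariant_form ::
    "('g::fin_dim_complex_lie_algebra \<Rightarrow> 'g \<Rightarrow> complex) \<Rightarrow> bool" where
  "invariant_form B \<longleftrightarrow>
    (\<forall>x. Vector_Spaces.linear scaleC (*) (B x)) \<and>
    (\<forall>x y. B x y = B y x) \<and>
    (\<forall>x y z. B (bracket x y) z = B x (bracket y z)) \<and>
    (\<forall>x. (\<forall>y. B x y = 0) \<longrightarrow> x = 0)"


section \<open>Roots, weights and the Weyl group\<close>

text \<open>The whole type is the Lie algebra; \<open>H\<close> is a Cartan subalgebra of it. A linear functional
  on \<open>H\<close> is represented by its extension by zero to the whole type, so that equal functionals
  are equal functions and the pointwise operations are those of the dual space.\<close>

definition dual :: "'g::fin_dim_complex_lie_algebra set \<Rightarrow> ('g \<Rightarrow> complex) set" where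
  "dual H = {f. (\<forall>x\<in>H. \<forall>y\<in>H. f (x + y) = f x + f y) \<and>
    (\<forall>c. \<forall>x\<in>H. f (c *\<^sub>C x) = c * f x) \<and> (\<forall>x. x \<notin> H \<longrightarrow> f x = 0)}"

definition root_space ::
    "'g::fin_dim_complex_lie_algebra set \<Rightarrow> ('g \<Rightarrow> complex) \<Rightarrow> 'g set" where
  "root_space H \<alpha> = {x. \<forall>h\<in>H. bracket h x = \<alpha> h *\<^sub>C x}"

definition roots :: "'g::fin_dim_complex_lie_algebra set \<Rightarrow> ('g \<Rightarrow> complex) set" where
  "roots H = {\<alpha>\<in>dual H. \<alpha> \<noteq> 0 \<and> root_space H \<alpha> \<noteq> {0}}"

definition coroot :: "'g::fin_dim_complex_lie_algebra set \<Rightarrow> ('g \<Rightarrow> complex) \<Rightarrow> 'g" where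
  "coroot H \<alpha> = (THE h.
    h \<in> lie.span {bracket x y | x y. x \<in> root_space H \<alpha> \<and> y \<in> root_space H (- \<alpha>)} \<and> \<alpha> h = 2)"

text \<open>A set of simple roots; choosing it is the same as choosing the positive roots.\<close>

definition root_base ::
    "'g::fin_dim_complex_lie_algebra set \<Rightarrow> ('g \<Rightarrow> complex) set \<Rightarrow> bool" where
  "root_base H \<Gamma> \<longleftrightarrow> finite \<Gamma> \<and> \<Gamma> \<subseteq> roots H \<and>
    (\<forall>c :: _ \<Rightarrow> complex. (\<forall>x. (\<Sum>\<alpha>\<in>\<Gamma>. c \<alpha> * \<alpha> x) = 0) \<longrightarrow> (\<forall>\<alpha>\<in>\<Gamma>. c \<alpha> = 0)) \<and>
    (\<forall>\<beta>\<in>roots H. \<exists>n :: _ \<Rightarrow> nat.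
      \<beta> = (\<lambda>x. \<Sum>\<alpha>\<in>\<Gamma>. of_nat (n \<alpha>) * \<alpha> x) \<or> \<beta> = (\<lambda>x. - (\<Sum>\<alpha>\<in>\<Gamma>. of_nat (n \<alpha>) * \<alpha> x)))"

definition pos_roots ::
    "'g::fin_dim_complex_lie_algebra set \<Rightarrow> ('g \<Rightarrow> complex) set \<Rightarrow> ('g \<Rightarrow> complex) set" where
  "pos_roots H \<Gamma> = {\<beta>\<in>roots H. \<exists>n :: _ \<Rightarrow> nat. \<beta> = (\<lambda>x. \<Sum>\<alpha>\<in>\<Gamma>. of_nat (n \<alpha>) * \<alpha> x)}"

definition half_sum :: "('g \<Rightarrow> complex) set \<Rightarrow> 'g \<Rightarrow> complex" where
  "half_sum \<Phi> = (\<lambda>x. (\<Sum>\<alpha>\<in>\<Phi>. \<alpha> x) / 2)"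

definition dominant_integral ::
    "'g::fin_dim_complex_lie_algebra set \<Rightarrow> ('g \<Rightarrow> complex) set \<Rightarrow> ('g \<Rightarrow> complex) set" where
  "dominant_integral H \<Gamma> = {\<mu>\<in>dual H. \<forall>\<alpha>\<in>pos_roots H \<Gamma>. \<mu> (coroot H \<alpha>) \<in> \<nat>}"

definition reflection ::
    "'g::fin_dim_complex_lie_algebra set \<Rightarrow> ('g \<Rightarrow> complex) \<Rightarrow> ('g \<Rightarrow> complex) \<Rightarrow> 'g \<Rightarrow> complex" where
  "reflection H \<alpha> = (\<lambda>\<nu>\<in>dual H. (\<lambda>x. \<nu> x - \<nu> (coroot H \<alpha>) * \<alpha> x))"

definition weyl_group ::
    "'g::fin_dim_complex_lie_algebra set \<Rightarrow> ('g \<Rightarrow> complex) set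
      \<Rightarrow> (('g \<Rightarrow> complex) \<Rightarrow> 'g \<Rightarrow> complex) set" where
  "weyl_group H \<Phi> = generate (BijGroup (dual H)) (reflection H ` \<Phi>)"

definition weyl_length ::
    "'g::fin_dim_complex_lie_algebra set \<Rightarrow> ('g \<Rightarrow> complex) set
      \<Rightarrow> (('g \<Rightarrow> complex) \<Rightarrow> 'g \<Rightarrow> complex) \<Rightarrow> nat" where
  "weyl_length H \<Gamma> w = (LEAST n. \<exists>as. length as = n \<and> set as \<subseteq> \<Gamma> \<and>
    w = foldr (\<lambda>\<alpha> v. reflection H \<alpha> \<otimes>\<^bsub>BijGroup (dual H)\<^esub> v) as \<one>\<^bsub>BijGroup (dual H)\<^esub>)"

definition weyl_sign ::
    "'g::fin_dim_complex_lie_algebra set \<Rightarrow> ('g \<Rightarrow> complex) set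
      \<Rightarrow> (('g \<Rightarrow> complex) \<Rightarrow> 'g \<Rightarrow> complex) \<Rightarrow> int" where
  "weyl_sign H \<Gamma> w = (- 1) ^ weyl_length H \<Gamma> w"


section \<open>Formal exponentials and singular elements\<close>

text \<open>Multiplication of finitely supported functions is convolution, so \<open>fexp\<close> turns sums into
  products.\<close>

definition fexp :: "('g \<Rightarrow> complex) \<Rightarrow> ('g \<Rightarrow> complex) \<Rightarrow>\<^sub>0 int" where
  "fexp \<nu> = Poly_Mapping.single \<nu> 1"

text \<open>For \<open>\<Phi> = roots H\<close> and \<open>\<Phi>\<^sup>+ = pos_roots H \<Gamma>\<close> this is the singular element of the
  ambient algebra. For a root subsystem \<open>\<Phi>\<close> with positive roots \<open>\<Phi>\<^sup>+\<close> it is that of the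
  corresponding regular subalgebra; the sign character of the smaller Weyl group is the
  restriction of that of the larger one.\<close>

definition singular_element ::
    "'g::fin_dim_complex_lie_algebra set \<Rightarrow> ('g \<Rightarrow> complex) set \<Rightarrow> ('g \<Rightarrow> complex) set
      \<Rightarrow> ('g \<Rightarrow> complex) set \<Rightarrow> ('g \<Rightarrow> complex) \<Rightarrow> ('g \<Rightarrow> complex) \<Rightarrow>\<^sub>0 int" where
  "singular_element H \<Gamma> \<Phi> \<Phi>p \<nu> =
    (\<Sum>w\<in>weyl_group H \<Phi>. of_int (weyl_sign H \<Gamma> w) * fexp (w (\<nu> + half_sum \<Phi>p) - half_sum \<Phi>p))"


section \<open>The orthogonal partner\<close>

text \<open>Throughout, \<open>Ha\<close> is the Cartan subalgebra of the reductive subalgebra, contained in \<open>H\<close>.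
  The orthogonal partner is the regular subalgebra with root system \<open>orth_roots H Ha\<close>; its
  Cartan subalgebra is \<open>orth_cartan H Ha\<close> and its Weyl group is
  \<open>weyl_group H (orth_pos_roots H Ha \<Gamma>)\<close>.\<close>

definition orth_roots ::
    "'g::fin_dim_complex_lie_algebra set \<Rightarrow> 'g set \<Rightarrow> ('g \<Rightarrow> complex) set" where
  "orth_roots H Ha = {\<beta>\<in>roots H. \<forall>h\<in>Ha. \<beta> h = 0}"

definition orth_pos_roots ::
    "'g::fin_dim_complex_lie_algebra set \<Rightarrow> 'g set \<Rightarrow> ('g \<Rightarrow> complex) set
      \<Rightarrow> ('g \<Rightarrow> complex) set" where
  "orth_pos_roots H Ha \<Gamma> = orth_roots H Ha \<inter> pos_roots H \<Gamma>"

definition orth_cartan :: "'g::fin_dim_complex_lie_algebra set \<Rightarrow> 'g set \<Rightarrow> 'g set" where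
  "orth_cartan H Ha = lie.span (coroot H ` orth_roots H Ha)"

definition orth_rest ::
    "('g::fin_dim_complex_lie_algebra \<Rightarrow> 'g \<Rightarrow> complex) \<Rightarrow> 'g set \<Rightarrow> 'g set \<Rightarrow> 'g set" where
  "orth_rest B H Ha = {x\<in>H. \<forall>a\<in>Ha. \<forall>b\<in>orth_cartan H Ha. B x (a + b) = 0}"

definition direct_sum3 ::
    "'g::fin_dim_complex_lie_algebra set \<Rightarrow> 'g set \<Rightarrow> 'g set \<Rightarrow> 'g set \<Rightarrow> bool" where
  "direct_sum3 V K L M \<longleftrightarrow> V = {x + y + z | x y z. x \<in> K \<and> y \<in> L \<and> z \<in> M} \<and>
    (\<forall>x\<in>K. \<forall>y\<in>L. \<forall>z\<in>M. x + y + z = 0 \<longrightarrow> x = 0 \<and> y = 0 \<and> z = 0)"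

text \<open>The dual of one summand of \<open>H\<close>, regarded as a subspace of \<open>dual H\<close>, consists of the
  functionals vanishing on the other summands.\<close>

definition annihilator ::
    "'g::fin_dim_complex_lie_algebra set \<Rightarrow> 'g set \<Rightarrow> ('g \<Rightarrow> complex) set" where
  "annihilator H K = {\<nu>\<in>dual H. \<forall>x\<in>K. \<nu> x = 0}"

definition sub_dual ::
    "('g::fin_dim_complex_lie_algebra \<Rightarrow> 'g \<Rightarrow> complex) \<Rightarrow> 'g set \<Rightarrow> 'g set
      \<Rightarrow> ('g \<Rightarrow> complex) set" where
  "sub_dual B H Ha = annihilator H (orth_cartan H Ha \<union> orth_rest B H Ha)"

definition orth_dual ::
    "('g::fin_dim_complex_lie_algebra \<Rightarrow> 'g \<Rightarrow> complex) \<Rightarrow> 'g set \<Rightarrow> 'g set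
      \<Rightarrow> ('g \<Rightarrow> complex) set" where
  "orth_dual B H Ha = annihilator H (Ha \<union> orth_rest B H Ha)"

definition rest_dual :: "'g::fin_dim_complex_lie_algebra set \<Rightarrow> 'g set \<Rightarrow> ('g \<Rightarrow> complex) set" where
  "rest_dual H Ha = annihilator H (Ha \<union> orth_cartan H Ha)"

definition tilde_dual ::
    "('g::fin_dim_complex_lie_algebra \<Rightarrow> 'g \<Rightarrow> complex) \<Rightarrow> 'g set \<Rightarrow> 'g set
      \<Rightarrow> ('g \<Rightarrow> complex) set" where
  "tilde_dual B H Ha = {\<kappa> + \<nu> | \<kappa> \<nu>. \<kappa> \<in> sub_dual B H Ha \<and> \<nu> \<in> rest_dual H Ha}"

definition proj_along :: "'b::ab_group_add set \<Rightarrow> 'b set \<Rightarrow> 'b \<Rightarrow> 'b" where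
  "proj_along K L x = (THE y. y \<in> K \<and> x - y \<in> L)"

definition proj_orth ::
    "('g::fin_dim_complex_lie_algebra \<Rightarrow> 'g \<Rightarrow> complex) \<Rightarrow> 'g set \<Rightarrow> 'g set
      \<Rightarrow> ('g \<Rightarrow> complex) \<Rightarrow> 'g \<Rightarrow> complex" where
  "proj_orth B H Ha = proj_along (orth_dual B H Ha) (tilde_dual B H Ha)"

definition proj_tilde ::
    "('g::fin_dim_complex_lie_algebra \<Rightarrow> 'g \<Rightarrow> complex) \<Rightarrow> 'g set \<Rightarrow> 'g set
      \<Rightarrow> ('g \<Rightarrow> complex) \<Rightarrow> 'g \<Rightarrow> complex" where
  "proj_tilde B H Ha = proj_along (tilde_dual B H Ha) (orth_dual B H Ha)"

definition defect ::
    "('g::fin_dim_complex_lie_algebra \<Rightarrow> 'g \<Rightarrow> complex) \<Rightarrow> 'g set \<Rightarrow> 'g set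
      \<Rightarrow> ('g \<Rightarrow> complex) set \<Rightarrow> 'g \<Rightarrow> complex" where
  "defect B H Ha \<Gamma> =
    half_sum (orth_pos_roots H Ha \<Gamma>) - proj_orth B H Ha (half_sum (pos_roots H \<Gamma>))"

definition weight_orth ::
    "('g::fin_dim_complex_lie_algebra \<Rightarrow> 'g \<Rightarrow> complex) \<Rightarrow> 'g set \<Rightarrow> 'g set
      \<Rightarrow> ('g \<Rightarrow> complex) set \<Rightarrow> ('g \<Rightarrow> complex)
      \<Rightarrow> (('g \<Rightarrow> complex) \<Rightarrow> 'g \<Rightarrow> complex) \<Rightarrow> 'g \<Rightarrow> complex" where
  "weight_orth B H Ha \<Gamma> \<mu> w =
    proj_orth B H Ha (w (\<mu> + half_sum (pos_roots H \<Gamma>)) - half_sum (pos_roots H \<Gamma>))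
      - defect B H Ha \<Gamma>"

definition weight_tilde ::
    "('g::fin_dim_complex_lie_algebra \<Rightarrow> 'g \<Rightarrow> complex) \<Rightarrow> 'g set \<Rightarrow> 'g set
      \<Rightarrow> ('g \<Rightarrow> complex) set \<Rightarrow> ('g \<Rightarrow> complex)
      \<Rightarrow> (('g \<Rightarrow> complex) \<Rightarrow> 'g \<Rightarrow> complex) \<Rightarrow> 'g \<Rightarrow> complex" where
  "weight_tilde B H Ha \<Gamma> \<mu> w =
    proj_tilde B H Ha (w (\<mu> + half_sum (pos_roots H \<Gamma>)) - half_sum (pos_roots H \<Gamma>))
      + defect B H Ha \<Gamma>"

definition orth_chamber ::
    "('g::fin_dim_complex_lie_algebra \<Rightarrow> 'g \<Rightarrow> complex) \<Rightarrow> 'g set \<Rightarrow> 'g set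
      \<Rightarrow> ('g \<Rightarrow> complex) set \<Rightarrow> ('g \<Rightarrow> complex) set" where
  "orth_chamber B H Ha \<Gamma> =
    {\<nu>\<in>orth_dual B H Ha. \<forall>\<beta>\<in>orth_pos_roots H Ha \<Gamma>. \<nu> (coroot H \<beta>) \<in> \<real>\<^sub>\<ge>\<^sub>0}"

definition weyl_reps ::
    "('g::fin_dim_complex_lie_algebra \<Rightarrow> 'g \<Rightarrow> complex) \<Rightarrow> 'g set \<Rightarrow> 'g set
      \<Rightarrow> ('g \<Rightarrow> complex) set \<Rightarrow> ('g \<Rightarrow> complex)
      \<Rightarrow> (('g \<Rightarrow> complex) \<Rightarrow> 'g \<Rightarrow> complex) set" where
  "weyl_reps B H Ha \<Gamma> \<mu> =
    {u\<in>weyl_group H (roots H). weight_orth B H Ha \<Gamma> \<mu> u \<in> orth_chamber B H Ha \<Gamma>}"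

definition singular_full ::
    "'g::fin_dim_complex_lie_algebra set \<Rightarrow> ('g \<Rightarrow> complex) set
      \<Rightarrow> ('g \<Rightarrow> complex) \<Rightarrow> ('g \<Rightarrow> complex) \<Rightarrow>\<^sub>0 int" where
  "singular_full H \<Gamma> = singular_element H \<Gamma> (roots H) (pos_roots H \<Gamma>)"

definition singular_orth ::
    "'g::fin_dim_complex_lie_algebra set \<Rightarrow> 'g set \<Rightarrow> ('g \<Rightarrow> complex) set
      \<Rightarrow> ('g \<Rightarrow> complex) \<Rightarrow> ('g \<Rightarrow> complex) \<Rightarrow>\<^sub>0 int" where
  "singular_orth H Ha \<Gamma> =
    singular_element H \<Gamma> (orth_pos_roots H Ha \<Gamma>) (orth_pos_roots H Ha \<Gamma>)"

end

theory Submission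
  imports Defs
begin

text \<open>
  For \<open>v\<close> in the small Weyl group and \<open>u \<in> U\<close> the exponents add up to
  \<open>v (u (\<mu> + \<rho>)) - \<rho>\<close>, since \<open>v\<close> fixes the complement of the dual of the Cartan subalgebra of the
  orthogonal partner pointwise. So the claim is that \<open>(v, u) \<mapsto> v u\<close> is a bijection onto the Weyl
  group and that the sign is multiplicative. The condition defining \<open>U\<close> says that \<open>u (\<mu> + \<rho>)\<close> is
  strictly dominant for the orthogonal partner, and \<open>\<mu> + \<rho>\<close> is regular; hence every coset has a
  representative (maximize the height), and uniqueness is the fact that an element of a Weyl group
  preserving the positive roots is trivial. The latter comes from the exchange condition, which
  deletes letters two at a time and so also shows that the parity of the length of a word in
  simple reflections depends only on its product. The root theory needed is derived from
  \<open>sl\<^sub>2\<close>-strings.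
\<close>

text \<open>The form \<open>B\<close> is complex and arbitrary, so it offers no positivity and no
  Euclidean structure on the roots. Signs come from elsewhere: from the integrality of sl_2-strings,
  from a sum of squares over the roots which forces the two pairings of a pair of roots to have
  equal sign, and from a linear functional \<open>ht\<close> with value 1 on the base, whose real
  part separates positive from negative roots. Reductivity enters through a complement to a central
  line, which excludes isotropic roots.

  The simple roots of the orthogonal partner need not belong to \<open>\<Gamma>\<close>. Positive
  systems are therefore treated for the roots vanishing on a set \<open>K\<close>, with the
  indecomposable positive roots as simple roots. The sign, by contrast, is always measured by words
  in \<open>\<Gamma>\<close>, also on the small group, so multiplicativity is a matter of the full
  Weyl group alone.

  The condition on \<open>U\<close> is a weak inequality for a weight shifted by
  \<open>\<rho>p\<close>, while strict dominance of \<open>u (\<mu> + \<rho>)\<close> is wanted; the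
  two match because the pairings are integers and the half sum pairs to 1 with every simple
  coroot.\<close>

lemma bracket_minus_right: "bracket x (- y) = - bracket x (y::'g::fin_dim_complex_lie_algebra)"
  by (metis add.inverse_unique add.right_inverse add_cancel_left_left bracket_add_right)

lemma bracket_diff_right:
  "bracket x (y - z) = bracket x y - bracket x (z::'g::fin_dim_complex_lie_algebra)"
  by (metis bracket_add_right bracket_minus_right diff_conv_add_uminus)

lemma bracket_zero_left [simp]: "bracket 0 (y::'g::fin_dim_complex_lie_algebra) = 0"
  by (metis add_cancel_left_left bracket_add_left)

lemma bracket_zero_right [simp]: "bracket y (0::'g::fin_dim_complex_lie_algebra) = 0"
  by (metis add_cancel_left_left bracket_add_right)

lemma bracket_sum_right:
  "bracket x (sum f A) = (\<Sum>a\<in>A. bracket x (f a::'g::fin_dim_complex_lie_algebra))"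
  by (induction A rule: infinite_finite_induct) (simp_all add: bracket_add_right)

lemma bracket_commute: "bracket x (y::'g::fin_dim_complex_lie_algebra) = - bracket y x"
proof -
  have "bracket x y + bracket y x = 0"
    using bracket_self[of "x + y"]
    by (simp only: bracket_add_left bracket_add_right) (simp add: bracket_self add.commute)
  then show ?thesis
    by (simp add: eq_neg_iff_add_eq_0)
qed

text \<open>The Jacobi identity in derivation form; computations along root strings commute
  operators past each other with it.\<close>

lemma bracket_bracket:
  "bracket x (bracket y z) =
    bracket (bracket x y) z + bracket y (bracket x (z::'g::fin_dim_complex_lie_algebra))"
proof -
  have "bracket x (bracket y z) + (bracket y (bracket z x) + bracket z (bracket x y)) = 0"
    using jacobi[of x y z] by (simp add: add.assoc)
  then have "bracket x (bracket y z) = - bracket y (bracket z x) - bracket z (bracket x y)"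
    by (simp add: eq_neg_iff_add_eq_0 algebra_simps)
  also have "bracket z x = - bracket x z" by (rule bracket_commute)
  also have "bracket z (bracket x y) = - bracket (bracket x y) z" by (rule bracket_commute)
  finally show ?thesis by (simp add: bracket_minus_right)
qed

section \<open>Eigenvectors of a single operator \<open>bracket h\<close>\<close>

text \<open>Applying \<open>bracket h\<close> minus \<open>a\<close> to the relation removes the
  term of eigenvalue \<open>a\<close> and multiplies every other term by the nonzero factor
  \<open>c - a\<close>, which leaves a shorter relation.\<close>

lemma eigenvectors_sum_zero:
  fixes w :: "complex \<Rightarrow> 'g::fin_dim_complex_lie_algebra"
  assumes "finite C" "\<And>c. c \<in> C \<Longrightarrow> bracket h (w c) = c *\<^sub>C w c" "sum w C = 0" "c \<in> C"
  shows "w c = 0"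
  using assms
proof (induction C arbitrary: w c rule: finite_induct)
  case (insert a C)
  have "bracket h (sum w (insert a C)) - a *\<^sub>C sum w (insert a C) = 0"
    by (simp only: insert.prems) simp
  moreover have "bracket h (sum w (insert a C)) = (\<Sum>c\<in>insert a C. c *\<^sub>C w c)"
    unfolding bracket_sum_right by (rule sum.cong) (auto intro: insert.prems)
  ultimately have "(\<Sum>c\<in>insert a C. (c - a) *\<^sub>C w c) = 0"
    by (simp add: lie.scale_sum_right sum_subtractf lie.scale_left_diff_distrib)
  then have "(\<Sum>c\<in>C. (c - a) *\<^sub>C w c) = 0"
    using insert.hyps by simp
  then have "(c - a) *\<^sub>C w c = 0" if "c \<in> C" for c
    using that by (intro insert.IH[of "\<lambda>c. (c - a) *\<^sub>C w c"])
      (auto simp: bracket_scaleC_right insert.prems scaleC_scaleC mult.commute)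
  then have *: "w c = 0" if "c \<in> C" for c
    using that insert.hyps by auto
  then have "w a = 0"
    using insert.prems insert.hyps by simp
  then show ?case
    using * insert.prems by auto
qed simp

lemma eigenvector_expansion:
  fixes v :: "'g::fin_dim_complex_lie_algebra"
  assumes "v \<in> lie.span {x. \<exists>c. bracket h x = c *\<^sub>C x}"
  obtains C w where "finite C" "\<And>c. bracket h (w c) = c *\<^sub>C w c" "v = sum w C"
proof -
  \<comment> \<open>The vanishing of \<open>w\<close> outside \<open>C\<close> is carried for the
    induction: it makes the sum insensitive to enlarging \<open>C\<close> by an eigenvalue
    \<open>d\<close>, whether or not \<open>d\<close> occurs already.\<close>
  have "\<exists>C w. finite C \<and> (\<forall>c. bracket h (w c) = c *\<^sub>C w c) \<and> (\<forall>c. c \<notin> C \<longrightarrow> w c = 0) \<and> v = sum w C"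
    using assms
  proof (induction rule: lie.span_induct_alt)
    case base
    show ?case by (intro exI[of _ "{}"] exI[of _ "\<lambda>_. 0"]) auto
  next
    case (step a x y)
    then obtain C w d where *: "finite C" "\<forall>c. bracket h (w c) = c *\<^sub>C w c"
      "\<forall>c. c \<notin> C \<longrightarrow> w c = 0" "y = sum w C" "bracket h x = d *\<^sub>C x" by auto
    define w' where "w' = (\<lambda>c. w c + (if c = d then a *\<^sub>C x else 0))"
    have "sum w' (insert d C) = sum w (insert d C) + a *\<^sub>C x"
      unfolding w'_def sum.distrib using *(1) by (simp add: sum.delta)
    also have "sum w (insert d C) = y"
      using * by (cases "d \<in> C") (auto simp: insert_absorb)
    finally have "a *\<^sub>C x + y = sum w' (insert d C)" by (simp add: add.commute)
    moreover have "bracket h (w' c) = c *\<^sub>C w' c" for c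
      using * by (auto simp: w'_def bracket_add_right bracket_scaleC_right scaleC_add_right
          lie.scale_left_commute)
    ultimately show ?case using *(1,3)
      by (intro exI[of _ "insert d C"] exI[of _ w']) (auto simp: w'_def)
  qed
  then show thesis using that by blast
qed

lemma finite_spanning_set:
  obtains b :: "'g::fin_dim_complex_lie_algebra set" where "finite b" "\<And>x. x \<in> lie.span b"
proof -
  obtain b :: "'g set" where b: "finite b" "\<And>x. \<exists>c. x = (\<Sum>v\<in>b. c v *\<^sub>C v)"
    using finite_dim by blast
  have "x \<in> lie.span b" for x
  proof -
    obtain c where "x = (\<Sum>v\<in>b. c v *\<^sub>C v)" using b(2) by blast
    then show ?thesis by (auto intro: lie.span_sum lie.span_scale lie.span_base)
  qed
  then show thesis using that b(1) by blast
qed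

text \<open>Eigenvectors for distinct eigenvalues are independent, and an independent set is no
  larger than a finite spanning set.\<close>

lemma finite_eigenvalues:
  "finite {c. \<exists>v\<noteq>0. bracket h v = c *\<^sub>C (v::'g::fin_dim_complex_lie_algebra)}" (is "finite ?E")
proof (rule ccontr)
  assume inf: "infinite ?E"
  obtain b :: "'g set" where b: "finite b" and spb: "\<And>x. x \<in> lie.span b"
    using finite_spanning_set by blast
  obtain C where C: "finite C" "C \<subseteq> ?E" "card C = Suc (card b)"
    using infinite_arbitrarily_large[OF inf] by metis
  have "\<forall>c\<in>C. \<exists>v::'g. v \<noteq> 0 \<and> bracket h v = c *\<^sub>C v" using C by auto
  then obtain f :: "complex \<Rightarrow> 'g" where f: "\<And>c. c \<in> C \<Longrightarrow> f c \<noteq> 0 \<and> bracket h (f c) = c *\<^sub>C f c"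
    by metis
  have inj: "inj_on f C"
    by (rule inj_onI) (metis f lie.scale_right_imp_eq)
  have "lie.independent (f ` C)"
  proof (rule lie.independent_if_scalars_zero)
    fix g x assume 0: "(\<Sum>x\<in>f ` C. g x *\<^sub>C x) = 0" and "x \<in> f ` C"
    then obtain c where c: "c \<in> C" "x = f c" by auto
    have "(\<Sum>c\<in>C. g (f c) *\<^sub>C f c) = 0"
      using 0 by (simp add: sum.reindex[OF inj])
    then have "g (f c) *\<^sub>C f c = 0"
      using C(1) c(1) by (intro eigenvectors_sum_zero[of C h "\<lambda>c. g (f c) *\<^sub>C f c"])
        (auto simp: f bracket_scaleC_right lie.scale_left_commute)
    then show "g x = 0" using f[OF c(1)] c by simp
  qed (use C in auto)
  then have "card (f ` C) \<le> card b"
    using lie.independent_span_bound[OF b] spb by auto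
  then show False using C card_image[OF inj] by simp
qed

section \<open>Root spaces and coroots\<close>

lemma root_spaceD: "x \<in> root_space H \<alpha> \<Longrightarrow> h \<in> H \<Longrightarrow> bracket h x = \<alpha> h *\<^sub>C x"
  by (simp add: root_space_def)

lemma zero_in_root_space [simp]: "0 \<in> root_space H \<alpha>"
  by (simp add: root_space_def)

lemma bracket_root_space:
  assumes "x \<in> root_space H \<alpha>" "y \<in> root_space H \<beta>"
  shows "bracket x y \<in> root_space H (\<alpha> + \<beta>)"
  using assms unfolding root_space_def
  by (auto simp: bracket_bracket[of _ x y] bracket_scaleC_left bracket_scaleC_right scaleC_add_left)

lemma funpow_bracket_root_space:
  assumes "x \<in> root_space H \<alpha>" "v \<in> root_space H \<beta>"
  shows "(bracket x ^^ k) v \<in> root_space H (\<lambda>z. \<beta> z + of_nat k * \<alpha> z)"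
proof (induction k)
  case (Suc k)
  have "\<alpha> + (\<lambda>z. \<beta> z + of_nat k * \<alpha> z) = (\<lambda>z. \<beta> z + of_nat (Suc k) * \<alpha> z)"
    by (auto simp: fun_eq_iff algebra_simps)
  then show ?case using bracket_root_space[OF assms(1) Suc] by simp
qed (use assms in simp)

lemma dual_zero [simp]: "0 \<in> dual H"
  by (simp add: dual_def)

lemma dual_add [intro]: "f \<in> dual H \<Longrightarrow> g \<in> dual H \<Longrightarrow> f + g \<in> dual H"
  by (auto simp: dual_def algebra_simps)

lemma dual_minus [intro]: "f \<in> dual H \<Longrightarrow> - f \<in> dual H"
  by (auto simp: dual_def algebra_simps)

lemma dual_diff [intro]: "f \<in> dual H \<Longrightarrow> g \<in> dual H \<Longrightarrow> f - g \<in> dual H"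
  by (auto simp: dual_def algebra_simps)

lemma dual_scale [intro]: "f \<in> dual H \<Longrightarrow> (\<lambda>x. c * f x) \<in> dual H"
  by (auto simp: dual_def algebra_simps)

lemma dual_lincomb [intro]: "f \<in> dual H \<Longrightarrow> g \<in> dual H \<Longrightarrow> (\<lambda>x. f x + c * g x) \<in> dual H"
  by (auto simp: dual_def algebra_simps)

lemma dual_lincomb' [intro]: "f \<in> dual H \<Longrightarrow> g \<in> dual H \<Longrightarrow> (\<lambda>x. f x - c * g x) \<in> dual H"
  by (auto simp: dual_def algebra_simps)

lemma dual_eqI: "f \<in> dual H \<Longrightarrow> g \<in> dual H \<Longrightarrow> (\<And>h. h \<in> H \<Longrightarrow> f h = g h) \<Longrightarrow> f = g"
  unfolding dual_def fun_eq_iff by (metis (mono_tags, lifting) mem_Collect_eq)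

lemma dual_addD: "f \<in> dual H \<Longrightarrow> x \<in> H \<Longrightarrow> y \<in> H \<Longrightarrow> f (x + y) = f x + f y"
  by (simp add: dual_def)

lemma dual_scaleD: "f \<in> dual H \<Longrightarrow> x \<in> H \<Longrightarrow> f (c *\<^sub>C x) = c * f x"
  by (simp add: dual_def)

lemma dual_diffD:
  assumes "lie.subspace H" "f \<in> dual H" "x \<in> H" "y \<in> H"
  shows "f (x - y) = f x - f y"
proof -
  have "x - y = x + (-1) *\<^sub>C y" by simp
  then show ?thesis
    using assms dual_addD[of f H x "(-1) *\<^sub>C y"] dual_scaleD[of f H y "-1"]
    by (metis (no_types, lifting) lie.subspace_scale mult_minus1 diff_conv_add_uminus)
qed

lemma roots_dual: "\<alpha> \<in> roots H \<Longrightarrow> \<alpha> \<in> dual H"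
  by (simp add: roots_def)

locale reductive_with_cartan =
  fixes H :: "'g::fin_dim_complex_lie_algebra set" and B :: "'g \<Rightarrow> 'g \<Rightarrow> complex"
  assumes reductive: "reductive (UNIV :: 'g set)"
    and cartan: "cartan_subalgebra UNIV H"
    and form: "invariant_form B"
begin

lemma H_subspace: "lie.subspace H" using cartan by (simp add: cartan_subalgebra_def)

lemma H_zero: "0 \<in> H" using H_subspace by (rule lie.subspace_0)

lemma H_minus: "x \<in> H \<Longrightarrow> - x \<in> H" using H_subspace by (rule lie.subspace_neg)

lemma H_scale: "x \<in> H \<Longrightarrow> c *\<^sub>C x \<in> H" using H_subspace by (rule lie.subspace_scale)

lemma H_diff: "x \<in> H \<Longrightarrow> y \<in> H \<Longrightarrow> x - y \<in> H" using H_subspace by (rule lie.subspace_diff)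

lemma H_comm: "h \<in> H \<Longrightarrow> k \<in> H \<Longrightarrow> bracket h k = 0" using cartan by (simp add: cartan_subalgebra_def)

lemma H_diagonalizable: "h \<in> H \<Longrightarrow> lie.span {x. \<exists>c. bracket h x = c *\<^sub>C x} = UNIV"
  using cartan by (simp add: cartan_subalgebra_def)

lemma root_space_zero: "root_space H 0 = H"
  using cartan by (auto simp: root_space_def cartan_subalgebra_def)

lemma B_commute: "B x y = B y x" using form unfolding invariant_form_def by blast

lemma B_linear: "Vector_Spaces.linear scaleC (*) (B x)" using form by (simp add: invariant_form_def)

lemma B_invariant: "B (bracket x y) z = B x (bracket y z)" using form unfolding invariant_form_def by blast

lemma B_nondegenerate: "(\<And>y. B x y = 0) \<Longrightarrow> x = 0" using form by (simp add: invariant_form_def)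

lemma B_add_right: "B x (y + z) = B x y + B x z"
  using B_linear[of x] by (simp add: Vector_Spaces.linear_def module_hom_def module_hom_axioms_def)

lemma B_scale_right: "B x (c *\<^sub>C y) = c * B x y"
  using B_linear[of x] by (simp add: Vector_Spaces.linear_def module_hom_def module_hom_axioms_def)

lemma B_scale_left: "B (c *\<^sub>C y) x = c * B y x"
  by (metis B_commute B_scale_right)

lemma B_add_left: "B (y + z) x = B y x + B z x"
  by (metis B_commute B_add_right)

lemma B_minus_left: "B (- y) x = - B y x"
  using B_scale_left[of "-1" y x] by simp

lemma B_diff_left: "B (y - z) x = B y x - B z x"
  by (metis B_add_left B_minus_left diff_conv_add_uminus)

lemma B_span_zero: "(\<And>y. y \<in> S \<Longrightarrow> B x y = 0) \<Longrightarrow> y \<in> lie.span S \<Longrightarrow> B x y = 0"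
  by (erule lie.span_induct_alt)
    (auto simp: B_add_right B_scale_right intro: B_scale_right[of x 0 0, simplified])

text \<open>Commuting diagonalizable operators have a common eigenbasis: splitting a joint
  eigenvector for \<open>F\<close> into its \<open>h\<close>-components yields joint eigenvectors
  for \<open>insert h F\<close>.\<close>

lemma simultaneous_eigenvectors_span:
  assumes "finite F" "F \<subseteq> H"
  shows "lie.span {v. \<forall>h\<in>F. \<exists>c. bracket h v = c *\<^sub>C v} = UNIV"
  using assms
proof (induction F rule: finite_induct)
  case (insert h F)
  let ?E = "\<lambda>F. {v. \<forall>h\<in>F. \<exists>c. bracket h v = c *\<^sub>C v}"
  have "v \<in> lie.span (?E (insert h F))" if v: "v \<in> ?E F" for v
  proof -
    have "v \<in> lie.span {x. \<exists>c. bracket h x = c *\<^sub>C x}"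
      using H_diagonalizable insert.prems by simp
    then obtain C w where C: "finite C" and w: "\<And>c. bracket h (w c) = c *\<^sub>C w c" and vw: "v = sum w C"
      using eigenvector_expansion[of v h] by blast
    have "w d \<in> ?E (insert h F)" if d: "d \<in> C" for d
    proof (clarsimp, intro conjI ballI)
      show "\<exists>c. bracket h (w d) = c *\<^sub>C w d" using w by blast
    next
      fix f assume f: "f \<in> F"
      then obtain c where c: "bracket f v = c *\<^sub>C v" using v by auto
      have fh: "bracket h (bracket f u) = bracket f (bracket h u)" for u
        using insert.prems f H_comm[of h f] by (auto simp: bracket_bracket[of h f u])
      \<comment> \<open>Because \<open>bracket f\<close> commutes with \<open>bracket h\<close>,
        each summand is again an eigenvector of \<open>bracket h\<close> for the eigenvalue
        \<open>d\<close>; a vanishing sum of such vectors vanishes termwise.\<close>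
      have "(\<Sum>d\<in>C. bracket f (w d) - c *\<^sub>C w d) = 0"
        using c vw by (simp add: bracket_sum_right sum_subtractf lie.scale_sum_right)
      then have "bracket f (w d) - c *\<^sub>C w d = 0"
        using C d
        by (intro eigenvectors_sum_zero[of C h "\<lambda>d. bracket f (w d) - c *\<^sub>C w d"])
          (auto simp: bracket_diff_right fh w bracket_scaleC_right lie.scale_right_diff_distrib
            lie.scale_left_commute)
      then show "\<exists>c. bracket f (w d) = c *\<^sub>C w d" by auto
    qed
    then show ?thesis unfolding vw by (intro lie.span_sum lie.span_base)
  qed
  then have "lie.span (?E F) \<subseteq> lie.span (?E (insert h F))"
    by (intro lie.span_minimal) auto
  then show ?case using insert by auto
qed auto

lemma H_finitely_spanned: obtains F where "finite F" "F \<subseteq> H" "lie.span F = H"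
proof -
  obtain b :: "'g set" where b: "finite b" and spb: "\<And>x. x \<in> lie.span b"
    using finite_spanning_set by blast
  obtain F where F: "F \<subseteq> H" "lie.independent F" "H \<subseteq> lie.span F"
    using lie.maximal_independent_subset by blast
  moreover have "finite F" using lie.independent_span_bound[OF b F(2)] spb by auto
  moreover have "lie.span F \<subseteq> H" using F(1) H_subspace by (rule lie.span_minimal)
  ultimately show thesis using that by auto
qed

text \<open>The root space decomposition, with the weight 0 included among the indices. The
  eigenvalue of a nonzero joint eigenvector depends linearly on the element of \<open>H\<close>, and
  extending it by 0 off \<open>H\<close> gives a member of \<open>dual H\<close>.\<close>

lemma root_spaces_span: "lie.span (\<Union>\<beta>\<in>dual H. root_space H \<beta>) = UNIV"
proof -
  obtain F where F: "finite F" "F \<subseteq> H" "lie.span F = H" by (rule H_finitely_spanned)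
  have "v \<in> (\<Union>\<beta>\<in>dual H. root_space H \<beta>)" if v: "\<forall>h\<in>F. \<exists>c. bracket h v = c *\<^sub>C v" for v
  proof (cases "v = 0")
    case True
    then show ?thesis by (intro UN_I[of 0]) auto
  next
    case False
    have "\<exists>c. bracket h v = c *\<^sub>C v" if "h \<in> H" for h
      using that unfolding F(3)[symmetric]
    proof (induction rule: lie.span_induct_alt)
      case base
      show ?case by (intro exI[of _ 0]) simp
    next
      case (step a x y)
      then obtain c d where "bracket x v = c *\<^sub>C v" "bracket y v = d *\<^sub>C v" using v by metis
      then show ?case
        by (intro exI[of _ "a * c + d"])
          (simp add: bracket_add_left bracket_scaleC_left scaleC_add_left scaleC_scaleC)
    qed
    then obtain \<phi> where \<phi>: "\<And>h. h \<in> H \<Longrightarrow> bracket h v = \<phi> h *\<^sub>C v" by metis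
    define \<beta> where "\<beta> = (\<lambda>h. if h \<in> H then \<phi> h else 0)"
    have "\<phi> (x + y) = \<phi> x + \<phi> y" if "x \<in> H" "y \<in> H" for x y
    proof -
      have "\<phi> (x + y) *\<^sub>C v = (\<phi> x + \<phi> y) *\<^sub>C v"
        using that H_subspace
        by (metis \<phi> bracket_add_left lie.subspace_add scaleC_add_left)
      then show ?thesis using False by simp
    qed
    moreover have "\<phi> (c *\<^sub>C x) = c * \<phi> x" if "x \<in> H" for c x
    proof -
      have "\<phi> (c *\<^sub>C x) *\<^sub>C v = (c * \<phi> x) *\<^sub>C v"
        using that by (metis \<phi> bracket_scaleC_left H_scale scaleC_scaleC)
      then show ?thesis using False by simp
    qed
    ultimately have "\<beta> \<in> dual H"
      using H_subspace H_scale by (auto simp: dual_def \<beta>_def lie.subspace_add)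
    moreover have "v \<in> root_space H \<beta>" by (simp add: root_space_def \<beta>_def \<phi>)
    ultimately show ?thesis by auto
  qed
  then have "lie.span {v. \<forall>h\<in>F. \<exists>c. bracket h v = c *\<^sub>C v} \<subseteq> lie.span (\<Union>\<beta>\<in>dual H. root_space H \<beta>)"
    by (intro lie.span_mono) auto
  then show ?thesis using simultaneous_eigenvectors_span[OF F(1,2)] by auto
qed

text \<open>A root is determined by its values on a finite spanning set of \<open>H\<close>, and
  each of these values is one of the finitely many eigenvalues of the corresponding
  operator.\<close>

lemma finite_roots: "finite (roots H)"
proof -
  obtain F where F: "finite F" "F \<subseteq> H" "lie.span F = H" by (rule H_finitely_spanned)
  let ?E = "\<lambda>h. {c. \<exists>v\<noteq>0. bracket h v = c *\<^sub>C (v::'g)}"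
  let ?r = "\<lambda>\<alpha>. restrict \<alpha> F"
  have "?r ` roots H \<subseteq> PiE F ?E"
  proof (intro image_subsetI PiE_I)
    fix \<alpha> h assume "\<alpha> \<in> roots H" "h \<in> F"
    then obtain v where "v \<noteq> 0" "v \<in> root_space H \<alpha>"
      unfolding roots_def using zero_in_root_space by blast
    then show "?r \<alpha> h \<in> ?E h" using F \<open>h \<in> F\<close> by (auto simp: root_space_def)
  qed auto
  then have "finite (?r ` roots H)"
    by (rule finite_subset) (intro finite_PiE F(1) finite_eigenvalues)
  moreover have "inj_on ?r (roots H)"
  proof (rule inj_onI)
    fix \<alpha> \<beta> assume \<alpha>: "\<alpha> \<in> roots H" "\<beta> \<in> roots H" and eq: "?r \<alpha> = ?r \<beta>"
    then have d: "\<alpha> \<in> dual H" "\<beta> \<in> dual H" by (auto intro: roots_dual)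
    have eqF: "\<alpha> x = \<beta> x" if "x \<in> F" for x using eq that by (metis restrict_apply')
    have "\<alpha> h = \<beta> h \<and> h \<in> H" if "h \<in> lie.span F" for h
      using that
    proof (induction rule: lie.span_induct_alt)
      case base
      show ?case using dual_scaleD[OF d(1) H_zero, of 0] dual_scaleD[OF d(2) H_zero, of 0] H_zero by simp
    next
      case (step a x y)
      then show ?case using eqF[of x] F(2) d H_scale H_subspace
        by (auto simp: dual_addD dual_scaleD lie.subspace_add subset_iff)
    qed
    then show "\<alpha> = \<beta>" using d F(3) by (auto intro: dual_eqI)
  qed
  ultimately show ?thesis by (rule finite_imageD)
qed

text \<open>Moving \<open>bracket h\<close> across the form by invariance multiplies
  \<open>B x y\<close> by \<open>\<alpha> h\<close> on one side and by \<open>- \<beta> h\<close> on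
  the other.\<close>

lemma B_root_spaces_orthogonal:
  assumes "x \<in> root_space H \<alpha>" "y \<in> root_space H \<beta>" "h \<in> H" "\<alpha> h + \<beta> h \<noteq> 0"
  shows "B x y = 0"
proof -
  have "\<alpha> h * B x y = B (bracket h x) y"
    using assms by (simp add: root_spaceD B_scale_left)
  also have "\<dots> = - B (bracket x h) y" by (metis bracket_commute B_minus_left)
  also have "\<dots> = - (\<beta> h * B x y)" using assms by (simp add: B_invariant root_spaceD B_scale_right)
  finally have "(\<alpha> h + \<beta> h) * B x y = 0" by (simp add: algebra_simps)
  then show ?thesis using assms by simp
qed

lemma dual_neq_witness:
  assumes "\<alpha> \<in> dual H" "\<beta> \<in> dual H" "\<alpha> \<noteq> \<beta>"
  obtains h where "h \<in> H" "\<alpha> h \<noteq> \<beta> h"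
  using assms dual_eqI by blast

text \<open>By orthogonality \<open>x\<close> can pair nontrivially only with the opposite root
  space, and by nondegeneracy it must pair nontrivially with something.\<close>

lemma root_space_partner:
  assumes "\<alpha> \<in> dual H" "x \<in> root_space H \<alpha>" "x \<noteq> 0"
  obtains y where "y \<in> root_space H (- \<alpha>)" "B x y = 1"
proof -
  have "\<exists>y\<in>root_space H (- \<alpha>). B x y \<noteq> 0"
  proof (rule ccontr)
    assume neg: "\<not> ?thesis"
    have "B x y = 0" if y: "y \<in> root_space H \<beta>" "\<beta> \<in> dual H" for y \<beta>
    proof (cases "\<beta> = - \<alpha>")
      case False
      then obtain h where "h \<in> H" "\<beta> h \<noteq> (- \<alpha>) h"
        using dual_neq_witness[OF y(2) dual_minus[OF assms(1)]] by metis
      then show ?thesis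
        using B_root_spaces_orthogonal[OF assms(2) y(1), of h]
        by (simp add: add_eq_0_iff)
    qed (use neg y in auto)
    then have "B x y = 0" for y
      using root_spaces_span B_span_zero[of "\<Union>\<beta>\<in>dual H. root_space H \<beta>" x y] by auto
    then show False using B_nondegenerate assms by blast
  qed
  then obtain y where y: "y \<in> root_space H (- \<alpha>)" "B x y \<noteq> 0" by blast
  have "(1 / B x y) *\<^sub>C y \<in> root_space H (- \<alpha>)"
    using y(1) by (auto simp: root_space_def bracket_scaleC_right scaleC_scaleC mult.commute)
  then show thesis using that y by (simp add: B_scale_right)
qed

text \<open>The case of weight 0, where \<open>H\<close> is its own partner. Identities between
  elements of \<open>H\<close> are later tested against \<open>H\<close> in this way.\<close>

lemma B_nondegenerate_H:
  assumes "x \<in> H" "\<And>k. k \<in> H \<Longrightarrow> B x k = 0"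
  shows "x = 0"
proof (rule ccontr)
  assume "x \<noteq> 0"
  then obtain y where "y \<in> root_space H (- 0)" "B x y = 1"
    using root_space_partner[of 0 x] assms root_space_zero by auto
  then show False using assms root_space_zero by auto
qed

text \<open>In other terms, \<open>bracket x y\<close> is \<open>B x y\<close> times the vector of
  \<open>H\<close> that represents \<open>\<alpha>\<close> under \<open>B\<close>.\<close>

lemma bracket_opposite_root_spaces:
  assumes "x \<in> root_space H \<alpha>" "y \<in> root_space H (- \<alpha>)"
  shows "bracket x y \<in> H" "h \<in> H \<Longrightarrow> B (bracket x y) h = B x y * \<alpha> h"
proof -
  show "bracket x y \<in> H"
    using bracket_root_space[OF assms] by (simp add: root_space_zero)
  assume "h \<in> H"
  then have "bracket y h = \<alpha> h *\<^sub>C y"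
    using assms(2) bracket_commute[of y h] by (simp add: root_spaceD)
  then show "B (bracket x y) h = B x y * \<alpha> h" by (simp add: B_invariant B_scale_right)
qed

text \<open>A string that never reached 0 would produce infinitely many distinct weights
  \<open>\<beta> + k \<alpha>\<close>, each of them a root or zero.\<close>

lemma funpow_bracket_nilpotent:
  assumes "\<alpha> \<in> dual H" "\<alpha> \<noteq> 0" "x \<in> root_space H \<alpha>" "\<beta> \<in> dual H" "v \<in> root_space H \<beta>"
  shows "\<exists>k. (bracket x ^^ k) v = 0"
proof (rule ccontr)
  assume "\<not> ?thesis"
  then have nz: "(bracket x ^^ k) v \<noteq> 0" for k by auto
  let ?f = "\<lambda>k::nat. \<lambda>z. \<beta> z + of_nat k * \<alpha> z"
  have "?f k \<in> insert 0 (roots H)" for k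
    using funpow_bracket_root_space[OF assms(3,5), of k] nz[of k] assms(1,4)
    unfolding roots_def by (auto simp: fun_eq_iff)
  then have "finite (range ?f)"
    using finite_roots by (meson finite_insert finite_subset image_subsetI)
  moreover have "inj ?f"
  proof (rule injI)
    fix k l assume "?f k = ?f l"
    moreover obtain z where "\<alpha> z \<noteq> 0" using assms(2) by (auto simp: fun_eq_iff)
    ultimately show "k = l" by (auto dest!: fun_cong[where x = z])
  qed
  ultimately show False using finite_imageD infinite_UNIV_nat by blast
qed

end

text \<open>The value \<open>a = 1\<close> is the case of an \<open>sl\<^sub>2\<close>-triple; \<open>a = 0\<close> is that of a Heisenberg algebra,
  which is excluded below by reductivity.\<close>

lemma lowering_formula:
  assumes "bracket x y = t" "bracket t y = (- 2 * a) *\<^sub>C y"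
    and "bracket t u = l *\<^sub>C u" "bracket x u = 0"
  shows "bracket t ((bracket y ^^ k) u) = (l - 2 * a * of_nat k) *\<^sub>C (bracket y ^^ k) u"
    and "bracket x ((bracket y ^^ Suc k) u) = (of_nat (Suc k) * (l - a * of_nat k)) *\<^sub>C (bracket y ^^ k) u"
proof -
  show t: "bracket t ((bracket y ^^ k) u) = (l - 2 * a * of_nat k) *\<^sub>C (bracket y ^^ k) u" for k
  proof (induction k)
    case (Suc k)
    have "bracket t ((bracket y ^^ Suc k) u) =
        (- 2 * a) *\<^sub>C (bracket y ^^ Suc k) u + (l - 2 * a * of_nat k) *\<^sub>C (bracket y ^^ Suc k) u"
      using Suc assms(2)
      by (simp only: funpow.simps o_apply bracket_bracket[of t y] bracket_scaleC_left
          bracket_scaleC_right)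
    then show ?case by (simp only: scaleC_add_left[symmetric]) (simp add: algebra_simps)
  qed (use assms in simp)
  show "bracket x ((bracket y ^^ Suc k) u) = (of_nat (Suc k) * (l - a * of_nat k)) *\<^sub>C (bracket y ^^ k) u"
  proof (induction k)
    case (Suc k)
    have "bracket x ((bracket y ^^ Suc (Suc k)) u) =
        bracket t ((bracket y ^^ Suc k) u) + bracket y (bracket x ((bracket y ^^ Suc k) u))"
      using assms(1) by (simp add: bracket_bracket[of x y])
    also have "\<dots> = (l - 2 * a * of_nat (Suc k)) *\<^sub>C (bracket y ^^ Suc k) u +
        (of_nat (Suc k) * (l - a * of_nat k)) *\<^sub>C (bracket y ^^ Suc k) u"
      by (simp only: Suc t bracket_scaleC_right) simp
    also have "\<dots> = (of_nat (Suc (Suc k)) * (l - a * of_nat (Suc k))) *\<^sub>C (bracket y ^^ Suc k) u"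
      unfolding scaleC_add_left[symmetric]
      by (rule arg_cong[where f = "\<lambda>c. c *\<^sub>C _"]) (simp add: algebra_simps)
    finally show ?case .
  qed (use assms in \<open>simp add: bracket_bracket[of x y]\<close>)
qed

section \<open>Strings under a lowering operator and the normalization of coroots\<close>

context reductive_with_cartan
begin

text \<open>At the last nonzero vector of the lowering string the next vector is 0, so the
  coefficient by which \<open>x\<close> brings it back must vanish; this says
  \<open>\<beta> t = a j\<close>.\<close>

lemma string_from_top:
  assumes \<alpha>: "\<alpha> \<in> dual H" "\<alpha> \<noteq> 0" and x: "x \<in> root_space H \<alpha>" and y: "y \<in> root_space H (- \<alpha>)"
    and t: "bracket x y = t" "\<alpha> t = 2 * a"
    and u: "\<beta> \<in> dual H" "u \<in> root_space H \<beta>" "u \<noteq> 0" "bracket x u = 0"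
  obtains j :: nat where "\<beta> t = a * of_nat j" "\<And>i. i \<le> j \<Longrightarrow> (bracket y ^^ i) u \<noteq> 0"
proof -
  have tH: "t \<in> H" using bracket_opposite_root_spaces(1)[OF x y] t by simp
  have ty: "bracket t y = (- 2 * a) *\<^sub>C y" using root_spaceD[OF y tH] t by simp
  have tu: "bracket t u = \<beta> t *\<^sub>C u" using root_spaceD[OF u(2) tH] by simp
  obtain k0 where k0: "(bracket y ^^ k0) u = 0"
    using funpow_bracket_nilpotent[OF dual_minus[OF \<alpha>(1)] _ y u(1,2)] \<alpha>(2) by auto
  define k where "k = (LEAST k. (bracket y ^^ k) u = 0)"
  have k: "(bracket y ^^ k) u = 0" unfolding k_def using k0 by (rule LeastI)
  have less: "(bracket y ^^ i) u \<noteq> 0" if "i < k" for i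
    using that not_less_Least unfolding k_def by blast
  obtain j where j: "k = Suc j" using k u(3) by (cases k) auto
  have "(of_nat (Suc j) * (\<beta> t - a * of_nat j)) *\<^sub>C (bracket y ^^ j) u = 0"
    using lowering_formula(2)[OF t(1) ty tu u(4), of j] k j by simp
  then have "\<beta> t = a * of_nat j" using less[of j] j
    by (metis lessI lie.scale_eq_0_iff mult_eq_0_iff of_nat_neq_0 right_minus_eq)
  then show thesis using that[of j] less j by auto
qed

lemma string_top_exists:
  assumes "\<alpha> \<in> dual H" "\<alpha> \<noteq> 0" "x \<in> root_space H \<alpha>" "\<beta> \<in> dual H" "v \<in> root_space H \<beta>" "v \<noteq> 0"
  obtains p where "(bracket x ^^ p) v \<noteq> 0" "bracket x ((bracket x ^^ p) v) = 0"
proof -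
  obtain k0 where k0: "(bracket x ^^ k0) v = 0"
    using funpow_bracket_nilpotent[OF assms(1-5)] by auto
  define k where "k = (LEAST k. (bracket x ^^ k) v = 0)"
  have k: "(bracket x ^^ k) v = 0" unfolding k_def using k0 by (rule LeastI)
  obtain j where j: "k = Suc j" using k assms by (cases k) auto
  then have "(bracket x ^^ j) v \<noteq> 0" using not_less_Least[of j "\<lambda>k. (bracket x ^^ k) v = 0"]
    unfolding k_def by auto
  then show thesis using that k j by auto
qed

text \<open>Modulo the central line spanned by \<open>t\<close>, both \<open>x\<close> and
  \<open>y\<close> can be replaced by elements of a complementary ideal without changing their
  bracket. Hence \<open>t\<close> lies in that ideal as well as in the line.\<close>

lemma central_derived_zero:
  fixes t :: 'g
  assumes "\<And>z. bracket t z = 0" "bracket x y = t"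
  shows "t = 0"
proof -
  let ?I = "lie.span {t}"
  have cent: "bracket i z = 0 \<and> bracket z i = 0" if "i \<in> ?I" for i z
    using that assms(1)
    by (auto simp: lie.span_singleton bracket_scaleC_left bracket_commute[of z])
  have "lie_ideal ?I UNIV"
    by (auto simp: lie_ideal_def cent lie.span_zero)
  moreover have "lie_ideal I UNIV \<longrightarrow> (\<exists>J. lie_ideal J UNIV \<and>
      (\<forall>x. \<exists>y\<in>I. \<exists>z\<in>J. x = y + z) \<and> I \<inter> J = {0})" for I :: "'g set"
    using reductive unfolding reductive_def ball_UNIV by (elim conjE) (rule spec)
  ultimately obtain J where J: "lie_ideal J UNIV" "\<forall>x. \<exists>y\<in>?I. \<exists>z\<in>J. x = y + z" "?I \<inter> J = {0}"
    by blast
  obtain i j where ij: "i \<in> ?I" "j \<in> J" "x = i + j" using J(2) by blast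
  obtain i' j' where ij': "i' \<in> ?I" "j' \<in> J" "y = i' + j'" using J(2) by blast
  have "t = bracket j j'"
    using assms(2) ij ij' cent by (simp add: bracket_add_left bracket_add_right)
  then have "t \<in> J" using J(1) ij' by (auto simp: lie_ideal_def)
  moreover have "t \<in> ?I" by (simp add: lie.span_base)
  ultimately show ?thesis using J(3) by blast
qed

text \<open>If \<open>\<alpha> t = 0\<close>, the string argument with \<open>a = 0\<close> shows
  that every occurring weight vanishes on \<open>t\<close>. Then \<open>t\<close> is central and a
  bracket, hence 0, although it represents the nonzero multiple \<open>B x y\<close> of
  \<open>\<alpha>\<close>.\<close>

lemma root_nonisotropic:
  assumes \<alpha>: "\<alpha> \<in> roots H" and x: "x \<in> root_space H \<alpha>" and y: "y \<in> root_space H (- \<alpha>)"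
    and xy: "B x y \<noteq> 0"
  shows "\<alpha> (bracket x y) \<noteq> 0"
proof
  define t where "t = bracket x y"
  assume "\<alpha> (bracket x y) = 0"
  then have at: "\<alpha> t = 2 * 0" by (simp add: t_def)
  have \<alpha>d: "\<alpha> \<in> dual H" "\<alpha> \<noteq> 0" using \<alpha> by (auto simp: roots_def)
  have tH: "t \<in> H" using bracket_opposite_root_spaces(1)[OF x y] by (simp add: t_def)
  have "bracket t v = 0" if v: "\<beta> \<in> dual H" "v \<in> root_space H \<beta>" for \<beta> v
  proof (cases "v = 0")
    case False
    obtain p where p: "(bracket x ^^ p) v \<noteq> 0" "bracket x ((bracket x ^^ p) v) = 0"
      using string_top_exists[OF \<alpha>d x v False] .
    have "(\<lambda>z. \<beta> z + of_nat p * \<alpha> z) \<in> dual H" using v \<alpha>d by auto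
    then obtain j :: nat where "\<beta> t + of_nat p * \<alpha> t = 0 * of_nat j"
      using string_from_top[OF \<alpha>d x y t_def[symmetric] at _ funpow_bracket_root_space[OF x v(2)] p]
      by metis
    then have "\<beta> t = 0" using at by simp
    then show ?thesis using root_spaceD[OF v(2) tH] by simp
  qed simp
  then have tz: "\<And>\<beta> v. \<beta> \<in> dual H \<Longrightarrow> v \<in> root_space H \<beta> \<Longrightarrow> bracket t v = 0" by blast
  have "bracket t z = 0" if "z \<in> lie.span (\<Union>\<beta>\<in>dual H. root_space H \<beta>)" for z
    using that by (induction rule: lie.span_induct_alt)
      (auto simp: bracket_add_right bracket_scaleC_right intro: tz)
  then have "bracket t z = 0" for z using root_spaces_span by simp
  then have "t = 0" using central_derived_zero t_def by blast
  then have "B x y * \<alpha> h = 0" if "h \<in> H" for h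
    using bracket_opposite_root_spaces(2)[OF x y that] t_def B_scale_left[of 0 0 h] by simp
  then have "\<alpha> h = 0" for h
    using xy \<alpha>d(1) unfolding dual_def by (cases "h \<in> H") auto
  then show False using \<alpha>d(2) by (auto simp: fun_eq_iff)
qed

text \<open>All brackets of the two opposite root spaces are proportional to a single
  \<open>t\<close> with \<open>\<alpha> t \<noteq> 0\<close>. The span in the definition of
  \<open>coroot\<close> is therefore a line, on which \<open>\<alpha> h = 2\<close> singles out one
  point, so the definite description is meaningful.\<close>

lemma coroot_triple:
  assumes \<alpha>: "\<alpha> \<in> roots H"
  obtains x y where "x \<in> root_space H \<alpha>" "y \<in> root_space H (- \<alpha>)" "B x y \<noteq> 0"
    "bracket x y = coroot H \<alpha>" "\<alpha> (coroot H \<alpha>) = 2"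
proof -
  have \<alpha>d: "\<alpha> \<in> dual H" "\<alpha> \<noteq> 0" using \<alpha> by (auto simp: roots_def)
  obtain x where x: "x \<in> root_space H \<alpha>" "x \<noteq> 0"
    using \<alpha> zero_in_root_space by (auto simp: roots_def)
  obtain y where y: "y \<in> root_space H (- \<alpha>)" "B x y = 1"
    using root_space_partner[OF \<alpha>d(1) x] .
  define t where "t = bracket x y"
  have tH: "t \<in> H" using bracket_opposite_root_spaces(1)[OF x(1) y(1)] by (simp add: t_def)
  have at: "\<alpha> t \<noteq> 0" using root_nonisotropic[OF \<alpha> x(1) y(1)] y(2) by (simp add: t_def)
  let ?S = "{bracket x y | x y. x \<in> root_space H \<alpha> \<and> y \<in> root_space H (- \<alpha>)}"
  have brk: "bracket x' y' = B x' y' *\<^sub>C t" if xy': "x' \<in> root_space H \<alpha>" "y' \<in> root_space H (- \<alpha>)" for x' y'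
  proof -
    have "bracket x' y' - B x' y' *\<^sub>C t = 0"
    proof (rule B_nondegenerate_H)
      show "bracket x' y' - B x' y' *\<^sub>C t \<in> H"
        using bracket_opposite_root_spaces(1)[OF xy'] tH by (simp add: H_diff H_scale)
      show "B (bracket x' y' - B x' y' *\<^sub>C t) k = 0" if "k \<in> H" for k
        using that y(2) bracket_opposite_root_spaces(2)[OF xy' that]
          bracket_opposite_root_spaces(2)[OF x(1) y(1) that]
        by (simp add: B_diff_left B_scale_left t_def)
    qed
    then show ?thesis by simp
  qed
  have "lie.span ?S = lie.span {t}"
  proof (rule antisym)
    show "lie.span ?S \<subseteq> lie.span {t}"
      by (rule lie.span_minimal) (auto simp: brk lie.span_base lie.span_scale)
    show "lie.span {t} \<subseteq> lie.span ?S"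
      by (rule lie.span_mono) (use x y t_def in auto)
  qed
  then have "coroot H \<alpha> = (THE h. (\<exists>c. h = c *\<^sub>C t) \<and> \<alpha> h = 2)"
    unfolding coroot_def by (simp add: lie.span_singleton image_iff)
  also have "\<dots> = (2 / \<alpha> t) *\<^sub>C t"
    by (rule the_equality) (use at \<alpha>d tH in \<open>auto simp: dual_scaleD eq_divide_eq\<close>)
  finally have c: "coroot H \<alpha> = (2 / \<alpha> t) *\<^sub>C t" .
  have "(2 / \<alpha> t) *\<^sub>C y \<in> root_space H (- \<alpha>)"
    using y(1) by (auto simp: root_space_def bracket_scaleC_right scaleC_scaleC mult.commute)
  moreover have "B x ((2 / \<alpha> t) *\<^sub>C y) \<noteq> 0" using at y(2) by (simp add: B_scale_right)
  moreover have "bracket x ((2 / \<alpha> t) *\<^sub>C y) = coroot H \<alpha>"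
    by (simp add: c t_def bracket_scaleC_right)
  moreover have "\<alpha> (coroot H \<alpha>) = 2"
    using c at dual_scaleD[OF \<alpha>d(1) tH] by simp
  ultimately show thesis using that x(1) by blast
qed

lemma coroot_in_H: "\<alpha> \<in> roots H \<Longrightarrow> coroot H \<alpha> \<in> H"
  by (metis bracket_opposite_root_spaces(1) coroot_triple)

lemma root_coroot [simp]: "\<alpha> \<in> roots H \<Longrightarrow> \<alpha> (coroot H \<alpha>) = 2"
  by (metis coroot_triple)

lemma B_coroot:
  assumes "\<alpha> \<in> roots H"
  obtains c where "c \<noteq> 0" "\<And>h. h \<in> H \<Longrightarrow> B (coroot H \<alpha>) h = c * \<alpha> h"
  by (metis assms bracket_opposite_root_spaces(2) coroot_triple)

text \<open>The coroot is proportional to the vector representing \<open>\<alpha>\<close> under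
  \<open>B\<close>, and the normalization fixes the factor. Coroots of other roots are computed from
  this, without returning to root spaces.\<close>

lemma coroot_unique:
  assumes "\<alpha> \<in> roots H" "h \<in> H" "\<alpha> h = 2" "\<And>k. k \<in> H \<Longrightarrow> B h k = c * \<alpha> k"
  shows "coroot H \<alpha> = h"
proof -
  obtain d where d: "\<And>h. h \<in> H \<Longrightarrow> B (coroot H \<alpha>) h = d * \<alpha> h" using B_coroot assms(1) by metis
  \<comment> \<open>Evaluating \<open>B\<close> on \<open>h\<close> and the coroot in both orders
    gives \<open>2 c = 2 d\<close>.\<close>
  have "c = d"
    using d[OF assms(2)] assms(4)[OF coroot_in_H[OF assms(1)]] assms(1,3) B_commute by simp
  then have "coroot H \<alpha> - h = 0"
    by (intro B_nondegenerate_H) (use assms coroot_in_H d in \<open>auto simp: B_diff_left H_diff\<close>)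
  then show ?thesis by simp
qed

end

section \<open>Root strings and reflections\<close>

context reductive_with_cartan
begin

lemma coroot_uminus:
  assumes "\<alpha> \<in> roots H" "- \<alpha> \<in> roots H"
  shows "coroot H (- \<alpha>) = - coroot H \<alpha>"
proof -
  obtain c where c: "\<And>h. h \<in> H \<Longrightarrow> B (coroot H \<alpha>) h = c * \<alpha> h" using B_coroot assms(1) by metis
  have "\<alpha> (- coroot H \<alpha>) = - 2"
    using dual_scaleD[of \<alpha> H "coroot H \<alpha>" "-1"] assms coroot_in_H roots_dual by auto
  then show ?thesis
    by (intro coroot_unique[where c = c]) (use assms c coroot_in_H H_minus in \<open>auto simp: B_minus_left\<close>)
qed

text \<open>Let \<open>p\<close> raising steps lead to the top, from which \<open>j\<close> lowering
  steps stay nonzero; then \<open>m = j - 2 p\<close>. The weight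
  \<open>\<beta> - k \<alpha>\<close> lies \<open>p + k\<close> steps below the top, and
  \<open>k \<le> m\<close> keeps this within \<open>j\<close>.\<close>

lemma root_string:
  assumes \<alpha>: "\<alpha> \<in> roots H" and \<beta>: "\<beta> \<in> roots H"
  obtains m :: int where "\<beta> (coroot H \<alpha>) = of_int m"
    "\<And>k. int k \<le> m \<Longrightarrow> root_space H (\<lambda>z. \<beta> z - of_nat k * \<alpha> z) \<noteq> {0}"
proof -
  have \<alpha>d: "\<alpha> \<in> dual H" "\<alpha> \<noteq> 0" using \<alpha> by (auto simp: roots_def)
  have \<beta>d: "\<beta> \<in> dual H" using \<beta> by (auto simp: roots_def)
  obtain v where v: "v \<in> root_space H \<beta>" "v \<noteq> 0"
    using \<beta> zero_in_root_space by (auto simp: roots_def)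
  obtain x y where xy: "x \<in> root_space H \<alpha>" "y \<in> root_space H (- \<alpha>)"
    "bracket x y = coroot H \<alpha>" "\<alpha> (coroot H \<alpha>) = 2"
    using coroot_triple[OF \<alpha>] by metis
  obtain p where p: "(bracket x ^^ p) v \<noteq> 0" "bracket x ((bracket x ^^ p) v) = 0"
    using string_top_exists[OF \<alpha>d xy(1) \<beta>d v] .
  let ?\<gamma> = "\<lambda>z. \<beta> z + of_nat p * \<alpha> z"
  have g: "(bracket x ^^ p) v \<in> root_space H ?\<gamma>" "?\<gamma> \<in> dual H"
    using funpow_bracket_root_space xy(1) v(1) \<alpha>d \<beta>d by auto
  obtain j :: nat where j: "?\<gamma> (coroot H \<alpha>) = 1 * of_nat j"
    "\<And>i. i \<le> j \<Longrightarrow> (bracket y ^^ i) ((bracket x ^^ p) v) \<noteq> 0"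
    by (rule string_from_top[OF \<alpha>d xy(1-3) _ g(2,1) p, of 1]) (use xy(4) in auto)
  let ?m = "int j - 2 * int p"
  have "\<beta> (coroot H \<alpha>) = of_int ?m"
    using j(1) xy(4) by (simp add: algebra_simps)
  moreover have "root_space H (\<lambda>z. \<beta> z - of_nat k * \<alpha> z) \<noteq> {0}" if "int k \<le> ?m" for k
  proof -
    have "(bracket y ^^ (p + k)) ((bracket x ^^ p) v) \<noteq> 0"
      using that by (intro j(2)) linarith
    moreover have "(bracket y ^^ (p + k)) ((bracket x ^^ p) v) \<in>
        root_space H (\<lambda>z. ?\<gamma> z + of_nat (p + k) * (- \<alpha>) z)"
      by (rule funpow_bracket_root_space[OF xy(2) g(1)])
    moreover have "(\<lambda>z. ?\<gamma> z + of_nat (p + k) * (- \<alpha>) z) = (\<lambda>z. \<beta> z - of_nat k * \<alpha> z)"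
      by (auto simp: fun_eq_iff algebra_simps)
    ultimately show ?thesis by auto
  qed
  ultimately show thesis using that by blast
qed

text \<open>The string of \<open>\<alpha>\<close> through itself has \<open>m = 2\<close>, and two
  steps down from \<open>\<alpha>\<close> is \<open>- \<alpha>\<close>.\<close>

lemma uminus_root:
  assumes "\<alpha> \<in> roots H"
  shows "- \<alpha> \<in> roots H"
proof -
  obtain m :: int where m: "\<alpha> (coroot H \<alpha>) = of_int m"
    and s: "\<And>k. int k \<le> m \<Longrightarrow> root_space H (\<lambda>z. \<alpha> z - of_nat k * \<alpha> z) \<noteq> {0}"
    using root_string[OF assms assms] by metis
  have "m = 2" using m root_coroot[OF assms] by (metis of_int_eq_numeral_iff)
  then have "root_space H (\<lambda>z. \<alpha> z - of_nat 2 * \<alpha> z) \<noteq> {0}"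
    by (intro s) simp
  moreover have "(\<lambda>z. \<alpha> z - of_nat 2 * \<alpha> z) = - \<alpha>" by (auto simp: fun_eq_iff)
  ultimately show ?thesis using assms by (auto simp: roots_def)
qed

lemma root_string_root:
  assumes "\<alpha> \<in> roots H" "\<beta> \<in> roots H" "\<beta> (coroot H \<alpha>) = of_int m" "int k \<le> m"
    and "(\<lambda>z. \<beta> z - of_nat k * \<alpha> z) \<noteq> 0"
  shows "(\<lambda>z. \<beta> z - of_nat k * \<alpha> z) \<in> roots H"
proof -
  obtain m' :: int where "\<beta> (coroot H \<alpha>) = of_int m'"
    "\<And>k. int k \<le> m' \<Longrightarrow> root_space H (\<lambda>z. \<beta> z - of_nat k * \<alpha> z) \<noteq> {0}"
    using root_string[OF assms(1,2)] by metis
  then show ?thesis using assms unfolding roots_def by auto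
qed

end

text \<open>The reflection without its restriction to \<open>dual H\<close>, so that additivity and
  homogeneity hold for all functions.\<close>

definition reflect ::
    "'g::fin_dim_complex_lie_algebra set \<Rightarrow> ('g \<Rightarrow> complex) \<Rightarrow> ('g \<Rightarrow> complex) \<Rightarrow> 'g \<Rightarrow> complex" where
  "reflect H \<alpha> \<nu> = (\<lambda>x. \<nu> x - \<nu> (coroot H \<alpha>) * \<alpha> x)"

lemma reflect_dual: "\<alpha> \<in> dual H \<Longrightarrow> \<nu> \<in> dual H \<Longrightarrow> reflect H \<alpha> \<nu> \<in> dual H"
  by (auto simp: reflect_def)

lemma reflect_zero [simp]: "reflect H \<alpha> 0 = 0"
  by (simp add: reflect_def fun_eq_iff)

lemma reflect_add: "reflect H \<alpha> (\<mu> + \<nu>) = reflect H \<alpha> \<mu> + reflect H \<alpha> \<nu>"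
  by (auto simp: reflect_def fun_eq_iff algebra_simps)

lemma reflect_minus: "reflect H \<alpha> (- \<nu>) = - reflect H \<alpha> \<nu>"
  by (auto simp: reflect_def fun_eq_iff algebra_simps)

lemma reflect_lincomb:
  "reflect H \<alpha> (\<lambda>x. \<mu> x - c * \<nu> x) = (\<lambda>x. reflect H \<alpha> \<mu> x - c * reflect H \<alpha> \<nu> x)"
  by (auto simp: reflect_def fun_eq_iff algebra_simps)

context reductive_with_cartan
begin

lemma root_nonzero: "\<alpha> \<in> roots H \<Longrightarrow> \<alpha> \<noteq> 0" by (simp add: roots_def)

lemma reflect_self: "\<alpha> \<in> roots H \<Longrightarrow> reflect H \<alpha> \<alpha> = - \<alpha>"
  by (auto simp: reflect_def fun_eq_iff)

lemma reflect_reflect: "\<alpha> \<in> roots H \<Longrightarrow> reflect H \<alpha> (reflect H \<alpha> \<nu>) = \<nu>"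
  by (auto simp: reflect_def fun_eq_iff algebra_simps)

lemma dual_uminusD: "\<nu> \<in> dual H \<Longrightarrow> h \<in> H \<Longrightarrow> \<nu> (- h) = - \<nu> h"
  using dual_scaleD[of \<nu> H h "-1"] by simp

lemma reflect_uminus_root: "\<alpha> \<in> roots H \<Longrightarrow> \<nu> \<in> dual H \<Longrightarrow> reflect H (- \<alpha>) \<nu> = reflect H \<alpha> \<nu>"
  by (auto simp: reflect_def fun_eq_iff coroot_uminus uminus_root dual_uminusD coroot_in_H)

text \<open>For \<open>m \<ge> 0\<close> the reflected root is step \<open>m\<close> of the string
  through \<open>\<beta>\<close>. For \<open>m < 0\<close> the root \<open>- \<alpha>\<close> has
  the same reflection and the opposite pairing.\<close>

lemma reflect_root:
  assumes \<alpha>: "\<alpha> \<in> roots H" and \<beta>: "\<beta> \<in> roots H"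
  shows "reflect H \<alpha> \<beta> \<in> roots H"
proof -
  have pos: "reflect H \<alpha> \<beta> \<in> roots H"
    if \<alpha>: "\<alpha> \<in> roots H" and m: "\<beta> (coroot H \<alpha>) = of_int m" "m \<ge> 0" for \<alpha> m
  proof -
    have "(\<lambda>z. \<beta> z - of_nat (nat m) * \<alpha> z) = reflect H \<alpha> \<beta>"
      using m by (auto simp: reflect_def)
    moreover have "reflect H \<alpha> \<beta> \<noteq> 0"
    proof
      assume "reflect H \<alpha> \<beta> = 0"
      then have "reflect H \<alpha> (reflect H \<alpha> \<beta>) = 0" by (simp only: reflect_zero)
      then show False using reflect_reflect[OF \<alpha>] root_nonzero[OF \<beta>] by simp
    qed
    ultimately show ?thesis using root_string_root[OF \<alpha> \<beta> m(1), of "nat m"] m(2) by simp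
  qed
  obtain m where m: "\<beta> (coroot H \<alpha>) = of_int m" using root_string[OF \<alpha> \<beta>] by metis
  show ?thesis
  proof (cases "m \<ge> 0")
    case True
    then show ?thesis using pos \<alpha> m by blast
  next
    case False
    have "\<beta> (coroot H (- \<alpha>)) = of_int (- m)"
      using m \<alpha> \<beta> by (simp add: coroot_uminus uminus_root dual_uminusD coroot_in_H roots_dual)
    then have "reflect H (- \<alpha>) \<beta> \<in> roots H"
      using False by (intro pos[of _ "- m"] uminus_root \<alpha>) auto
    then show ?thesis using reflect_uminus_root \<alpha> \<beta> roots_dual by metis
  qed
qed

text \<open>Lowering by \<open>y\<close> is injective on the weight spaces of the positive multiples
  of \<open>\<alpha>\<close>, so everything reduces to the space of \<open>2 \<alpha>\<close>, where
  the image of lowering turns out to be killed by \<open>y\<close> once more.\<close>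

lemma multiple_not_root:
  assumes \<alpha>: "\<alpha> \<in> roots H" and n: "n \<ge> 2"
  shows "(\<lambda>z. of_nat n * \<alpha> z) \<notin> roots H"
proof -
  have \<alpha>d: "\<alpha> \<in> dual H" "\<alpha> \<noteq> 0" using \<alpha> by (auto simp: roots_def)
  obtain x y where xy: "x \<in> root_space H \<alpha>" "y \<in> root_space H (- \<alpha>)" "B x y \<noteq> 0"
    "bracket x y = coroot H \<alpha>" "\<alpha> (coroot H \<alpha>) = 2"
    using coroot_triple[OF \<alpha>] by metis
  have nd: "(\<lambda>z. of_nat n * \<alpha> z) \<in> dual H" for n using \<alpha>d by auto
  have lowest: "z = 0" if z: "z \<in> root_space H (\<lambda>z. of_nat (Suc n) * \<alpha> z)" "bracket y z = 0" for n z
  proof (rule ccontr)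
    assume "z \<noteq> 0"
    \<comment> \<open>With \<open>x\<close> and \<open>y\<close> exchanged, \<open>z\<close> becomes
      a top vector, but its eigenvalue is \<open>- 2 (n + 1)\<close>, whereas a top eigenvalue is a
      natural number.\<close>
    have "bracket y x = - coroot H \<alpha>" using xy bracket_commute[of y x] by simp
    moreover have "(- \<alpha>) (- coroot H \<alpha>) = 2 * 1"
      using xy(5) \<alpha> by (simp add: dual_uminusD coroot_in_H roots_dual)
    moreover have "x \<in> root_space H (- (- \<alpha>))" using xy by simp
    moreover have "- \<alpha> \<in> dual H" "- \<alpha> \<noteq> 0" using \<alpha>d by auto
    ultimately obtain j :: nat where "of_nat (Suc n) * \<alpha> (- coroot H \<alpha>) = 1 * of_nat j"
      using string_from_top[of "- \<alpha>" y x "- coroot H \<alpha>" 1 "\<lambda>z. of_nat (Suc n) * \<alpha> z" z]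
        xy(2) nd[of "Suc n"] z \<open>z \<noteq> 0\<close> by blast
    then have "of_int (- 2 * (int (Suc n))) = (of_int (int j) :: complex)"
      using xy(5) \<alpha> by (simp add: dual_uminusD coroot_in_H roots_dual algebra_simps)
    then show False unfolding of_int_eq_iff by simp
  qed
  have down: "bracket y z \<in> root_space H (\<lambda>z. of_nat n * \<alpha> z)"
    if z: "z \<in> root_space H (\<lambda>z. of_nat (Suc n) * \<alpha> z)" for n z
  proof -
    have "- \<alpha> + (\<lambda>z. of_nat (Suc n) * \<alpha> z) = (\<lambda>z. of_nat n * \<alpha> z)"
      by (auto simp: fun_eq_iff algebra_simps)
    then show ?thesis using bracket_root_space[OF xy(2) z] by simp
  qed
  have "z = 0" if "z \<in> root_space H (\<lambda>z. of_nat (Suc (Suc n)) * \<alpha> z)" for n z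
    using that
  proof (induction n arbitrary: z)
    case 0
    let ?w = "bracket y z"
    have w: "?w \<in> root_space H (\<lambda>z. of_nat (Suc 0) * \<alpha> z)" by (rule down) (use 0 in simp)
    \<comment> \<open>By invariance this equals \<open>B (bracket y y) z\<close>. Since the bracket
      of opposite root vectors is governed by their \<open>B\<close>-value, \<open>?w\<close> and
      \<open>y\<close> commute.\<close>
    have "B y ?w = 0"
      using B_invariant[of y y z] B_scale_left[of 0 0 z] by (simp add: bracket_self)
    then have "B ?w y = 0" by (simp add: B_commute)
    have "bracket ?w y = 0"
    proof (rule B_nondegenerate_H)
      have w': "?w \<in> root_space H \<alpha>" using w by simp
      show "bracket ?w y \<in> H" using bracket_opposite_root_spaces(1)[OF w' xy(2)] .
      show "B (bracket ?w y) k = 0" if "k \<in> H" for k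
        using bracket_opposite_root_spaces(2)[OF w' xy(2) that] \<open>B ?w y = 0\<close> by simp
    qed
    then have "bracket y ?w = 0" using bracket_commute[of y ?w] by simp
    then have "?w = 0" using lowest w by blast
    then show ?case using lowest 0 by blast
  next
    case (Suc n)
    then show ?case using lowest down by blast
  qed
  moreover obtain k where "n = Suc (Suc k)" using n by (metis add_2_eq_Suc le_Suc_ex)
  ultimately show ?thesis using zero_in_root_space unfolding roots_def by blast
qed

lemma coroot_reflect:
  assumes \<alpha>: "\<alpha> \<in> roots H" and \<beta>: "\<beta> \<in> roots H"
  shows "coroot H (reflect H \<alpha> \<beta>) = coroot H \<beta> - \<alpha> (coroot H \<beta>) *\<^sub>C coroot H \<alpha>"
proof -
  obtain a where a: "\<And>h. h \<in> H \<Longrightarrow> B (coroot H \<alpha>) h = a * \<alpha> h" using B_coroot \<alpha> by metis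
  obtain b where b: "\<And>h. h \<in> H \<Longrightarrow> B (coroot H \<beta>) h = b * \<beta> h" using B_coroot \<beta> by metis
  note cH = coroot_in_H[OF \<alpha>] coroot_in_H[OF \<beta>]
  \<comment> \<open>Symmetry of \<open>B\<close> on the two coroots trades the factor
    \<open>a\<close> for \<open>b\<close>, so the candidate represents \<open>b\<close> times the
    reflected root, with the same \<open>b\<close> as for \<open>\<beta>\<close>.\<close>
  have ab: "a * \<alpha> (coroot H \<beta>) = b * \<beta> (coroot H \<alpha>)"
    using a[OF cH(2)] b[OF cH(1)] B_commute by metis
  have ev: "f (coroot H \<beta> - \<alpha> (coroot H \<beta>) *\<^sub>C coroot H \<alpha>) =
      f (coroot H \<beta>) - \<alpha> (coroot H \<beta>) * f (coroot H \<alpha>)" if "f \<in> dual H" for f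
    using that cH by (simp add: dual_diffD[OF H_subspace] H_scale dual_scaleD)
  show ?thesis
  proof (rule coroot_unique[where c = b])
    show "reflect H \<alpha> \<beta> \<in> roots H" using reflect_root \<alpha> \<beta> .
    show "coroot H \<beta> - \<alpha> (coroot H \<beta>) *\<^sub>C coroot H \<alpha> \<in> H" using cH by (simp add: H_diff H_scale)
    show "reflect H \<alpha> \<beta> (coroot H \<beta> - \<alpha> (coroot H \<beta>) *\<^sub>C coroot H \<alpha>) = 2"
      unfolding reflect_def using \<alpha> \<beta> by (simp add: ev roots_dual algebra_simps)
    show "B (coroot H \<beta> - \<alpha> (coroot H \<beta>) *\<^sub>C coroot H \<alpha>) k = b * reflect H \<alpha> \<beta> k" if "k \<in> H" for k
      using a[OF that] b[OF that] ab
      by (simp add: reflect_def B_diff_left B_scale_left algebra_simps)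
  qed
qed

text \<open>The form \<open>K h k = (\<Sum>\<delta>\<in>roots H. \<delta> h * \<delta> k)\<close> is invariant under reflections and takes
  positive values on coroots.\<close>

lemma coroot_pairing_sign:
  assumes \<alpha>: "\<alpha> \<in> roots H" and \<beta>: "\<beta> \<in> roots H"
    and mn: "\<alpha> (coroot H \<beta>) = of_int m" "\<beta> (coroot H \<alpha>) = of_int n"
  shows "sgn m = sgn n"
proof -
  define K where "K h k = (\<Sum>\<delta>\<in>roots H. \<delta> h * \<delta> k)" for h k
  have inv: "\<gamma> h * K (coroot H \<gamma>) (coroot H \<gamma>) = 2 * K h (coroot H \<gamma>)"
    if \<gamma>: "\<gamma> \<in> roots H" for \<gamma> h
  proof -
    let ?s = "reflect H \<gamma>" and ?c = "coroot H \<gamma>"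
    have "bij_betw ?s (roots H) (roots H)"
      by (rule bij_betwI[where g = ?s]) (use reflect_root reflect_reflect \<gamma> in auto)
    then have "K h ?c = (\<Sum>\<delta>\<in>roots H. ?s \<delta> h * ?s \<delta> ?c)"
      unfolding K_def by (rule sum.reindex_bij_betw[symmetric])
    also have "\<dots> = (\<Sum>\<delta>\<in>roots H. \<gamma> h * (\<delta> ?c * \<delta> ?c) - \<delta> h * \<delta> ?c)"
      using \<gamma> by (intro sum.cong) (auto simp: reflect_def algebra_simps)
    also have "\<dots> = \<gamma> h * K ?c ?c - K h ?c"
      by (simp add: K_def sum_subtractf sum_distrib_left)
    finally show ?thesis by (simp add: algebra_simps)
  qed
  have pos: "\<exists>N::int. N > 0 \<and> K (coroot H \<gamma>) (coroot H \<gamma>) = of_int N" if \<gamma>: "\<gamma> \<in> roots H" for \<gamma>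
  proof -
    have "\<forall>\<delta>\<in>roots H. \<exists>m::int. \<delta> (coroot H \<gamma>) = of_int m" using root_string[OF \<gamma>] by metis
    then obtain e :: "_ \<Rightarrow> int" where e: "\<And>\<delta>. \<delta> \<in> roots H \<Longrightarrow> \<delta> (coroot H \<gamma>) = of_int (e \<delta>)" by metis
    have "e \<gamma> \<noteq> 0" using e[OF \<gamma>] root_coroot[OF \<gamma>] by auto
    then have "(\<Sum>\<delta>\<in>roots H. e \<delta> * e \<delta>) > 0"
      by (intro sum_pos2[OF finite_roots \<gamma>]) (auto simp: zero_less_mult_iff linorder_neq_iff)
    moreover have "K (coroot H \<gamma>) (coroot H \<gamma>) = of_int (\<Sum>\<delta>\<in>roots H. e \<delta> * e \<delta>)"
      by (simp add: K_def e)
    ultimately show ?thesis by blast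
  qed
  obtain M N where MN: "M > 0" "N > 0" "K (coroot H \<alpha>) (coroot H \<alpha>) = of_int M"
    "K (coroot H \<beta>) (coroot H \<beta>) = of_int N" using pos \<alpha> \<beta> by metis
  \<comment> \<open>By symmetry \<open>m M\<close> and \<open>n N\<close> both equal twice this
    value, and \<open>M\<close>, \<open>N\<close> are positive.\<close>
  have "K (coroot H \<beta>) (coroot H \<alpha>) = K (coroot H \<alpha>) (coroot H \<beta>)"
    by (simp add: K_def mult.commute)
  then have "of_int (m * M) = (of_int (n * N) :: complex)"
    using inv[OF \<alpha>, of "coroot H \<beta>"] inv[OF \<beta>, of "coroot H \<alpha>"] MN mn by simp
  then have "m * M = n * N" unfolding of_int_eq_iff .
  then have "sgn m * sgn M = sgn n * sgn N" by (metis sgn_mult)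
  then show ?thesis using MN by simp
qed

lemma reflect_pairing:
  assumes \<alpha>: "\<alpha> \<in> roots H" and \<beta>: "\<beta> \<in> roots H" and \<nu>: "\<nu> \<in> dual H"
  shows "reflect H \<alpha> \<nu> (coroot H (reflect H \<alpha> \<beta>)) = \<nu> (coroot H \<beta>)"
  unfolding coroot_reflect[OF \<alpha> \<beta>] using coroot_in_H[OF \<alpha>] coroot_in_H[OF \<beta>] roots_dual[OF \<alpha>] \<nu> \<alpha>
  by (simp add: reflect_def dual_diffD[OF H_subspace] H_scale dual_scaleD algebra_simps)

end

section \<open>Positive systems\<close>

text \<open>\<open>ht\<close> is any linear functional with value \<open>1\<close> on the simple roots. In this locale \<open>K\<close> is an
  arbitrary subset of the Cartan subalgebra; \<open>K = {}\<close> gives the full root system and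
  \<open>K = Ha\<close> that of the orthogonal partner.\<close>

locale based_root_system = reductive_with_cartan H B
  for H :: "'g::fin_dim_complex_lie_algebra set" and B +
  fixes \<Gamma> :: "('g \<Rightarrow> complex) set" and ht :: "('g \<Rightarrow> complex) \<Rightarrow> complex"
  assumes base: "root_base H \<Gamma>"
    and ht_add: "ht (\<mu> + \<nu>) = ht \<mu> + ht \<nu>"
    and ht_scale: "ht (\<lambda>x. c * \<nu> x) = c * ht \<nu>"
    and ht_base: "\<alpha> \<in> \<Gamma> \<Longrightarrow> ht \<alpha> = 1"
begin

abbreviation pos :: "'g set \<Rightarrow> ('g \<Rightarrow> complex) set" where
  "pos K \<equiv> orth_pos_roots H K \<Gamma>"

lemma ht_zero: "ht 0 = 0"
  using ht_add[of 0 0] by simp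

lemma ht_minus: "ht (- \<nu>) = - ht \<nu>"
  using ht_add[of \<nu> "- \<nu>"] by (simp add: ht_zero add_eq_0_iff)

lemma ht_diff: "ht (\<mu> - \<nu>) = ht \<mu> - ht \<nu>"
  using ht_add[of \<mu> "- \<nu>"] by (simp add: ht_minus)

lemma ht_lincomb: "ht (\<lambda>x. \<mu> x - c * \<nu> x) = ht \<mu> - c * ht \<nu>"
proof -
  have "(\<lambda>x. \<mu> x - c * \<nu> x) = \<mu> - (\<lambda>x. c * \<nu> x)" by auto
  then show ?thesis by (simp only: ht_diff ht_scale)
qed

lemma ht_sum: "ht (\<lambda>x. \<Sum>\<alpha>\<in>A. c \<alpha> * \<alpha> x) = (\<Sum>\<alpha>\<in>A. c \<alpha> * ht \<alpha>)"
proof (induction A rule: infinite_finite_induct)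
  case (insert \<alpha> A)
  then have "(\<lambda>x. \<Sum>\<alpha>\<in>insert \<alpha> A. c \<alpha> * \<alpha> x) = (\<lambda>x. c \<alpha> * \<alpha> x) + (\<lambda>x. \<Sum>\<alpha>\<in>A. c \<alpha> * \<alpha> x)"
    by auto
  then show ?case using insert by (simp only: ht_add ht_scale) simp
qed (use ht_zero in \<open>simp_all add: zero_fun_def\<close>)

lemma ht_reflect: "ht (reflect H \<alpha> \<nu>) = ht \<nu> - \<nu> (coroot H \<alpha>) * ht \<alpha>"
  unfolding reflect_def by (rule ht_lincomb)

lemma base_finite: "finite \<Gamma>" and base_roots: "\<Gamma> \<subseteq> roots H"
  using base by (auto simp: root_base_def)

lemma orth_roots_empty: "orth_roots H {} = roots H" by (simp add: orth_roots_def)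

lemma pos_empty: "pos {} = pos_roots H \<Gamma>"
  by (auto simp: orth_pos_roots_def orth_roots_def pos_roots_def)

text \<open>On positive roots \<open>ht\<close> takes natural values; this is the same number as a
  \<open>nat\<close>, fit to be an induction measure.\<close>

definition height :: "('g \<Rightarrow> complex) \<Rightarrow> nat" where
  "height \<beta> = nat \<lfloor>Re (ht \<beta>)\<rfloor>"

lemma pos_orth_root: "\<beta> \<in> pos K \<Longrightarrow> \<beta> \<in> orth_roots H K"
  by (simp add: orth_pos_roots_def)

lemma orth_root: "\<beta> \<in> orth_roots H K \<Longrightarrow> \<beta> \<in> roots H"
  by (simp add: orth_roots_def)

lemma pos_root: "\<beta> \<in> pos K \<Longrightarrow> \<beta> \<in> roots H"
  by (simp add: orth_pos_roots_def orth_roots_def)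

lemma pos_expansion:
  assumes "\<beta> \<in> pos K"
  obtains n :: "('g \<Rightarrow> complex) \<Rightarrow> nat" where "\<beta> = (\<lambda>x. \<Sum>\<alpha>\<in>\<Gamma>. of_nat (n \<alpha>) * \<alpha> x)"
  using assms by (auto simp: orth_pos_roots_def pos_roots_def)

lemma pos_height:
  assumes "\<beta> \<in> pos K"
  shows "ht \<beta> = of_nat (height \<beta>)" "height \<beta> > 0"
proof -
  obtain n :: "('g \<Rightarrow> complex) \<Rightarrow> nat" where n: "\<beta> = (\<lambda>x. \<Sum>\<alpha>\<in>\<Gamma>. of_nat (n \<alpha>) * \<alpha> x)"
    using pos_expansion[OF assms] .
  have "ht \<beta> = (\<Sum>\<alpha>\<in>\<Gamma>. of_nat (n \<alpha>) * ht \<alpha>)" using ht_sum n by simp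
  also have "\<dots> = of_nat (\<Sum>\<alpha>\<in>\<Gamma>. n \<alpha>)" by (simp add: ht_base)
  finally have *: "ht \<beta> = of_nat (sum n \<Gamma>)" .
  then have h: "height \<beta> = sum n \<Gamma>" by (simp add: height_def del: of_nat_sum)
  show "ht \<beta> = of_nat (height \<beta>)" unfolding h by (rule *)
  have "sum n \<Gamma> \<noteq> 0"
  proof
    assume "sum n \<Gamma> = 0"
    then have "\<beta> = 0" using n base_finite by (simp add: fun_eq_iff)
    then show False using root_nonzero pos_root assms by blast
  qed
  then show "height \<beta> > 0" unfolding h by simp
qed

lemma pos_Re_ht: "\<beta> \<in> pos K \<Longrightarrow> Re (ht \<beta>) > 0"
  by (simp add: pos_height)

lemma orth_uminus: "\<beta> \<in> orth_roots H K \<Longrightarrow> - \<beta> \<in> orth_roots H K"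
  by (simp add: orth_roots_def uminus_root)

lemma orth_reflect: "\<alpha> \<in> orth_roots H K \<Longrightarrow> \<beta> \<in> orth_roots H K \<Longrightarrow> reflect H \<alpha> \<beta> \<in> orth_roots H K"
  by (simp add: orth_roots_def reflect_root) (simp add: reflect_def)

lemma pos_or_neg:
  assumes "\<beta> \<in> orth_roots H K"
  shows "\<beta> \<in> pos K \<or> - \<beta> \<in> pos K"
proof -
  obtain n :: "('g \<Rightarrow> complex) \<Rightarrow> nat" where
    n: "\<beta> = (\<lambda>x. \<Sum>\<alpha>\<in>\<Gamma>. of_nat (n \<alpha>) * \<alpha> x) \<or> \<beta> = (\<lambda>x. - (\<Sum>\<alpha>\<in>\<Gamma>. of_nat (n \<alpha>) * \<alpha> x))"
    using base orth_root[OF assms] unfolding root_base_def by meson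
  then have "\<beta> = (\<lambda>x. \<Sum>\<alpha>\<in>\<Gamma>. of_nat (n \<alpha>) * \<alpha> x) \<or> - \<beta> = (\<lambda>x. \<Sum>\<alpha>\<in>\<Gamma>. of_nat (n \<alpha>) * \<alpha> x)"
    by (auto simp: fun_eq_iff)
  then show ?thesis
    using assms orth_uminus[OF assms] orth_root unfolding orth_pos_roots_def pos_roots_def by blast
qed

lemma pos_iff_ht: "\<beta> \<in> orth_roots H K \<Longrightarrow> \<beta> \<in> pos K \<longleftrightarrow> Re (ht \<beta>) > 0"
  using pos_or_neg[of \<beta> K] pos_Re_ht[of \<beta> K] pos_Re_ht[of "- \<beta>" K] by (auto simp: ht_minus)

lemma uminus_pos_iff: "\<beta> \<in> orth_roots H K \<Longrightarrow> - \<beta> \<in> pos K \<longleftrightarrow> \<beta> \<notin> pos K"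
  using pos_or_neg[of \<beta> K] pos_iff_ht[of \<beta> K] pos_iff_ht[of "- \<beta>" K] orth_uminus[of \<beta> K]
  by (auto simp: ht_minus)

lemma pos_finite: "finite (pos K)"
  using finite_roots by (rule finite_subset[rotated]) (auto intro: pos_root)

text \<open>The indecomposable positive roots. They are intrinsic to the subsystem, whose simple
  roots can be decomposable in the ambient system and then are not in
  \<open>\<Gamma>\<close>.\<close>

definition simple :: "'g set \<Rightarrow> ('g \<Rightarrow> complex) set" where
  "simple K = {\<alpha>\<in>pos K. \<forall>\<beta>\<in>pos K. \<forall>\<gamma>\<in>pos K. \<alpha> \<noteq> \<beta> + \<gamma>}"

lemma simple_pos: "\<alpha> \<in> simple K \<Longrightarrow> \<alpha> \<in> pos K"
  by (simp add: simple_def)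

lemma simple_root: "\<alpha> \<in> simple K \<Longrightarrow> \<alpha> \<in> roots H"
  using simple_pos pos_root by blast

lemma simple_not_sum: "\<alpha> \<in> simple K \<Longrightarrow> \<beta> \<in> pos K \<Longrightarrow> \<gamma> \<in> pos K \<Longrightarrow> \<alpha> = \<beta> + \<gamma> \<Longrightarrow> False"
  by (auto simp: simple_def)

lemma height_reflect:
  assumes "\<alpha> \<in> pos K" "\<beta> \<in> pos K" "reflect H \<alpha> \<beta> \<in> pos K" "\<beta> (coroot H \<alpha>) = of_int m"
  shows "int (height (reflect H \<alpha> \<beta>)) = int (height \<beta>) - m * int (height \<alpha>)"
proof -
  have "of_int (int (height (reflect H \<alpha> \<beta>))) = (of_int (int (height \<beta>) - m * int (height \<alpha>)) :: complex)"
    using ht_reflect[of \<alpha> \<beta>] pos_height(1)[OF assms(1)] pos_height(1)[OF assms(2)]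
      pos_height(1)[OF assms(3)] assms(4) by simp
  then show ?thesis unfolding of_int_eq_iff .
qed

text \<open>If \<open>\<gamma> - k \<alpha>\<close> were positive and \<open>\<gamma> - (k + 1) \<alpha>\<close> negative, \<open>\<alpha>\<close> would be a sum of two positive
  roots; so the root string from \<open>\<gamma>\<close> to \<open>reflect H \<alpha> \<gamma>\<close> stays positive.\<close>

lemma simple_reflect_pos:
  assumes \<alpha>: "\<alpha> \<in> simple K" and \<gamma>: "\<gamma> \<in> pos K" and ne: "\<gamma> \<noteq> \<alpha>"
  shows "reflect H \<alpha> \<gamma> \<in> pos K"
proof -
  have \<alpha>p: "\<alpha> \<in> pos K" using \<alpha> by (rule simple_pos)
  note \<alpha>r = pos_root[OF \<alpha>p] and \<gamma>r = pos_root[OF \<gamma>]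
  obtain m :: int where m: "\<gamma> (coroot H \<alpha>) = of_int m" using root_string[OF \<alpha>r \<gamma>r] by metis
  show ?thesis
  proof (cases "m \<le> 0")
    case True
    have "Re (ht (reflect H \<alpha> \<gamma>)) = real (height \<gamma>) + of_int (- m) * real (height \<alpha>)"
      unfolding ht_reflect m pos_height(1)[OF \<alpha>p] pos_height(1)[OF \<gamma>] by simp
    moreover have "of_int (- m) * real (height \<alpha>) \<ge> 0" using True by (simp add: mult_nonpos_nonneg)
    ultimately have "Re (ht (reflect H \<alpha> \<gamma>)) > 0" using pos_height(2)[OF \<gamma>] by simp
    then show ?thesis using pos_iff_ht orth_reflect pos_orth_root \<alpha>p \<gamma> by blast
  next
    case False
    let ?g = "\<lambda>k::nat. \<lambda>z. \<gamma> z - of_nat k * \<alpha> z"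
    have "?g k \<in> pos K" if "int k \<le> m" for k
      using that
    proof (induction k)
      case 0
      show ?case using \<gamma> by simp
    next
      case (Suc k)
      then have k: "?g k \<in> pos K" by simp
      \<comment> \<open>If the string met 0, \<open>\<gamma>\<close> would be a multiple of
        \<open>\<alpha>\<close>: for \<open>k = 0\<close> it would be \<open>\<alpha>\<close>
        itself, and higher multiples are not roots.\<close>
      have "?g (Suc k) \<noteq> 0"
      proof
        assume "?g (Suc k) = 0"
        then have eq: "\<gamma> = (\<lambda>z. of_nat (Suc k) * \<alpha> z)" by (auto simp: fun_eq_iff)
        show False
        proof (cases k)
          case 0
          then show False using eq ne by simp
        next
          case (Suc l)
          then show False using eq multiple_not_root[OF \<alpha>r, of "Suc k"] \<gamma>r by simp
        qed
      qed
      then have "?g (Suc k) \<in> roots H"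
        using root_string_root[OF \<alpha>r \<gamma>r m] Suc.prems by blast
      then have o: "?g (Suc k) \<in> orth_roots H K"
        using pos_orth_root[OF \<alpha>p] pos_orth_root[OF \<gamma>] by (simp add: orth_roots_def)
      show ?case
      proof (rule ccontr)
        assume "?g (Suc k) \<notin> pos K"
        then have "- ?g (Suc k) \<in> pos K" using uminus_pos_iff[OF o] by blast
        moreover have "\<alpha> = ?g k + - ?g (Suc k)" by (auto simp: fun_eq_iff algebra_simps)
        ultimately show False using simple_not_sum[OF \<alpha> k] by blast
      qed
    qed
    from this[of "nat m"] show ?thesis using False m by (simp add: reflect_def)
  qed
qed

lemma simple_pairing_pos:
  assumes \<beta>: "\<beta> \<in> pos K"
  obtains \<alpha> m n where "\<alpha> \<in> simple K" "\<beta> (coroot H \<alpha>) = of_int m" "m > 0"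
    "\<alpha> (coroot H \<beta>) = of_int n" "n > 0"
proof -
  \<comment> \<open>Splitting positive roots into indecomposable ones propagates nonpositivity from
    the simple roots. Applied to \<open>\<beta>\<close> on its own coroot, where the value is 2,
    this forces a simple root with positive value.\<close>
  have "Re (\<gamma> h) \<le> 0" if "\<gamma> \<in> pos K" "\<forall>\<alpha>\<in>simple K. Re (\<alpha> h) \<le> 0" for \<gamma> h
    using that
  proof (induction \<gamma> rule: measure_induct_rule[of height])
    case (less \<gamma>)
    show ?case
    proof (cases "\<gamma> \<in> simple K")
      case False
      then obtain \<delta> \<epsilon> where *: "\<delta> \<in> pos K" "\<epsilon> \<in> pos K" "\<gamma> = \<delta> + \<epsilon>"
        using less.prems by (auto simp: simple_def)
      then have "(of_nat (height \<gamma>) :: complex) = of_nat (height \<delta> + height \<epsilon>)"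
        using ht_add[of \<delta> \<epsilon>] pos_height(1) less.prems(1) by (metis of_nat_add)
      then have "height \<gamma> = height \<delta> + height \<epsilon>" unfolding of_nat_eq_iff .
      then show ?thesis
        using less.IH[of \<delta>] less.IH[of \<epsilon>] less.prems(2) * pos_height(2)[OF *(1)] pos_height(2)[OF *(2)]
        by simp
    qed (use less in auto)
  qed
  from this[OF \<beta>, of "coroot H \<beta>"] obtain \<alpha> where \<alpha>: "\<alpha> \<in> simple K" "Re (\<alpha> (coroot H \<beta>)) > 0"
    using root_coroot[OF pos_root[OF \<beta>]] by fastforce
  obtain m where m: "\<beta> (coroot H \<alpha>) = of_int m"
    using root_string[OF simple_root[OF \<alpha>(1)] pos_root[OF \<beta>]] by metis
  obtain n where n: "\<alpha> (coroot H \<beta>) = of_int n"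
    using root_string[OF pos_root[OF \<beta>] simple_root[OF \<alpha>(1)]] by metis
  have "n > 0" using \<alpha>(2) n by simp
  moreover have "sgn n = sgn m"
    using coroot_pairing_sign[OF simple_root[OF \<alpha>(1)] pos_root[OF \<beta>] n m] .
  ultimately have "m > 0" by (auto simp: sgn_if split: if_splits)
  then show thesis using that \<alpha>(1) m n \<open>n > 0\<close> by blast
qed

text \<open>A positive root that is not simple loses height under a suitable simple reflection, so
  undoing such reflections reaches it from lower roots. The nonpositive pairing recorded with each
  step means that the coroot grows by \<open>n\<close> copies of a simple coroot.\<close>

lemma pos_induct [consumes 1, case_names simple reflect]:
  assumes \<beta>: "\<beta> \<in> pos K"
    and simple: "\<And>\<alpha>. \<alpha> \<in> simple K \<Longrightarrow> Q \<alpha>"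
    and reflect: "\<And>\<alpha> \<gamma> n. \<alpha> \<in> simple K \<Longrightarrow> \<gamma> \<in> pos K \<Longrightarrow> \<alpha> (coroot H \<gamma>) = - of_nat n \<Longrightarrow>
      Q \<gamma> \<Longrightarrow> Q (reflect H \<alpha> \<gamma>)"
  shows "Q \<beta>"
  using \<beta>
proof (induction \<beta> rule: measure_induct_rule[of height])
  case (less \<beta>)
  show ?case
  proof (cases "\<beta> \<in> simple K")
    case False
    obtain \<alpha> m n where \<alpha>: "\<alpha> \<in> simple K" and m: "\<beta> (coroot H \<alpha>) = of_int m" "m > 0"
      and n: "\<alpha> (coroot H \<beta>) = of_int n" "n > 0"
      using simple_pairing_pos[OF less.prems] .
    let ?\<gamma> = "reflect H \<alpha> \<beta>"
    note r = simple_root[OF \<alpha>] pos_root[OF less.prems]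
    have \<gamma>: "?\<gamma> \<in> pos K" using simple_reflect_pos[OF \<alpha> less.prems] False \<alpha> by blast
    have "int (height ?\<gamma>) = int (height \<beta>) - m * int (height \<alpha>)"
      using height_reflect[OF simple_pos[OF \<alpha>] less.prems \<gamma> m(1)] .
    moreover have "m * int (height \<alpha>) > 0" using m pos_height(2)[OF simple_pos[OF \<alpha>]] by simp
    ultimately have "height ?\<gamma> < height \<beta>" by linarith
    then have "Q ?\<gamma>" using less.IH \<gamma> by blast
    moreover have "reflect H \<alpha> \<alpha> (coroot H ?\<gamma>) = \<alpha> (coroot H \<beta>)"
      using reflect_pairing[OF r roots_dual[OF r(1)]] .
    then have "\<alpha> (coroot H ?\<gamma>) = - of_int n"
      using n reflect_self[OF r(1)] by (metis minus_minus uminus_apply)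
    then have "\<alpha> (coroot H ?\<gamma>) = - of_nat (nat n)" using n(2) by simp
    ultimately have "Q (reflect H \<alpha> ?\<gamma>)" using reflect[OF \<alpha> \<gamma>] by blast
    then show ?thesis using reflect_reflect r by simp
  qed (use simple in blast)
qed

lemma base_pos: "\<alpha> \<in> \<Gamma> \<Longrightarrow> \<alpha> \<in> pos {}"
  using base_roots pos_iff_ht[of \<alpha> "{}"] by (auto simp: orth_roots_empty ht_base)

lemma base_height: "\<alpha> \<in> \<Gamma> \<Longrightarrow> height \<alpha> = 1"
  by (simp add: height_def ht_base)

lemma height_add:
  assumes "\<alpha> \<in> pos K" "\<beta> \<in> pos K" "\<alpha> + \<beta> \<in> pos K"
  shows "height (\<alpha> + \<beta>) = height \<alpha> + height \<beta>"
proof -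
  have "(of_nat (height (\<alpha> + \<beta>)) :: complex) = of_nat (height \<alpha> + height \<beta>)"
    using ht_add[of \<alpha> \<beta>] assms by (simp add: pos_height(1))
  then show ?thesis unfolding of_nat_eq_iff .
qed

text \<open>Elements of \<open>\<Gamma>\<close> have height 1 and cannot split. Conversely, an
  indecomposable \<open>\<alpha>\<close> outside \<open>\<Gamma>\<close> pairs positively with some
  \<open>\<gamma>\<close> in \<open>\<Gamma>\<close>, so \<open>\<gamma> - \<alpha>\<close> is a
  root: if positive, \<open>\<gamma>\<close> of height 1 splits, and if negative,
  \<open>\<alpha>\<close> does.\<close>

lemma simple_empty: "simple {} = \<Gamma>"
proof (intro equalityI subsetI)
  fix \<alpha> assume \<alpha>: "\<alpha> \<in> \<Gamma>"
  have "\<alpha> \<noteq> \<beta> + \<gamma>" if "\<beta> \<in> pos {}" "\<gamma> \<in> pos {}" for \<beta> \<gamma>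
    using height_add[OF that] pos_height(2)[OF that(1)] pos_height(2)[OF that(2)]
      base_pos[OF \<alpha>] base_height[OF \<alpha>] by auto
  then show "\<alpha> \<in> simple {}" using base_pos[OF \<alpha>] by (simp add: simple_def)
next
  fix \<alpha> assume \<alpha>: "\<alpha> \<in> simple {}"
  note \<alpha>p = simple_pos[OF \<alpha>] and \<alpha>r = simple_root[OF \<alpha>]
  obtain n :: "('g \<Rightarrow> complex) \<Rightarrow> nat" where n: "\<alpha> = (\<lambda>x. \<Sum>\<gamma>\<in>\<Gamma>. of_nat (n \<gamma>) * \<gamma> x)"
    using pos_expansion[OF \<alpha>p] .
  have "\<exists>\<gamma>\<in>\<Gamma>. Re (\<gamma> (coroot H \<alpha>)) > 0"
  proof (rule ccontr)
    assume "\<not> ?thesis"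
    then have "(\<Sum>\<gamma>\<in>\<Gamma>. real (n \<gamma>) * Re (\<gamma> (coroot H \<alpha>))) \<le> 0"
      by (intro sum_nonpos) (auto simp: not_less intro: mult_nonneg_nonpos)
    moreover have "Re (\<alpha> (coroot H \<alpha>)) = (\<Sum>\<gamma>\<in>\<Gamma>. real (n \<gamma>) * Re (\<gamma> (coroot H \<alpha>)))"
      by (subst n) simp
    ultimately show False using \<alpha>r by simp
  qed
  then obtain \<gamma> where \<gamma>: "\<gamma> \<in> \<Gamma>" "Re (\<gamma> (coroot H \<alpha>)) > 0" by blast
  have \<gamma>r: "\<gamma> \<in> roots H" using \<gamma> base_roots by blast
  obtain m where m: "\<gamma> (coroot H \<alpha>) = of_int m" using root_string[OF \<alpha>r \<gamma>r] by metis
  have m1: "int 1 \<le> m" using \<gamma>(2) m by simp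
  show "\<alpha> \<in> \<Gamma>"
  proof (rule ccontr)
    assume "\<alpha> \<notin> \<Gamma>"
    then have "\<gamma> \<noteq> \<alpha>" using \<gamma> by blast
    then have "(\<lambda>z. \<gamma> z - of_nat 1 * \<alpha> z) \<noteq> 0" by (auto simp: fun_eq_iff)
    from root_string_root[OF \<alpha>r \<gamma>r m m1 this] have "\<gamma> - \<alpha> \<in> roots H"
      by (simp add: fun_diff_def)
    then have o: "\<gamma> - \<alpha> \<in> orth_roots H {}" by (simp add: orth_roots_empty)
    show False
    proof (cases "\<gamma> - \<alpha> \<in> pos {}")
      case True
      then show False
        using height_add[OF \<alpha>p True] base_pos[OF \<gamma>(1)] base_height[OF \<gamma>(1)] pos_height(2)[OF \<alpha>p]
          pos_height(2)[OF True] by simp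
    next
      case False
      then have "\<alpha> - \<gamma> \<in> pos {}" using uminus_pos_iff[OF o] by simp
      from simple_not_sum[OF \<alpha> base_pos[OF \<gamma>(1)] this] show False by simp
    qed
  qed
qed

text \<open>The simple reflection permutes the other positive roots and negates their values on the
  coroot of \<open>\<alpha>\<close>, so these cancel. Only \<open>\<alpha>\<close> contributes, with
  half of 2.\<close>

lemma half_sum_simple:
  assumes \<alpha>: "\<alpha> \<in> simple K"
  shows "half_sum (pos K) (coroot H \<alpha>) = 1"
proof -
  let ?T = "pos K - {\<alpha>}" and ?s = "reflect H \<alpha>"
  note \<alpha>r = simple_root[OF \<alpha>] and \<alpha>p = simple_pos[OF \<alpha>]
  have "?s \<gamma> \<noteq> \<alpha>" if "\<gamma> \<in> pos K" for \<gamma>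
  proof
    assume "?s \<gamma> = \<alpha>"
    then have "\<gamma> = - \<alpha>" using reflect_reflect[OF \<alpha>r] reflect_self[OF \<alpha>r] by metis
    then show False using that \<alpha>p uminus_pos_iff[OF pos_orth_root[OF \<alpha>p]] by simp
  qed
  then have "bij_betw ?s ?T ?T"
    by (intro bij_betwI[where g = ?s]) (use simple_reflect_pos[OF \<alpha>] reflect_reflect[OF \<alpha>r] in auto)
  then have "(\<Sum>\<beta>\<in>?T. \<beta> (coroot H \<alpha>)) = (\<Sum>\<beta>\<in>?T. ?s \<beta> (coroot H \<alpha>))"
    by (rule sum.reindex_bij_betw[symmetric])
  also have "\<dots> = - (\<Sum>\<beta>\<in>?T. \<beta> (coroot H \<alpha>))"
    using \<alpha>r by (simp add: reflect_def sum_negf[symmetric])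
  finally have "(\<Sum>\<beta>\<in>?T. \<beta> (coroot H \<alpha>)) = 0" by simp
  then have "(\<Sum>\<beta>\<in>pos K. \<beta> (coroot H \<alpha>)) = 2"
    using sum.remove[OF pos_finite \<alpha>p, of "\<lambda>\<beta>. \<beta> (coroot H \<alpha>)"] \<alpha>r by simp
  then show ?thesis by (simp add: half_sum_def)
qed

text \<open>Each coroot of a positive root is a sum of simple coroots. Phrasing this through a set
  closed under addition serves both for positive integers and for natural numbers.\<close>

lemma pos_coroot_closed:
  assumes \<nu>: "\<nu> \<in> dual H" and A: "\<And>a b. a \<in> A \<Longrightarrow> b \<in> A \<Longrightarrow> a + b \<in> A"
    and simple: "\<And>\<alpha>. \<alpha> \<in> simple K \<Longrightarrow> \<nu> (coroot H \<alpha>) \<in> A" and \<beta>: "\<beta> \<in> pos K"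
  shows "\<nu> (coroot H \<beta>) \<in> A"
  using \<beta>
proof (induction rule: pos_induct)
  case (reflect \<alpha> \<gamma> n)
  have r: "\<alpha> \<in> roots H" "\<gamma> \<in> roots H" using reflect simple_root pos_root by auto
  have "\<nu> (coroot H (reflect H \<alpha> \<gamma>)) = \<nu> (coroot H \<gamma>) + of_nat n * \<nu> (coroot H \<alpha>)"
    using r \<nu> reflect(3)
    by (simp add: coroot_reflect dual_diffD[OF H_subspace] H_scale coroot_in_H dual_addD dual_scaleD)
  moreover have "\<nu> (coroot H \<gamma>) + of_nat k * \<nu> (coroot H \<alpha>) \<in> A" for k
  proof (induction k)
    case (Suc k)
    then show ?case using A[OF Suc simple[OF reflect(1)]] by (simp add: algebra_simps)
  qed (use reflect in simp)
  ultimately show ?case by simp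
qed (rule simple)

lemma half_sum_dual:
  assumes "\<Phi> \<subseteq> dual H"
  shows "half_sum \<Phi> \<in> dual H"
proof -
  have "(\<Sum>\<alpha>\<in>\<Phi>. \<alpha> (x + y)) = (\<Sum>\<alpha>\<in>\<Phi>. \<alpha> x) + (\<Sum>\<alpha>\<in>\<Phi>. \<alpha> y)" if "x \<in> H" "y \<in> H" for x y
    unfolding sum.distrib[symmetric] using assms that by (intro sum.cong) (auto simp: dual_addD)
  moreover have "(\<Sum>\<alpha>\<in>\<Phi>. \<alpha> (c *\<^sub>C x)) = c * (\<Sum>\<alpha>\<in>\<Phi>. \<alpha> x)" if "x \<in> H" for x c
    unfolding sum_distrib_left using assms that by (intro sum.cong) (auto simp: dual_scaleD)
  moreover have "(\<Sum>\<alpha>\<in>\<Phi>. \<alpha> x) = 0" if "x \<notin> H" for x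
    using assms that by (intro sum.neutral) (auto simp: dual_def)
  ultimately show ?thesis
    by (auto simp: half_sum_def dual_def add_divide_distrib)
qed

lemma half_sum_pos_dual: "half_sum (pos K) \<in> dual H"
  using half_sum_dual pos_root roots_dual by blast

end

section \<open>Words in reflections and the Weyl group\<close>

definition act ::
    "'g::fin_dim_complex_lie_algebra set \<Rightarrow> ('g \<Rightarrow> complex) list \<Rightarrow> ('g \<Rightarrow> complex) \<Rightarrow> 'g \<Rightarrow> complex" where
  "act H as = foldr (reflect H) as"

text \<open>Members of \<open>BijGroup (dual H)\<close> are extensional functions, hence the
  restriction.\<close>

definition word_map ::
    "'g::fin_dim_complex_lie_algebra set \<Rightarrow> ('g \<Rightarrow> complex) list \<Rightarrow> ('g \<Rightarrow> complex) \<Rightarrow> 'g \<Rightarrow> complex" where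
  "word_map H as = restrict (act H as) (dual H)"

lemma act_Nil [simp]: "act H [] \<nu> = \<nu>"
  by (simp add: act_def)

lemma act_Cons [simp]: "act H (\<alpha> # as) \<nu> = reflect H \<alpha> (act H as \<nu>)"
  by (simp add: act_def)

lemma act_append [simp]: "act H (as @ bs) \<nu> = act H as (act H bs \<nu>)"
  by (simp add: act_def)

lemma act_add: "act H as (\<mu> + \<nu>) = act H as \<mu> + act H as \<nu>"
  by (induction as) (simp_all only: act_Nil act_Cons reflect_add)

lemma act_minus: "act H as (- \<nu>) = - act H as \<nu>"
  by (induction as) (simp_all only: act_Nil act_Cons reflect_minus)

lemma act_lincomb: "act H as (\<lambda>x. \<mu> x - c * \<nu> x) = (\<lambda>x. act H as \<mu> x - c * act H as \<nu> x)"
  by (induction as) (simp_all add: reflect_lincomb)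

text \<open>Conjugating a reflection by a word gives the reflection in the transported root; the
  premise is the invariance of the pairing.\<close>

lemma act_conjugate:
  assumes "act H as \<nu> (coroot H (act H as \<beta>)) = \<nu> (coroot H \<beta>)"
  shows "reflect H (act H as \<beta>) (act H as \<nu>) = act H as (reflect H \<beta> \<nu>)"
  unfolding reflect_def act_lincomb assms ..

lemma reflection_eq: "reflection H \<alpha> = restrict (reflect H \<alpha>) (dual H)"
  unfolding reflection_def by (rule restrict_ext) (simp add: reflect_def)

lemma word_map_eq_iff:
  "word_map H as = word_map H bs \<longleftrightarrow> (\<forall>\<nu>\<in>dual H. act H as \<nu> = act H bs \<nu>)"
  unfolding word_map_def by (metis restrict_apply' restrict_ext)

context based_root_system
begin

lemma act_dual: "set as \<subseteq> roots H \<Longrightarrow> \<nu> \<in> dual H \<Longrightarrow> act H as \<nu> \<in> dual H"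
  by (induction as) (auto intro: reflect_dual roots_dual)

lemma act_orth:
  "set as \<subseteq> orth_roots H K \<Longrightarrow> \<beta> \<in> orth_roots H K \<Longrightarrow> act H as \<beta> \<in> orth_roots H K"
  by (induction as) (auto intro: orth_reflect)

lemma act_roots: "set as \<subseteq> roots H \<Longrightarrow> \<beta> \<in> roots H \<Longrightarrow> act H as \<beta> \<in> roots H"
  using act_orth[of as "{}" \<beta>] by (simp add: orth_roots_empty)

lemma act_rev: "set as \<subseteq> roots H \<Longrightarrow> act H (rev as) (act H as \<nu>) = \<nu>"
  by (induction as arbitrary: \<nu>) (auto simp: reflect_reflect)

lemma act_rev': "set as \<subseteq> roots H \<Longrightarrow> act H as (act H (rev as) \<nu>) = \<nu>"
  using act_rev[of "rev as"] by simp

lemma act_pairing: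
  "set as \<subseteq> roots H \<Longrightarrow> \<beta> \<in> roots H \<Longrightarrow> \<nu> \<in> dual H \<Longrightarrow>
    act H as \<nu> (coroot H (act H as \<beta>)) = \<nu> (coroot H \<beta>)"
  by (induction as) (auto simp: reflect_pairing act_roots act_dual)

text \<open>Letters act from the right, and a simple reflection makes no positive root negative but
  its own. So at the first change of sign the current root is the letter itself.\<close>

lemma first_sign_change:
  assumes "set as \<subseteq> simple K" "\<beta> \<in> pos K" "act H as \<beta> \<notin> pos K"
  obtains bs \<gamma> cs where "as = bs @ \<gamma> # cs" "act H cs \<beta> = \<gamma>"
  using assms(1,3)
proof (induction as arbitrary: thesis)
  case Nil
  then show ?case using assms(2) by simp
next
  case (Cons \<alpha> as)
  show ?case
  proof (cases "act H as \<beta> \<in> pos K")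
    case True
    then have "act H as \<beta> = \<alpha>" using simple_reflect_pos[of \<alpha> K "act H as \<beta>"] Cons.prems by auto
    then show ?thesis using Cons.prems(1)[of "[]" \<alpha> as] by simp
  next
    case False
    then obtain bs \<gamma> cs where "as = bs @ \<gamma> # cs" "act H cs \<beta> = \<gamma>"
      using Cons.IH Cons.prems by auto
    then show ?thesis using Cons.prems(1)[of "\<alpha> # bs" \<gamma> cs] by simp
  qed
qed

text \<open>The exchange condition: the last letter of the word makes its own root negative, so some
  earlier letter undoes this, and both letters can be deleted.\<close>

lemma simple_word_trivial:
  assumes "set as \<subseteq> simple K" "\<And>\<beta>. \<beta> \<in> pos K \<Longrightarrow> act H as \<beta> \<in> pos K"
  shows "(\<forall>\<nu>\<in>dual H. act H as \<nu> = \<nu>) \<and> even (length as)"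
  using assms
proof (induction as rule: length_induct)
  case (1 as)
  show ?case
  proof (cases as rule: rev_cases)
    case (snoc bs \<alpha>)
    have \<alpha>: "\<alpha> \<in> simple K" and bs: "set bs \<subseteq> simple K" using 1(2) snoc by auto
    note \<alpha>r = simple_root[OF \<alpha>]
    have bsr: "set bs \<subseteq> roots H" "set bs \<subseteq> orth_roots H K"
      using bs simple_root simple_pos pos_orth_root by blast+
    have "- act H bs \<alpha> \<in> pos K"
      using 1(3)[OF simple_pos[OF \<alpha>]]
      unfolding snoc act_append act_Cons act_Nil reflect_self[OF \<alpha>r] act_minus .
    then have "act H bs \<alpha> \<notin> pos K"
      using uminus_pos_iff[of "act H bs \<alpha>" K] act_orth[OF bsr(2)] simple_pos[OF \<alpha>] pos_orth_root by blast
    then obtain cs \<gamma> ds where w: "bs = cs @ \<gamma> # ds" "act H ds \<alpha> = \<gamma>"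
      using first_sign_change[OF bs simple_pos[OF \<alpha>]] by metis
    have dsr: "set ds \<subseteq> roots H" using bsr w by auto
    \<comment> \<open>As \<open>\<gamma>\<close> is the image of \<open>\<alpha>\<close> under
      \<open>ds\<close>, reflecting in \<open>\<gamma>\<close> after \<open>ds\<close> is the same
      as applying \<open>ds\<close> after reflecting in \<open>\<alpha>\<close>; the final
      \<open>\<alpha>\<close> then cancels.\<close>
    have eq: "act H as \<nu> = act H (cs @ ds) \<nu>" if \<nu>: "\<nu> \<in> dual H" for \<nu>
    proof -
      let ?\<nu> = "reflect H \<alpha> \<nu>"
      have "?\<nu> \<in> dual H" using \<nu> \<alpha>r by (simp add: reflect_dual roots_dual)
      then have "reflect H (act H ds \<alpha>) (act H ds ?\<nu>) = act H ds (reflect H \<alpha> ?\<nu>)"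
        by (intro act_conjugate act_pairing dsr \<alpha>r)
      then show ?thesis using snoc w \<alpha>r by (simp add: reflect_reflect)
    qed
    have "(\<forall>\<nu>\<in>dual H. act H (cs @ ds) \<nu> = \<nu>) \<and> even (length (cs @ ds))"
    proof (rule 1(1)[rule_format])
      show "length (cs @ ds) < length as" using snoc w by simp
      show "set (cs @ ds) \<subseteq> simple K" using bs w by auto
      show "act H (cs @ ds) \<beta> \<in> pos K" if "\<beta> \<in> pos K" for \<beta>
        using 1(3)[OF that] unfolding eq[OF roots_dual[OF pos_root[OF that]]] .
    qed
    then show ?thesis using eq snoc w by auto
  qed simp
qed

text \<open>Along the induction, the reflection in the new root is the old one conjugated by a
  simple reflection.\<close>

lemma pos_reflect_simple_word:
  assumes "\<beta> \<in> pos K"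
  shows "\<exists>as. set as \<subseteq> simple K \<and> (\<forall>\<nu>\<in>dual H. reflect H \<beta> \<nu> = act H as \<nu>)"
  using assms
proof (induction rule: pos_induct)
  case (simple \<alpha>)
  then show ?case by (intro exI[of _ "[\<alpha>]"]) simp
next
  case (reflect \<alpha> \<gamma> n)
  then obtain as where as: "set as \<subseteq> simple K" "\<forall>\<nu>\<in>dual H. reflect H \<gamma> \<nu> = act H as \<nu>" by blast
  have r: "\<alpha> \<in> roots H" "\<gamma> \<in> roots H" using reflect simple_root pos_root by auto
  have "reflect H (reflect H \<alpha> \<gamma>) \<nu> = act H (\<alpha> # as @ [\<alpha>]) \<nu>" if \<nu>: "\<nu> \<in> dual H" for \<nu>
  proof -
    have d: "reflect H \<alpha> \<nu> \<in> dual H" using r \<nu> by (simp add: reflect_dual roots_dual)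
    have "reflect H (act H [\<alpha>] \<gamma>) (act H [\<alpha>] (reflect H \<alpha> \<nu>)) = act H [\<alpha>] (reflect H \<gamma> (reflect H \<alpha> \<nu>))"
      by (rule act_conjugate, rule act_pairing) (use r d in auto)
    then show ?thesis using as(2) d r by (simp add: reflect_reflect)
  qed
  then show ?case using as reflect by (intro exI[of _ "\<alpha> # as @ [\<alpha>]"]) auto
qed

lemma orth_word_simple_word:
  assumes "set as \<subseteq> orth_roots H K"
  shows "\<exists>bs. set bs \<subseteq> simple K \<and> (\<forall>\<nu>\<in>dual H. act H as \<nu> = act H bs \<nu>)"
  using assms
proof (induction as)
  case Nil
  show ?case by (intro exI[of _ "[]"]) simp
next
  case (Cons \<alpha> as)
  then obtain bs where bs: "set bs \<subseteq> simple K" "\<forall>\<nu>\<in>dual H. act H as \<nu> = act H bs \<nu>" by auto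
  have bsr: "set bs \<subseteq> roots H" using bs simple_root by blast
  have \<alpha>: "\<alpha> \<in> orth_roots H K" using Cons by simp
  have "\<exists>cs. set cs \<subseteq> simple K \<and> (\<forall>\<nu>\<in>dual H. reflect H \<alpha> \<nu> = act H cs \<nu>)"
    using pos_or_neg[OF \<alpha>] pos_reflect_simple_word[of \<alpha> K] pos_reflect_simple_word[of "- \<alpha>" K]
      reflect_uminus_root[OF orth_root[OF \<alpha>]] by auto
  then obtain cs where cs: "set cs \<subseteq> simple K" "\<forall>\<nu>\<in>dual H. reflect H \<alpha> \<nu> = act H cs \<nu>" by blast
  have "act H (\<alpha> # as) \<nu> = act H (cs @ bs) \<nu>" if "\<nu> \<in> dual H" for \<nu>
    using that bs(2) cs(2) act_dual[OF bsr that] by simp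
  then show ?case using bs cs by (intro exI[of _ "cs @ bs"]) auto
qed

lemma word_map_Bij: "set as \<subseteq> roots H \<Longrightarrow> word_map H as \<in> Bij (dual H)"
  unfolding Bij_def word_map_def
  by (auto intro!: bij_betwI[where g = "act H (rev as)"] simp: act_rev act_rev' act_dual)

lemma word_map_mult:
  assumes "set as \<subseteq> roots H" "set bs \<subseteq> roots H"
  shows "word_map H as \<otimes>\<^bsub>BijGroup (dual H)\<^esub> word_map H bs = word_map H (as @ bs)"
  using word_map_Bij[OF assms(1)] word_map_Bij[OF assms(2)] assms
  by (auto simp: BijGroup_def compose_def word_map_def fun_eq_iff act_dual)

lemma word_map_Nil: "word_map H [] = \<one>\<^bsub>BijGroup (dual H)\<^esub>"
  by (auto simp: BijGroup_def word_map_def)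

lemma word_map_single: "word_map H [\<alpha>] = reflection H \<alpha>"
  by (auto simp: word_map_def reflection_eq fun_eq_iff)

lemma foldr_reflection:
  "set as \<subseteq> roots H \<Longrightarrow>
    foldr (\<lambda>\<alpha> v. reflection H \<alpha> \<otimes>\<^bsub>BijGroup (dual H)\<^esub> v) as \<one>\<^bsub>BijGroup (dual H)\<^esub> = word_map H as"
proof (induction as)
  case (Cons \<alpha> as)
  then show ?case using word_map_mult[of "[\<alpha>]" as] by (simp add: word_map_single)
qed (simp add: word_map_Nil)

lemma weyl_group_words:
  assumes \<Phi>: "\<Phi> \<subseteq> roots H"
  shows "weyl_group H \<Phi> = word_map H ` lists \<Phi>"
proof (intro equalityI subsetI)
  fix w assume "w \<in> weyl_group H \<Phi>"
  then show "w \<in> word_map H ` lists \<Phi>"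
    unfolding weyl_group_def
  proof (induction rule: generate.induct)
    case one
    show ?case by (rule image_eqI[of _ _ "[]"]) (simp_all add: word_map_Nil)
  next
    case (incl w)
    then obtain \<alpha> where "\<alpha> \<in> \<Phi>" "w = reflection H \<alpha>" by auto
    then show ?case by (intro image_eqI[of _ _ "[\<alpha>]"]) (simp_all add: word_map_single)
  next
    case (inv w)
    then obtain \<alpha> where \<alpha>: "\<alpha> \<in> \<Phi>" "w = reflection H \<alpha>" by auto
    then have r: "set [\<alpha>] \<subseteq> roots H" using \<Phi> by auto
    have "word_map H [\<alpha>, \<alpha>] = word_map H []"
      using r by (simp add: word_map_eq_iff reflect_reflect)
    then have "w \<otimes>\<^bsub>BijGroup (dual H)\<^esub> w = \<one>\<^bsub>BijGroup (dual H)\<^esub>"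
      using word_map_mult[OF r r] \<alpha> by (simp add: word_map_single word_map_Nil)
    moreover have "w \<in> carrier (BijGroup (dual H))"
      using word_map_Bij[OF r] \<alpha> by (simp add: BijGroup_def word_map_single)
    ultimately have "inv\<^bsub>BijGroup (dual H)\<^esub> w = w"
      by (intro group.inv_equality group_BijGroup)
    then show ?case using \<alpha> by (intro image_eqI[of _ _ "[\<alpha>]"]) (simp_all add: word_map_single)
  next
    case (eng v w)
    then obtain as bs where *: "as \<in> lists \<Phi>" "bs \<in> lists \<Phi>" "v = word_map H as" "w = word_map H bs"
      by auto
    moreover have "set as \<subseteq> roots H" "set bs \<subseteq> roots H" using * \<Phi> by auto
    ultimately have "v \<otimes>\<^bsub>BijGroup (dual H)\<^esub> w = word_map H (as @ bs)"
      using word_map_mult by simp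
    then show ?case using * by (intro image_eqI[of _ _ "as @ bs"]) auto
  qed
next
  fix w assume "w \<in> word_map H ` lists \<Phi>"
  then obtain as where as: "set as \<subseteq> \<Phi>" "w = word_map H as" by auto
  have "word_map H as \<in> generate (BijGroup (dual H)) (reflection H ` \<Phi>)" using as(1)
  proof (induction as)
    case Nil
    show ?case unfolding word_map_Nil by (rule generate.one)
  next
    case (Cons \<alpha> as)
    then have r: "set [\<alpha>] \<subseteq> roots H" "set as \<subseteq> roots H" using \<Phi> by auto
    have "word_map H (\<alpha> # as) = reflection H \<alpha> \<otimes>\<^bsub>BijGroup (dual H)\<^esub> word_map H as"
      using word_map_mult[OF r] by (simp add: word_map_single)
    then show ?case using Cons by (auto intro: generate.eng generate.incl)
  qed
  then show "w \<in> weyl_group H \<Phi>" using as by (simp add: weyl_group_def)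
qed

text \<open>The range allowed for \<open>\<Phi>\<close> covers both conventions in use: the full
  group is generated from all roots, the small one from positive roots.\<close>

lemma weyl_group_simple_words:
  assumes "pos K \<subseteq> \<Phi>" "\<Phi> \<subseteq> orth_roots H K"
  shows "weyl_group H \<Phi> = word_map H ` lists (simple K)"
proof -
  have "\<Phi> \<subseteq> roots H" using assms orth_root by blast
  moreover have "word_map H as \<in> word_map H ` lists (simple K)" if "as \<in> lists \<Phi>" for as
  proof -
    have "set as \<subseteq> orth_roots H K" using that assms by auto
    then obtain bs where "set bs \<subseteq> simple K" "\<forall>\<nu>\<in>dual H. act H as \<nu> = act H bs \<nu>"
      using orth_word_simple_word by blast
    then show ?thesis by (intro image_eqI[of _ _ bs]) (auto simp: word_map_eq_iff)
  qed
  moreover have "lists (simple K) \<subseteq> lists \<Phi>"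
    using assms simple_pos by (intro lists_mono) blast
  ultimately show ?thesis by (auto simp: weyl_group_words)
qed

lemma weyl_group_orth: "weyl_group H (pos K) = word_map H ` lists (simple K)"
  by (rule weyl_group_simple_words) (auto intro: pos_orth_root)

lemma weyl_group_full: "weyl_group H (roots H) = word_map H ` lists \<Gamma>"
  using weyl_group_simple_words[of "{}" "roots H"] pos_root
  by (auto simp: orth_roots_empty simple_empty)

text \<open>The word \<open>rev bs @ as\<close> fixes every positive root, hence acts trivially and
  has even length.\<close>

lemma simple_words_eq:
  assumes as: "set as \<subseteq> simple K" and bs: "set bs \<subseteq> simple K"
    and eq: "\<And>\<beta>. \<beta> \<in> pos K \<Longrightarrow> act H as \<beta> = act H bs \<beta>"
  shows "word_map H as = word_map H bs" "even (length as) = even (length bs)"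
proof -
  have r: "set as \<subseteq> roots H" "set bs \<subseteq> roots H" using as bs simple_root by blast+
  have *: "(\<forall>\<nu>\<in>dual H. act H (rev bs @ as) \<nu> = \<nu>) \<and> even (length (rev bs @ as))"
    by (rule simple_word_trivial) (use as bs eq in \<open>auto simp: act_rev r\<close>)
  then show "even (length as) = even (length bs)" by auto
  have "act H as \<nu> = act H bs \<nu>" if "\<nu> \<in> dual H" for \<nu>
    using * that act_rev'[OF r(2)] by (metis act_append)
  then show "word_map H as = word_map H bs" by (simp add: word_map_eq_iff)
qed

text \<open>An element is determined by its restriction to the positive roots, a map between finite
  sets. Finiteness is what later allows a maximum over the group.\<close>

lemma finite_weyl_group: "finite (weyl_group H (pos K))"
proof -
  let ?r = "\<lambda>w. restrict w (pos K)"
  have sub: "set as \<subseteq> orth_roots H K" if "as \<in> lists (simple K)" for as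
    using that simple_pos pos_orth_root by auto
  have d: "\<beta> \<in> dual H" if "\<beta> \<in> pos K" for \<beta> using that pos_root roots_dual by blast
  have "?r ` weyl_group H (pos K) \<subseteq> PiE (pos K) (\<lambda>_. orth_roots H K)"
    unfolding weyl_group_orth word_map_def
    using sub act_orth pos_orth_root d by fastforce
  moreover have "finite (orth_roots H K)"
    using finite_roots orth_root by (meson finite_subset subsetI)
  ultimately have "finite (?r ` weyl_group H (pos K))"
    using pos_finite[of K] by (meson finite_PiE finite_subset)
  moreover have "inj_on ?r (weyl_group H (pos K))"
  proof (rule inj_onI)
    fix v w assume "v \<in> weyl_group H (pos K)" "w \<in> weyl_group H (pos K)" and eq: "?r v = ?r w"
    then obtain as bs where *: "set as \<subseteq> simple K" "set bs \<subseteq> simple K"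
      "v = word_map H as" "w = word_map H bs"
      unfolding weyl_group_orth by auto
    have "act H as \<beta> = act H bs \<beta>" if "\<beta> \<in> pos K" for \<beta>
      using fun_cong[OF eq, of \<beta>] that d[OF that] * by (simp add: word_map_def)
    then show "v = w" using simple_words_eq * by blast
  qed
  ultimately show ?thesis by (rule finite_imageD)
qed

text \<open>The sign is defined by a shortest word; any other word for the same element has the same
  parity.\<close>

lemma weyl_sign_word:
  assumes "as \<in> lists \<Gamma>"
  shows "weyl_sign H \<Gamma> (word_map H as) = (- 1) ^ length as"
proof -
  define P where "P = (\<lambda>n. \<exists>bs. length bs = n \<and> set bs \<subseteq> \<Gamma> \<and>
    word_map H as = foldr (\<lambda>\<alpha> v. reflection H \<alpha> \<otimes>\<^bsub>BijGroup (dual H)\<^esub> v) bs \<one>\<^bsub>BijGroup (dual H)\<^esub>)"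
  have r: "set bs \<subseteq> roots H" if "set bs \<subseteq> \<Gamma>" for bs using that base_roots by blast
  have as: "set as \<subseteq> \<Gamma>" using assms by auto
  have "P (length as)"
    unfolding P_def foldr_reflection[OF r[OF as], symmetric] using as by blast
  then have "P (weyl_length H \<Gamma> (word_map H as))"
    unfolding weyl_length_def P_def by (rule LeastI)
  then obtain bs where bs: "length bs = weyl_length H \<Gamma> (word_map H as)" "set bs \<subseteq> \<Gamma>"
    "word_map H as = word_map H bs"
    unfolding P_def using foldr_reflection r by metis
  have "act H as \<beta> = act H bs \<beta>" if "\<beta> \<in> pos {}" for \<beta>
    using bs(3) roots_dual[OF pos_root[OF that]] unfolding word_map_eq_iff by blast
  then have "even (length as) = even (length bs)"
    by (intro simple_words_eq[of _ "{}"]) (use bs as in \<open>auto simp: simple_empty\<close>)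
  then show ?thesis unfolding weyl_sign_def bs(1)[symmetric] by (simp add: minus_one_power_iff)
qed

end

section \<open>The decomposition of the dual space\<close>

lemma proj_along_eqI:
  assumes "y \<in> K" "x - y \<in> L" "\<And>z. z \<in> K \<Longrightarrow> z - y \<in> L \<Longrightarrow> z = y" "\<And>a b. a \<in> L \<Longrightarrow> b \<in> L \<Longrightarrow> a - b \<in> L"
  shows "proj_along K L x = y"
  unfolding proj_along_def
proof (rule the_equality)
  fix z assume z: "z \<in> K \<and> x - z \<in> L"
  then have "(x - y) - (x - z) \<in> L" using assms by blast
  then show "z = y" using z assms(3) by simp
qed (use assms in blast)

lemma annihilator_diff: "f \<in> annihilator H K \<Longrightarrow> g \<in> annihilator H K \<Longrightarrow> f - g \<in> annihilator H K"
  by (auto simp: annihilator_def)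

locale orthogonal_decomposition = based_root_system +
  fixes Ha :: "'a set" and \<mu> :: "'a \<Rightarrow> complex"
  assumes Ha_subspace: "lie.subspace Ha" and Ha_subset: "Ha \<subseteq> H"
    and direct_sum: "direct_sum3 H Ha (orth_cartan H Ha) (orth_rest B H Ha)"
    and dominant: "\<mu> \<in> dominant_integral H \<Gamma>"
begin

abbreviation "Hp \<equiv> orth_cartan H Ha"
abbreviation "Hr \<equiv> orth_rest B H Ha"

lemma Hp_subspace: "lie.subspace Hp"
  by (simp add: orth_cartan_def)

lemma Hp_subset: "Hp \<subseteq> H"
  unfolding orth_cartan_def
  by (rule lie.span_minimal) (auto intro: H_subspace coroot_in_H orth_root)

lemma B_zero_left: "B 0 y = 0"
  using B_scale_left[of 0 0 y] by simp

lemma Hr_subspace: "lie.subspace Hr"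
  unfolding lie.subspace_def orth_rest_def using H_subspace
  by (auto simp: lie.subspace_0 lie.subspace_add H_scale B_zero_left B_add_left B_scale_left)

lemma Hr_subset: "Hr \<subseteq> H"
  by (auto simp: orth_rest_def)

lemma coroot_Hp: "\<beta> \<in> orth_roots H Ha \<Longrightarrow> coroot H \<beta> \<in> Hp"
  unfolding orth_cartan_def by (rule lie.span_base) simp

lemma decomposition_exists:
  assumes "h \<in> H"
  obtains x y z where "x \<in> Ha" "y \<in> Hp" "z \<in> Hr" "h = x + y + z"
  using assms direct_sum unfolding direct_sum3_def by blast

lemma decomposition_unique:
  assumes "x \<in> Ha" "y \<in> Hp" "z \<in> Hr" "x' \<in> Ha" "y' \<in> Hp" "z' \<in> Hr" "x + y + z = x' + y' + z'"
  shows "x = x'" "y = y'" "z = z'"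
proof -
  have "(x - x') + (y - y') + (z - z') = 0"
    using assms(7) by (simp add: algebra_simps)
  then have "x - x' = 0 \<and> y - y' = 0 \<and> z - z' = 0"
    using assms direct_sum Ha_subspace Hp_subspace Hr_subspace
    unfolding direct_sum3_def by (blast intro: lie.subspace_diff)
  then show "x = x'" "y = y'" "z = z'" by auto
qed

lemma dual_through_projection:
  assumes "\<nu> \<in> dual H" "\<And>h. h \<in> H \<Longrightarrow> f h \<in> H" "\<And>h k. h \<in> H \<Longrightarrow> k \<in> H \<Longrightarrow> f (h + k) = f h + f k"
    "\<And>c h. h \<in> H \<Longrightarrow> f (c *\<^sub>C h) = c *\<^sub>C f h"
  shows "(\<lambda>h. if h \<in> H then \<nu> (f h) else 0) \<in> dual H"
  using assms H_subspace
  by (auto simp: dual_def lie.subspace_add H_scale)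

text \<open>The three components are \<open>\<nu>\<close> composed with the projections of
  \<open>H\<close> onto its summands.\<close>

lemma dual_decomposition:
  assumes \<nu>: "\<nu> \<in> dual H"
  obtains \<kappa> \<pi> \<eta> where "\<kappa> \<in> sub_dual B H Ha" "\<pi> \<in> orth_dual B H Ha" "\<eta> \<in> rest_dual H Ha"
    "\<nu> = \<kappa> + \<pi> + \<eta>"
proof -
  have "\<forall>h\<in>H. \<exists>x y z. x \<in> Ha \<and> y \<in> Hp \<and> z \<in> Hr \<and> h = x + y + z"
    using decomposition_exists by metis
  then obtain p q r where pqr: "\<And>h. h \<in> H \<Longrightarrow> p h \<in> Ha" "\<And>h. h \<in> H \<Longrightarrow> q h \<in> Hp"
    "\<And>h. h \<in> H \<Longrightarrow> r h \<in> Hr" "\<And>h. h \<in> H \<Longrightarrow> h = p h + q h + r h"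
    by metis
  note sub = Ha_subspace Hp_subspace Hr_subspace
  have zero: "0 \<in> Ha" "0 \<in> Hp" "0 \<in> Hr" using sub lie.subspace_0 by auto
  \<comment> \<open>Uniqueness of the components yields both the linearity of the chosen projections
    and their values on the summands.\<close>
  have eval: "p h = x" "q h = y" "r h = z"
    if "x \<in> Ha" "y \<in> Hp" "z \<in> Hr" "h = x + y + z" for h x y z
  proof -
    have "h \<in> H" using that Ha_subset Hp_subset Hr_subset H_subspace by (auto intro!: lie.subspace_add)
    then show "p h = x" "q h = y" "r h = z"
      using decomposition_unique[of "p h" "q h" "r h" x y z] pqr that by metis+
  qed
  have add: "p (h + k) = p h + p k \<and> q (h + k) = q h + q k \<and> r (h + k) = r h + r k"
    if "h \<in> H" "k \<in> H" for h k
  proof -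
    have "h + k = (p h + p k) + (q h + q k) + (r h + r k)"
      using pqr(4)[OF that(1)] pqr(4)[OF that(2)] by (metis (no_types, lifting) add.assoc add.commute)
    then show ?thesis
      using eval[of "p h + p k" "q h + q k" "r h + r k" "h + k"] pqr that sub lie.subspace_add by metis
  qed
  have scale: "p (c *\<^sub>C h) = c *\<^sub>C p h \<and> q (c *\<^sub>C h) = c *\<^sub>C q h \<and> r (c *\<^sub>C h) = c *\<^sub>C r h"
    if "h \<in> H" for c h
  proof -
    have "c *\<^sub>C h = c *\<^sub>C p h + c *\<^sub>C q h + c *\<^sub>C r h"
      using pqr(4)[OF that] by (metis scaleC_add_right)
    then show ?thesis
      using eval[of "c *\<^sub>C p h" "c *\<^sub>C q h" "c *\<^sub>C r h" "c *\<^sub>C h"] pqr that sub lie.subspace_scale by metis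
  qed
  have inH: "p h \<in> H" "q h \<in> H" "r h \<in> H" if "h \<in> H" for h
    using pqr that Ha_subset Hp_subset Hr_subset by blast+
  let ?\<kappa> = "\<lambda>h. if h \<in> H then \<nu> (p h) else 0"
  let ?\<pi> = "\<lambda>h. if h \<in> H then \<nu> (q h) else 0"
  let ?\<eta> = "\<lambda>h. if h \<in> H then \<nu> (r h) else 0"
  have \<nu>0: "\<nu> 0 = 0" using dual_scaleD[OF \<nu> H_zero, of 0] by simp
  have d: "?\<kappa> \<in> dual H" "?\<pi> \<in> dual H" "?\<eta> \<in> dual H"
    using \<nu> inH add scale by (auto intro!: dual_through_projection)
  have Ha: "p h = h" "q h = 0" "r h = 0" if "h \<in> Ha" for h using eval[of h 0 0 h] that zero by auto
  have Hp: "p h = 0" "q h = h" "r h = 0" if "h \<in> Hp" for h using eval[of 0 h 0 h] that zero by auto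
  have Hr: "p h = 0" "q h = 0" "r h = h" if "h \<in> Hr" for h using eval[of 0 0 h h] that zero by auto
  have "?\<kappa> \<in> sub_dual B H Ha" "?\<pi> \<in> orth_dual B H Ha" "?\<eta> \<in> rest_dual H Ha"
    using d by (auto simp: sub_dual_def orth_dual_def rest_dual_def annihilator_def Ha Hp Hr \<nu>0)
  moreover have "\<nu> = ?\<kappa> + ?\<pi> + ?\<eta>"
  proof (rule dual_eqI[OF \<nu>])
    show "?\<kappa> + ?\<pi> + ?\<eta> \<in> dual H" using d by blast
    fix h assume h: "h \<in> H"
    have "\<nu> h = \<nu> (p h + q h + r h)" using pqr(4)[OF h] by simp
    also have "\<dots> = \<nu> (p h) + \<nu> (q h) + \<nu> (r h)"
      using inH[OF h] H_subspace by (simp add: dual_addD[OF \<nu>] lie.subspace_add)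
    finally show "\<nu> h = (?\<kappa> + ?\<pi> + ?\<eta>) h" using h by simp
  qed
  ultimately show thesis using that by blast
qed

lemma tilde_dualD:
  assumes "\<tau> \<in> tilde_dual B H Ha"
  shows "\<tau> \<in> dual H" "y \<in> Hp \<Longrightarrow> \<tau> y = 0"
  using assms by (auto simp: tilde_dual_def sub_dual_def rest_dual_def annihilator_def)

lemma tilde_dual_diff:
  assumes "\<sigma> \<in> tilde_dual B H Ha" "\<tau> \<in> tilde_dual B H Ha"
  shows "\<sigma> - \<tau> \<in> tilde_dual B H Ha"
proof -
  obtain a b a' b' where "\<sigma> = a + b" "\<tau> = a' + b'" "a \<in> sub_dual B H Ha" "a' \<in> sub_dual B H Ha"
    "b \<in> rest_dual H Ha" "b' \<in> rest_dual H Ha"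
    using assms by (auto simp: tilde_dual_def)
  then have "\<sigma> - \<tau> = (a - a') + (b - b')" "a - a' \<in> sub_dual B H Ha" "b - b' \<in> rest_dual H Ha"
    by (auto simp: sub_dual_def rest_dual_def intro: annihilator_diff)
  then show ?thesis unfolding tilde_dual_def by blast
qed

lemma orth_dualD:
  assumes "\<tau> \<in> orth_dual B H Ha"
  shows "\<tau> \<in> dual H" "x \<in> Ha \<Longrightarrow> \<tau> x = 0" "z \<in> Hr \<Longrightarrow> \<tau> z = 0"
  using assms by (auto simp: orth_dual_def annihilator_def)

lemma orth_dual_diff: "\<sigma> \<in> orth_dual B H Ha \<Longrightarrow> \<tau> \<in> orth_dual B H Ha \<Longrightarrow> \<sigma> - \<tau> \<in> orth_dual B H Ha"
  unfolding orth_dual_def by (rule annihilator_diff)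

lemma orth_dual_tilde_dual_disjoint:
  assumes "\<tau> \<in> orth_dual B H Ha" "\<tau> \<in> tilde_dual B H Ha"
  shows "\<tau> = 0"
proof (rule dual_eqI[OF orth_dualD(1)[OF assms(1)] dual_zero])
  fix h assume "h \<in> H"
  then obtain x y z where xyz: "x \<in> Ha" "y \<in> Hp" "z \<in> Hr" "h = x + y + z"
    by (rule decomposition_exists)
  then have "x \<in> H" "y \<in> H" "z \<in> H" using Ha_subset Hp_subset Hr_subset by auto
  then show "\<tau> h = 0 h"
    using xyz orth_dualD[OF assms(1)] tilde_dualD(2)[OF assms(2)] H_subspace
    by (simp add: dual_addD lie.subspace_add)
qed

lemma proj_eqI:
  assumes "\<pi> \<in> orth_dual B H Ha" "\<nu> - \<pi> \<in> tilde_dual B H Ha"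
  shows "proj_orth B H Ha \<nu> = \<pi>" "proj_tilde B H Ha \<nu> = \<nu> - \<pi>"
proof -
  show "proj_orth B H Ha \<nu> = \<pi>"
    unfolding proj_orth_def
    using assms orth_dual_tilde_dual_disjoint orth_dual_diff tilde_dual_diff
    by (intro proj_along_eqI) (metis eq_iff_diff_eq_0)+
  have "z = \<nu> - \<pi>" if "z \<in> tilde_dual B H Ha" "z - (\<nu> - \<pi>) \<in> orth_dual B H Ha" for z
    using that assms orth_dual_tilde_dual_disjoint tilde_dual_diff by (metis eq_iff_diff_eq_0)
  moreover have "\<nu> - (\<nu> - \<pi>) \<in> orth_dual B H Ha" using assms(1) by simp
  ultimately show "proj_tilde B H Ha \<nu> = \<nu> - \<pi>"
    unfolding proj_tilde_def using assms(2) orth_dual_diff by (intro proj_along_eqI) blast+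
qed

lemma proj_orth_dual: "\<nu> \<in> dual H \<Longrightarrow> proj_orth B H Ha \<nu> \<in> orth_dual B H Ha"
  and proj_orth_complement: "\<nu> \<in> dual H \<Longrightarrow> \<nu> - proj_orth B H Ha \<nu> \<in> tilde_dual B H Ha"
proof -
  assume \<nu>: "\<nu> \<in> dual H"
  obtain \<kappa> \<pi> \<eta> where *: "\<kappa> \<in> sub_dual B H Ha" "\<pi> \<in> orth_dual B H Ha" "\<eta> \<in> rest_dual H Ha"
    "\<nu> = \<kappa> + \<pi> + \<eta>" using dual_decomposition[OF \<nu>] .
  have "\<nu> - \<pi> = \<kappa> + \<eta>" unfolding *(4) by (simp add: algebra_simps)
  then have t: "\<nu> - \<pi> \<in> tilde_dual B H Ha" using * unfolding tilde_dual_def by blast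
  then show "proj_orth B H Ha \<nu> \<in> orth_dual B H Ha" "\<nu> - proj_orth B H Ha \<nu> \<in> tilde_dual B H Ha"
    using proj_eqI(1)[OF *(2) t] *(2) by auto
qed

lemma proj_tilde_eq: "\<nu> \<in> dual H \<Longrightarrow> proj_tilde B H Ha \<nu> = \<nu> - proj_orth B H Ha \<nu>"
  using proj_eqI(2) proj_orth_dual proj_orth_complement by blast

text \<open>The complementary component vanishes on \<open>Hp\<close>. As the coroots of the partner
  lie there, the chamber condition can be read off the unprojected weight.\<close>

lemma proj_orth_Hp: "\<nu> \<in> dual H \<Longrightarrow> y \<in> Hp \<Longrightarrow> proj_orth B H Ha \<nu> y = \<nu> y"
  using tilde_dualD(2)[OF proj_orth_complement] by fastforce

lemma proj_orth_diff:
  assumes "\<nu> \<in> dual H" "\<sigma> \<in> dual H"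
  shows "proj_orth B H Ha (\<nu> - \<sigma>) = proj_orth B H Ha \<nu> - proj_orth B H Ha \<sigma>"
proof (rule proj_eqI)
  show "proj_orth B H Ha \<nu> - proj_orth B H Ha \<sigma> \<in> orth_dual B H Ha"
    using assms by (intro orth_dual_diff proj_orth_dual)
  have "\<nu> - \<sigma> - (proj_orth B H Ha \<nu> - proj_orth B H Ha \<sigma>) =
      (\<nu> - proj_orth B H Ha \<nu>) - (\<sigma> - proj_orth B H Ha \<sigma>)" by (simp add: algebra_simps)
  then show "\<nu> - \<sigma> - (proj_orth B H Ha \<nu> - proj_orth B H Ha \<sigma>) \<in> tilde_dual B H Ha"
    using assms by (simp only:) (intro tilde_dual_diff proj_orth_complement)
qed

text \<open>On \<open>Hr\<close> the root is proportional to pairing with its coroot under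
  \<open>B\<close>, and \<open>Hr\<close> is orthogonal to that coroot.\<close>

lemma orth_root_orth_dual:
  assumes \<beta>: "\<beta> \<in> orth_roots H Ha"
  shows "\<beta> \<in> orth_dual B H Ha"
proof -
  have \<beta>r: "\<beta> \<in> roots H" using \<beta> by (rule orth_root)
  obtain c where c: "c \<noteq> 0" "\<And>h. h \<in> H \<Longrightarrow> B (coroot H \<beta>) h = c * \<beta> h" using B_coroot[OF \<beta>r] by metis
  have "\<beta> z = 0" if z: "z \<in> Hr" for z
  proof -
    have "B z (0 + coroot H \<beta>) = 0"
      using z coroot_Hp[OF \<beta>] lie.subspace_0[OF Ha_subspace] unfolding orth_rest_def by blast
    then have "B (coroot H \<beta>) z = 0" by (simp add: B_commute)
    then show ?thesis using c z Hr_subset by auto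
  qed
  then show ?thesis using \<beta> roots_dual[OF \<beta>r] by (auto simp: orth_dual_def annihilator_def orth_roots_def)
qed

abbreviation "\<rho> \<equiv> half_sum (pos {})"
abbreviation "\<rho>p \<equiv> half_sum (pos Ha)"

lemma rho_orth_dual: "\<rho>p \<in> orth_dual B H Ha"
proof -
  have "\<rho>p x = 0" if "x \<in> Ha \<union> Hr" for x
  proof -
    have "\<forall>\<beta>\<in>pos Ha. \<beta> x = 0" using orth_root_orth_dual pos_orth_root that orth_dualD by blast
    then have "(\<Sum>\<beta>\<in>pos Ha. \<beta> x) = 0" by (intro sum.neutral) simp
    then show ?thesis by (simp add: half_sum_def)
  qed
  then show ?thesis using half_sum_pos_dual by (simp add: orth_dual_def annihilator_def)
qed

lemma act_tilde_dual:
  assumes "set as \<subseteq> orth_roots H Ha" "\<tau> \<in> tilde_dual B H Ha"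
  shows "act H as \<tau> = \<tau>"
  using assms(1)
proof (induction as)
  case (Cons \<beta> as)
  then have "\<tau> (coroot H \<beta>) = 0" using tilde_dualD(2)[OF assms(2)] coroot_Hp by simp
  then show ?case using Cons by (simp add: reflect_def)
qed simp

section \<open>Representatives of the cosets\<close>

abbreviation "\<mu>\<rho> \<equiv> \<mu> + \<rho>"

lemma mu_rho_dual: "\<mu>\<rho> \<in> dual H"
  using dominant half_sum_pos_dual[of "{}"] by (auto simp: dominant_integral_def)

lemma half_sum_pairing:
  assumes "\<beta> \<in> pos K"
  obtains n where "half_sum (pos K) (coroot H \<beta>) = of_nat (Suc n)"
proof -
  have "half_sum (pos K) (coroot H \<beta>) \<in> range (\<lambda>n. of_nat (Suc n))"
  proof (rule pos_coroot_closed[OF half_sum_pos_dual _ _ assms])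
    fix a b :: complex assume "a \<in> range (\<lambda>n. of_nat (Suc n))" "b \<in> range (\<lambda>n. of_nat (Suc n))"
    then obtain m n where "a = of_nat (Suc m)" "b = of_nat (Suc n)" by auto
    then have "a + b = of_nat (Suc (m + Suc n))" by simp
    then show "a + b \<in> range (\<lambda>n. of_nat (Suc n))" by blast
  next
    fix \<alpha> assume "\<alpha> \<in> simple K"
    then show "half_sum (pos K) (coroot H \<alpha>) \<in> range (\<lambda>n. of_nat (Suc n))"
      using half_sum_simple by (intro image_eqI[of _ _ 0]) auto
  qed
  then show thesis using that by blast
qed

lemma mu_rho_pairing:
  assumes "\<beta> \<in> pos {}"
  obtains n where "\<mu>\<rho> (coroot H \<beta>) = of_nat (Suc n)"
proof -
  obtain m where m: "\<rho> (coroot H \<beta>) = of_nat (Suc m)" using half_sum_pairing[OF assms] .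
  obtain k where k: "\<mu> (coroot H \<beta>) = of_nat k"
    using dominant assms unfolding dominant_integral_def pos_empty Nats_def by auto
  have "\<mu>\<rho> (coroot H \<beta>) = of_nat (Suc (k + m))" using m k by simp
  then show thesis using that by blast
qed

text \<open>Regularity of \<open>\<mu> + \<rho>\<close> along its orbit: the inverse word moves the
  pairing back to \<open>\<mu> + \<rho>\<close> and some root, where it is a positive integer up to
  sign.\<close>

lemma orbit_pairing:
  assumes as: "set as \<subseteq> roots H" and \<gamma>: "\<gamma> \<in> roots H"
  obtains m :: int where "act H as \<mu>\<rho> (coroot H \<gamma>) = of_int m" "m \<noteq> 0"
proof -
  let ?\<beta> = "act H (rev as) \<gamma>"
  have \<beta>: "?\<beta> \<in> roots H" using act_roots as \<gamma> by simp
  have "act H as \<mu>\<rho> (coroot H (act H as ?\<beta>)) = \<mu>\<rho> (coroot H ?\<beta>)"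
    by (rule act_pairing[OF as \<beta> mu_rho_dual])
  then have eq: "act H as \<mu>\<rho> (coroot H \<gamma>) = \<mu>\<rho> (coroot H ?\<beta>)"
    using act_rev'[OF as] by simp
  consider "?\<beta> \<in> pos {}" | "- ?\<beta> \<in> pos {}"
    using pos_or_neg[of ?\<beta> "{}"] \<beta> by (auto simp: orth_roots_empty)
  then show thesis
  proof cases
    case 1
    then obtain n where "\<mu>\<rho> (coroot H ?\<beta>) = of_nat (Suc n)" by (rule mu_rho_pairing)
    then show thesis using that[of "int (Suc n)"] eq by simp
  next
    case 2
    then obtain n where n: "\<mu>\<rho> (coroot H (- ?\<beta>)) = of_nat (Suc n)" by (rule mu_rho_pairing)
    have "\<mu>\<rho> (coroot H (- ?\<beta>)) = - \<mu>\<rho> (coroot H ?\<beta>)"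
      unfolding coroot_uminus[OF \<beta> uminus_root[OF \<beta>]]
      by (rule dual_uminusD[OF mu_rho_dual coroot_in_H[OF \<beta>]])
    then have "act H as \<mu>\<rho> (coroot H \<gamma>) = of_int (- int (Suc n))"
      using n eq by (metis add.inverse_inverse of_int_minus of_int_of_nat_eq)
    then show thesis using that by fastforce
  qed
qed

lemma word_map_apply: "\<nu> \<in> dual H \<Longrightarrow> word_map H as \<nu> = act H as \<nu>"
  by (simp add: word_map_def)

text \<open>The projection of \<open>\<rho>\<close> coming from the shift cancels against the one in
  the defect.\<close>

lemma weight_orth_eq:
  assumes "set as \<subseteq> roots H"
  shows "weight_orth B H Ha \<Gamma> \<mu> (word_map H as) = proj_orth B H Ha (act H as \<mu>\<rho>) - \<rho>p"
proof -
  have "act H as \<mu>\<rho> \<in> dual H" using act_dual[OF assms mu_rho_dual] .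
  then show ?thesis
    using half_sum_pos_dual[of "{}"]
    unfolding weight_orth_def defect_def pos_empty[symmetric] word_map_apply[OF mu_rho_dual]
    by (simp add: proj_orth_diff)
qed

lemma weight_tilde_eq:
  assumes "set as \<subseteq> roots H"
  shows "weight_tilde B H Ha \<Gamma> \<mu> (word_map H as) =
    act H as \<mu>\<rho> - proj_orth B H Ha (act H as \<mu>\<rho>) - \<rho> + \<rho>p"
proof -
  have d: "act H as \<mu>\<rho> \<in> dual H" using act_dual[OF assms mu_rho_dual] .
  have "act H as \<mu>\<rho> - \<rho> \<in> dual H" using d half_sum_pos_dual[of "{}"] by blast
  then show ?thesis
    using half_sum_pos_dual[of "{}"] d
    unfolding weight_tilde_def defect_def pos_empty[symmetric] word_map_apply[OF mu_rho_dual]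
    by (simp add: proj_orth_diff proj_tilde_eq algebra_simps)
qed

text \<open>Adding the positive value of \<open>\<rho>p\<close> turns the weak inequality into a
  strict one. The converse must recover the lost shift, which is 1 only on simple coroots, so it is
  checked there and then propagated.\<close>

lemma weyl_reps_iff:
  assumes as: "set as \<subseteq> roots H"
  shows "word_map H as \<in> weyl_reps B H Ha \<Gamma> \<mu> \<longleftrightarrow>
    (\<forall>\<beta>\<in>pos Ha. Re (act H as \<mu>\<rho> (coroot H \<beta>)) > 0)"
proof -
  define \<xi> where "\<xi> = act H as \<mu>\<rho>"
  define \<sigma> where "\<sigma> = proj_orth B H Ha \<xi> - \<rho>p"
  have \<xi>: "\<xi> \<in> dual H" unfolding \<xi>_def using act_dual[OF as mu_rho_dual] .
  have \<sigma>: "\<sigma> \<in> orth_dual B H Ha" "\<sigma> \<in> dual H"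
    unfolding \<sigma>_def using orth_dual_diff proj_orth_dual[OF \<xi>] rho_orth_dual orth_dualD(1) by blast+
  have val: "\<sigma> (coroot H \<beta>) = \<xi> (coroot H \<beta>) - \<rho>p (coroot H \<beta>)" if "\<beta> \<in> pos Ha" for \<beta>
    unfolding \<sigma>_def using proj_orth_Hp[OF \<xi> coroot_Hp[OF pos_orth_root[OF that]]] by simp
  have "word_map H as \<in> weyl_group H (roots H)"
    using as by (simp add: weyl_group_words in_lists_conv_set subset_iff)
  then have "word_map H as \<in> weyl_reps B H Ha \<Gamma> \<mu> \<longleftrightarrow> (\<forall>\<beta>\<in>pos Ha. \<sigma> (coroot H \<beta>) \<in> \<real>\<^sub>\<ge>\<^sub>0)"
    using \<sigma>(1) by (simp add: weyl_reps_def orth_chamber_def weight_orth_eq[OF as] \<sigma>_def \<xi>_def)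
  also have "\<dots> \<longleftrightarrow> (\<forall>\<beta>\<in>pos Ha. Re (\<xi> (coroot H \<beta>)) > 0)"
  proof (intro iffI ballI)
    fix \<beta> assume "\<forall>\<beta>\<in>pos Ha. \<sigma> (coroot H \<beta>) \<in> \<real>\<^sub>\<ge>\<^sub>0" and \<beta>: "\<beta> \<in> pos Ha"
    then have "Re (\<sigma> (coroot H \<beta>)) \<ge> 0" by (auto simp: nonneg_Reals_def)
    moreover obtain n where "\<rho>p (coroot H \<beta>) = of_nat (Suc n)" using half_sum_pairing[OF \<beta>] .
    ultimately show "Re (\<xi> (coroot H \<beta>)) > 0" using val[OF \<beta>] by simp
  next
    fix \<beta> assume pos: "\<forall>\<beta>\<in>pos Ha. Re (\<xi> (coroot H \<beta>)) > 0" and \<beta>: "\<beta> \<in> pos Ha"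
    \<comment> \<open>On a simple coroot the pairing with \<open>\<xi>\<close> is a positive
      integer, so subtracting 1 leaves a natural number.\<close>
    have "\<sigma> (coroot H \<beta>) \<in> \<nat>"
    proof (rule pos_coroot_closed[OF \<sigma>(2) Nats_add _ \<beta>])
      fix \<alpha> assume \<alpha>: "\<alpha> \<in> simple Ha"
      obtain m where m: "\<xi> (coroot H \<alpha>) = of_int m"
        using orbit_pairing[OF as simple_root[OF \<alpha>]] unfolding \<xi>_def by metis
      have "m > 0" using pos simple_pos[OF \<alpha>] m by fastforce
      then have "\<sigma> (coroot H \<alpha>) = of_nat (nat (m - 1))"
        using val[OF simple_pos[OF \<alpha>]] m half_sum_simple[OF \<alpha>] by simp
      then show "\<sigma> (coroot H \<alpha>) \<in> \<nat>" by simp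
    qed
    then show "\<sigma> (coroot H \<beta>) \<in> \<real>\<^sub>\<ge>\<^sub>0" by (auto elim!: Nats_cases)
  qed
  finally show ?thesis unfolding \<xi>_def .
qed

lemma weyl_reps_word:
  assumes "u \<in> weyl_reps B H Ha \<Gamma> \<mu>"
  obtains as where "as \<in> lists \<Gamma>" "u = word_map H as"
  using assms unfolding weyl_reps_def weyl_group_full by blast

lemma weyl_orth_subset: "weyl_group H (pos Ha) \<subseteq> weyl_group H (roots H)"
proof -
  have sub: "pos Ha \<subseteq> roots H" using pos_root by blast
  show ?thesis unfolding weyl_group_words[OF sub] weyl_group_words[OF order_refl]
    by (rule image_mono) (use lists_mono[OF sub] in blast)
qed

lemma weyl_sign_mult:
  assumes "v \<in> weyl_group H (roots H)" "w \<in> weyl_group H (roots H)"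
  shows "weyl_sign H \<Gamma> (v \<otimes>\<^bsub>BijGroup (dual H)\<^esub> w) = weyl_sign H \<Gamma> v * weyl_sign H \<Gamma> w"
proof -
  obtain as bs where *: "as \<in> lists \<Gamma>" "bs \<in> lists \<Gamma>" "v = word_map H as" "w = word_map H bs"
    using assms unfolding weyl_group_full by blast
  then have "set as \<subseteq> roots H" "set bs \<subseteq> roots H" using base_roots by auto
  then have "v \<otimes>\<^bsub>BijGroup (dual H)\<^esub> w = word_map H (as @ bs)" using * word_map_mult by simp
  then show ?thesis using * by (simp add: weyl_sign_word power_add)
qed

text \<open>The maximized quantity is the real part of \<open>ht\<close>, which on a general weight
  is just a complex number. Only its change under a reflection matters, and that is an
  integer.\<close>

lemma coset_representative:
  assumes ws: "set ws \<subseteq> roots H"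
  obtains as where "set as \<subseteq> pos Ha" "word_map H (as @ ws) \<in> weyl_reps B H Ha \<Gamma> \<mu>"
proof -
  define \<xi> where "\<xi> = act H ws \<mu>\<rho>"
  have \<xi>: "\<xi> \<in> dual H" unfolding \<xi>_def using act_dual[OF ws mu_rho_dual] .
  have sub: "pos Ha \<subseteq> roots H" using pos_root by blast
  note W = weyl_group_words[OF sub]
  let ?f = "\<lambda>v. Re (ht (v \<xi>))"
  have fin: "finite (?f ` weyl_group H (pos Ha))" using finite_weyl_group by simp
  have "?f ` weyl_group H (pos Ha) \<noteq> {}" unfolding W by auto
  from Max_in[OF fin this] obtain v where
    "v \<in> weyl_group H (pos Ha)" "?f v = Max (?f ` weyl_group H (pos Ha))" by auto
  then have v: "v \<in> weyl_group H (pos Ha)" "\<And>w. w \<in> weyl_group H (pos Ha) \<Longrightarrow> ?f w \<le> ?f v"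
    using fin by auto
  then obtain as where as: "set as \<subseteq> pos Ha" "v = word_map H as" unfolding W by auto
  have asr: "set (as @ ws) \<subseteq> roots H" using as ws sub by auto
  have "Re (act H (as @ ws) \<mu>\<rho> (coroot H \<beta>)) > 0" if \<beta>: "\<beta> \<in> pos Ha" for \<beta>
  proof -
    obtain m where m: "act H (as @ ws) \<mu>\<rho> (coroot H \<beta>) = of_int m" "m \<noteq> 0"
      using orbit_pairing[OF asr pos_root[OF \<beta>]] .
    \<comment> \<open>One more reflection changes the maximized value by
      \<open>- m * height \<beta>\<close>; maximality gives \<open>m \<ge> 0\<close>, and regularity
      excludes 0.\<close>
    have "word_map H (\<beta> # as) \<in> weyl_group H (pos Ha)"
      unfolding W using as(1) \<beta> by (intro imageI) auto
    from v(2)[OF this] have "Re (ht (reflect H \<beta> (act H as \<xi>))) \<le> Re (ht (act H as \<xi>))"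
      using as(2) by (simp add: word_map_apply[OF \<xi>])
    then have "of_int m * real (height \<beta>) \<ge> 0"
      using m(1) unfolding ht_reflect by (simp add: \<xi>_def pos_height(1)[OF \<beta>])
    then have "m > 0" using m(2) pos_height(2)[OF \<beta>] by (auto simp: zero_le_mult_iff)
    then show ?thesis using m(1) by simp
  qed
  then show thesis using that[OF as(1)] weyl_reps_iff[OF asr] by blast
qed

lemma coset_decomposition:
  "bij_betw (\<lambda>(u, v). v \<otimes>\<^bsub>BijGroup (dual H)\<^esub> u)
    (weyl_reps B H Ha \<Gamma> \<mu> \<times> weyl_group H (pos Ha)) (weyl_group H (roots H))"
proof (rule bij_betw_imageI)
  have sub: "pos Ha \<subseteq> roots H" using pos_root by blast
  show "inj_on (\<lambda>(u, v). v \<otimes>\<^bsub>BijGroup (dual H)\<^esub> u)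
    (weyl_reps B H Ha \<Gamma> \<mu> \<times> weyl_group H (pos Ha))"
  proof (rule inj_onI, clarify)
    fix u v u' v'
    assume u: "u \<in> weyl_reps B H Ha \<Gamma> \<mu>" "u' \<in> weyl_reps B H Ha \<Gamma> \<mu>"
      and v: "v \<in> weyl_group H (pos Ha)" "v' \<in> weyl_group H (pos Ha)"
      and eq: "v \<otimes>\<^bsub>BijGroup (dual H)\<^esub> u = v' \<otimes>\<^bsub>BijGroup (dual H)\<^esub> u'"
    obtain bs bs' where bs: "bs \<in> lists \<Gamma>" "u = word_map H bs" "bs' \<in> lists \<Gamma>" "u' = word_map H bs'"
      using u weyl_reps_word by metis
    obtain as as' where as: "set as \<subseteq> simple Ha" "v = word_map H as" "set as' \<subseteq> simple Ha" "v' = word_map H as'"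
      using v unfolding weyl_group_orth by auto
    have r: "set as \<subseteq> roots H" "set as' \<subseteq> roots H" "set bs \<subseteq> roots H" "set bs' \<subseteq> roots H"
      using as bs simple_root base_roots by auto
    have "word_map H (as @ bs) = word_map H (as' @ bs')"
      using eq as bs word_map_mult r by simp
    then have eq: "act H as (act H bs \<nu>) = act H as' (act H bs' \<nu>)" if "\<nu> \<in> dual H" for \<nu>
      using that by (simp add: word_map_eq_iff)
    \<comment> \<open>This word represents the inverse of \<open>v'\<close> times \<open>v\<close>
      and carries \<open>u (\<mu> + \<rho>)\<close> to \<open>u' (\<mu> + \<rho>)\<close>. Both are
      strictly dominant for the partner, so it cannot make a positive root negative.\<close>
    define cs where "cs = rev as' @ as"
    have cs: "set cs \<subseteq> simple Ha" using as by (auto simp: cs_def)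
    then have csr: "set cs \<subseteq> roots H" "set cs \<subseteq> orth_roots H Ha"
      using simple_root simple_pos pos_orth_root by blast+
    have cs_act: "act H cs (act H bs \<nu>) = act H bs' \<nu>" if "\<nu> \<in> dual H" for \<nu>
      using eq[OF that] act_rev[OF r(2)] by (simp add: cs_def)
    have "act H cs \<beta> \<in> pos Ha" if \<beta>: "\<beta> \<in> pos Ha" for \<beta>
    proof (rule ccontr)
      assume neg: "act H cs \<beta> \<notin> pos Ha"
      let ?\<gamma> = "act H cs \<beta>"
      have o: "?\<gamma> \<in> orth_roots H Ha" using act_orth[OF csr(2) pos_orth_root[OF \<beta>]] .
      have \<gamma>: "?\<gamma> \<in> roots H" using orth_root[OF o] .
      have n: "- ?\<gamma> \<in> pos Ha" using uminus_pos_iff[OF o] neg by blast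
      have d: "act H bs \<mu>\<rho> \<in> dual H" "act H bs' \<mu>\<rho> \<in> dual H" using act_dual r mu_rho_dual by auto
      have "act H bs' \<mu>\<rho> (coroot H ?\<gamma>) = act H bs \<mu>\<rho> (coroot H \<beta>)"
        using act_pairing[OF csr(1) pos_root[OF \<beta>] d(1)] cs_act[OF mu_rho_dual] by simp
      moreover have "act H bs' \<mu>\<rho> (coroot H (- ?\<gamma>)) = - act H bs' \<mu>\<rho> (coroot H ?\<gamma>)"
        unfolding coroot_uminus[OF \<gamma> uminus_root[OF \<gamma>]]
        by (rule dual_uminusD[OF d(2) coroot_in_H[OF \<gamma>]])
      moreover have "Re (act H bs \<mu>\<rho> (coroot H \<beta>)) > 0"
        using u(1) weyl_reps_iff[OF r(3)] bs(2) \<beta> by blast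
      moreover have "Re (act H bs' \<mu>\<rho> (coroot H (- ?\<gamma>))) > 0"
        using u(2) weyl_reps_iff[OF r(4)] bs(4) n by blast
      ultimately show False by simp
    qed
    then have id: "act H cs \<nu> = \<nu>" if "\<nu> \<in> dual H" for \<nu>
      using simple_word_trivial[OF cs] that by blast
    have "act H as \<nu> = act H as' \<nu>" if "\<nu> \<in> dual H" for \<nu>
    proof -
      have "act H as' (act H cs \<nu>) = act H as \<nu>" using act_rev'[OF r(2)] by (simp add: cs_def)
      then show ?thesis using id[OF that] by simp
    qed
    moreover have "act H bs \<nu> = act H bs' \<nu>" if "\<nu> \<in> dual H" for \<nu>
      using cs_act[OF that] id[OF act_dual[OF r(3) that]] by simp
    ultimately show "u = u' \<and> v = v'" using as bs by (simp add: word_map_eq_iff)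
  qed
  show "(\<lambda>(u, v). v \<otimes>\<^bsub>BijGroup (dual H)\<^esub> u) `
    (weyl_reps B H Ha \<Gamma> \<mu> \<times> weyl_group H (pos Ha)) = weyl_group H (roots H)"
  proof (intro equalityI subsetI)
    fix w assume "w \<in> (\<lambda>(u, v). v \<otimes>\<^bsub>BijGroup (dual H)\<^esub> u) `
      (weyl_reps B H Ha \<Gamma> \<mu> \<times> weyl_group H (pos Ha))"
    then obtain u v where "u \<in> weyl_group H (roots H)" "v \<in> weyl_group H (roots H)"
      "w = v \<otimes>\<^bsub>BijGroup (dual H)\<^esub> u"
      using weyl_orth_subset unfolding weyl_reps_def by auto
    then show "w \<in> weyl_group H (roots H)" unfolding weyl_group_def by (simp add: generate.eng)
  next
    fix w assume "w \<in> weyl_group H (roots H)"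
    then obtain ws where ws: "set ws \<subseteq> roots H" "w = word_map H ws"
      using weyl_group_words[OF order_refl] by auto
    obtain as where as: "set as \<subseteq> pos Ha" "word_map H (as @ ws) \<in> weyl_reps B H Ha \<Gamma> \<mu>"
      using coset_representative[OF ws(1)] .
    have r: "set as \<subseteq> roots H" using as sub by blast
    \<comment> \<open>The reversed word undoes the passage from \<open>w\<close> to its coset
      representative.\<close>
    have "word_map H (rev as) \<otimes>\<^bsub>BijGroup (dual H)\<^esub> word_map H (as @ ws) = word_map H (rev as @ as @ ws)"
      using r ws by (intro word_map_mult) auto
    also have "\<dots> = w" unfolding ws(2) word_map_eq_iff by (simp add: act_rev[OF r])
    finally have "w = word_map H (rev as) \<otimes>\<^bsub>BijGroup (dual H)\<^esub> word_map H (as @ ws)" by simp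
    moreover have "word_map H (rev as) \<in> weyl_group H (pos Ha)"
      unfolding weyl_group_words[OF sub] using as by (intro imageI) auto
    ultimately show "w \<in> (\<lambda>(u, v). v \<otimes>\<^bsub>BijGroup (dual H)\<^esub> u) `
      (weyl_reps B H Ha \<Gamma> \<mu> \<times> weyl_group H (pos Ha))"
      using as(2) by force
  qed
qed

section \<open>Comparison of exponents and summation over the cosets\<close>

lemma fexp_mult: "fexp \<nu> * fexp \<sigma> = fexp (\<nu> + \<sigma>)"
  by (simp add: fexp_def mult_single)

lemma exponent_decomposition:
  assumes u: "u \<in> weyl_reps B H Ha \<Gamma> \<mu>" and v: "v \<in> weyl_group H (pos Ha)"
  shows "weight_tilde B H Ha \<Gamma> \<mu> u + (v (weight_orth B H Ha \<Gamma> \<mu> u + \<rho>p) - \<rho>p) =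
    (v \<otimes>\<^bsub>BijGroup (dual H)\<^esub> u) \<mu>\<rho> - \<rho>"
proof -
  have sub: "pos Ha \<subseteq> roots H" using pos_root by blast
  obtain bs where bs: "bs \<in> lists \<Gamma>" "u = word_map H bs" using weyl_reps_word u by metis
  obtain as where as: "set as \<subseteq> pos Ha" "v = word_map H as"
    using v unfolding weyl_group_words[OF sub] by auto
  have r: "set as \<subseteq> roots H" "set bs \<subseteq> roots H" "set as \<subseteq> orth_roots H Ha"
    using as bs base_roots sub pos_orth_root by auto
  define \<xi> where "\<xi> = act H bs \<mu>\<rho>"
  define \<pi> where "\<pi> = proj_orth B H Ha \<xi>"
  have \<xi>: "\<xi> \<in> dual H" unfolding \<xi>_def using act_dual[OF r(2) mu_rho_dual] .
  have \<pi>: "\<pi> \<in> dual H" unfolding \<pi>_def using orth_dualD(1) proj_orth_dual[OF \<xi>] .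
  \<comment> \<open>Only the partner component \<open>\<pi>\<close> of \<open>\<xi>\<close> is moved
    by the small group; the rest passes unchanged into the coefficient
    \<open>weight_tilde\<close>.\<close>
  have "act H as \<pi> + (\<xi> - \<pi>) = act H as \<pi> + act H as (\<xi> - \<pi>)"
    using act_tilde_dual[OF r(3)] proj_orth_complement[OF \<xi>] by (simp add: \<pi>_def)
  also have "\<dots> = act H as \<xi>" unfolding act_add[symmetric] by simp
  finally have *: "act H as \<pi> + (\<xi> - \<pi>) = act H as \<xi>" .
  have "v (weight_orth B H Ha \<Gamma> \<mu> u + \<rho>p) = act H as \<pi>"
    using \<pi> unfolding bs(2) weight_orth_eq[OF r(2)] as(2)
    by (simp add: \<xi>_def[symmetric] \<pi>_def[symmetric] word_map_apply)
  moreover have "weight_tilde B H Ha \<Gamma> \<mu> u = \<xi> - \<pi> - \<rho> + \<rho>p"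
    unfolding bs(2) weight_tilde_eq[OF r(2)] \<pi>_def \<xi>_def ..
  moreover have "(v \<otimes>\<^bsub>BijGroup (dual H)\<^esub> u) \<mu>\<rho> = act H as \<xi>"
    unfolding as(2) bs(2) word_map_mult[OF r(1,2)] word_map_apply[OF mu_rho_dual] act_append \<xi>_def ..
  ultimately show ?thesis unfolding *[symmetric] by (simp only:) (simp add: algebra_simps)
qed

lemma singular_decomposition:
  "singular_full H \<Gamma> \<mu> =
    (\<Sum>u\<in>weyl_reps B H Ha \<Gamma> \<mu>.
      of_int (weyl_sign H \<Gamma> u) * fexp (weight_tilde B H Ha \<Gamma> \<mu> u) *
        singular_orth H Ha \<Gamma> (weight_orth B H Ha \<Gamma> \<mu> u))"
proof -
  let ?G = "BijGroup (dual H)" and ?U = "weyl_reps B H Ha \<Gamma> \<mu>" and ?V = "weyl_group H (pos Ha)"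
  let ?g = "\<lambda>w. of_int (weyl_sign H \<Gamma> w) * fexp (w \<mu>\<rho> - \<rho>)"
  have summand: "?g (v \<otimes>\<^bsub>?G\<^esub> u) =
      of_int (weyl_sign H \<Gamma> u) * fexp (weight_tilde B H Ha \<Gamma> \<mu> u) *
        (of_int (weyl_sign H \<Gamma> v) * fexp (v (weight_orth B H Ha \<Gamma> \<mu> u + \<rho>p) - \<rho>p))"
    if u: "u \<in> ?U" and v: "v \<in> ?V" for u v
  proof -
    have "weyl_sign H \<Gamma> (v \<otimes>\<^bsub>?G\<^esub> u) = weyl_sign H \<Gamma> v * weyl_sign H \<Gamma> u"
      using u v weyl_orth_subset by (intro weyl_sign_mult) (auto simp: weyl_reps_def)
    then show ?thesis
      unfolding exponent_decomposition[OF u v, symmetric] fexp_mult[symmetric]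
      by (simp add: mult.assoc mult.left_commute)
  qed
  have "singular_full H \<Gamma> \<mu> = (\<Sum>w\<in>weyl_group H (roots H). ?g w)"
    by (simp add: singular_full_def singular_element_def pos_empty)
  also have "\<dots> = (\<Sum>(u, v)\<in>?U \<times> ?V. ?g (v \<otimes>\<^bsub>?G\<^esub> u))"
    using sum.reindex_bij_betw[OF coset_decomposition, of ?g] by (simp add: case_prod_unfold)
  also have "\<dots> = (\<Sum>u\<in>?U. \<Sum>v\<in>?V. ?g (v \<otimes>\<^bsub>?G\<^esub> u))"
    by (rule sum.cartesian_product[symmetric])
  also have "\<dots> = (\<Sum>u\<in>?U. of_int (weyl_sign H \<Gamma> u) * fexp (weight_tilde B H Ha \<Gamma> \<mu> u) *
        singular_orth H Ha \<Gamma> (weight_orth B H Ha \<Gamma> \<mu> u))"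
    unfolding singular_orth_def singular_element_def sum_distrib_left
    by (intro sum.cong refl summand)
  finally show ?thesis .
qed

end

text \<open>A base is linearly independent in the space of all complex functions, so prescribing the
  value 1 on it extends to a linear functional on that whole space. The extension is not canonical,
  but on roots it is determined by the base.\<close>

lemma height_functional_exists:
  fixes \<Gamma> :: "('g::fin_dim_complex_lie_algebra \<Rightarrow> complex) set"
  assumes "root_base H \<Gamma>"
  obtains ht :: "('g \<Rightarrow> complex) \<Rightarrow> complex" where "\<And>\<mu> \<nu>. ht (\<mu> + \<nu>) = ht \<mu> + ht \<nu>"
    "\<And>c \<nu>. ht (\<lambda>x. c * \<nu> x) = c * ht \<nu>" "\<And>\<alpha>. \<alpha> \<in> \<Gamma> \<Longrightarrow> ht \<alpha> = 1"
proof -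
  let ?s = "\<lambda>(c::complex) (f::'g \<Rightarrow> complex) x. c * f x"
  interpret fs: vector_space ?s
    by unfold_locales (auto simp: fun_eq_iff algebra_simps)
  interpret cs: vector_space "(*) :: complex \<Rightarrow> complex \<Rightarrow> complex"
    by unfold_locales (auto simp: algebra_simps)
  interpret vector_space_pair ?s "(*) :: complex \<Rightarrow> complex \<Rightarrow> complex" ..
  have "fs.independent \<Gamma>"
  proof (rule fs.independent_if_scalars_zero)
    fix c and \<alpha> assume 0: "(\<Sum>\<alpha>\<in>\<Gamma>. (\<lambda>x. c \<alpha> * \<alpha> x)) = 0" and "\<alpha> \<in> \<Gamma>"
    have "(\<Sum>\<alpha>\<in>A. (\<lambda>x. c \<alpha> * \<alpha> x)) z = (\<Sum>\<alpha>\<in>A. c \<alpha> * \<alpha> z)" for A z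
      by (induction A rule: infinite_finite_induct) simp_all
    from this[of \<Gamma>] have "\<forall>z. (\<Sum>\<alpha>\<in>\<Gamma>. c \<alpha> * \<alpha> z) = 0" unfolding 0 by simp
    moreover have "\<forall>c :: _ \<Rightarrow> complex. (\<forall>x. (\<Sum>\<alpha>\<in>\<Gamma>. c \<alpha> * \<alpha> x) = 0) \<longrightarrow> (\<forall>\<alpha>\<in>\<Gamma>. c \<alpha> = 0)"
      using assms unfolding root_base_def by (elim conjE)
    ultimately show "c \<alpha> = 0" using \<open>\<alpha> \<in> \<Gamma>\<close> by blast
  qed (use assms in \<open>simp add: root_base_def\<close>)
  from linear_independent_extend[OF this, of "\<lambda>_. 1"] obtain ht where
    "Vector_Spaces.linear ?s (*) ht" "\<forall>x\<in>\<Gamma>. ht x = 1" by blast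
  then show thesis
    using that[of ht] by (simp add: Vector_Spaces.linear_def module_hom_def module_hom_axioms_def)
qed

theorem lemma1:
  fixes B :: "'g::fin_dim_complex_lie_algebra \<Rightarrow> 'g \<Rightarrow> complex"
    and H A Ha :: "'g set"
    and \<Gamma> :: "('g \<Rightarrow> complex) set"
    and \<mu> :: "'g \<Rightarrow> complex"
  assumes "reductive (UNIV :: 'g set)"
    and "cartan_subalgebra UNIV H"
    and "invariant_form B"
    and "root_base H \<Gamma>"
    and "reductive A"
    and "cartan_subalgebra A Ha"
    and "Ha \<subseteq> H"
    and "direct_sum3 H Ha (orth_cartan H Ha) (orth_rest B H Ha)"
    and "\<mu> \<in> dominant_integral H \<Gamma>"
  shows "singular_full H \<Gamma> \<mu> =
    (\<Sum>u\<in>weyl_reps B H Ha \<Gamma> \<mu>.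
      of_int (weyl_sign H \<Gamma> u) * fexp (weight_tilde B H Ha \<Gamma> \<mu> u) *
        singular_orth H Ha \<Gamma> (weight_orth B H Ha \<Gamma> \<mu> u))"
proof -
  obtain ht :: "('g \<Rightarrow> complex) \<Rightarrow> complex" where ht: "\<And>\<mu> \<nu>. ht (\<mu> + \<nu>) = ht \<mu> + ht \<nu>"
    "\<And>c \<nu>. ht (\<lambda>x. c * \<nu> x) = c * ht \<nu>" "\<And>\<alpha>. \<alpha> \<in> \<Gamma> \<Longrightarrow> ht \<alpha> = 1"
    using height_functional_exists[OF assms(4)] by blast
  have "lie.subspace Ha" using assms(6) by (simp add: cartan_subalgebra_def)
  interpret orthogonal_decomposition H B \<Gamma> ht Ha \<mu>
    by unfold_locales (fact assms ht \<open>lie.subspace Ha\<close>)+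
  show ?thesis by (rule singular_decomposition)
qed

end
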